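(* Let $u$ be a radial solution of $S_k(D^2u)=g(u)$ in $B_1$. Then $u$ is semistable if and only if $$\int_{B_1}\left\{k\,c_{n,k}|x|^{1-k}(u')^{k-1}|\nabla\xi|^2+g'(u)\,\xi^2\right\}dx\geq 0$$ for every radially symmetric function $\xi\in C_c^{1}(B_1)$.
   Context: $n$ is a positive integer, $k\in\{1,\dots,n\}$, $B_1$ is the open unit ball of $\mathbb{R}^n$, $c_{n,k}=\binom{n}{k}/n$, $(\cdot,\cdot)$ is the Euclidean inner product, and $g:\mathbb{R}\to\mathbb{R}$ is a positive $C^1$ function. A function is radial if $u(x)=u(r)$, $r=|x|$; $u'$ is its derivative in $r$. $S_k(D^2u)=\sigma_k(\lambda(D^2u))$ is the $k$-th elementary symmetric function of the eigenvalues of the Hessian $D^2u$, and $S_k^{ij}(D^2u)=\frac{\partial}{\partial u_{ij}}S_k(D^2u)$, where $u_i=u_{x_i}$, $u_{ij}=u_{x_ix_j}$. For radial $u$, with $\lambda_1=u''$ and $\lambda_2=u'/r$, one has at $x\neq0$ $$S_k^{ij}(D^2u)=k\,c_{n,k}\left(\lambda_2^{k-1}\delta_{ij}+\frac{k-1}{n-1}\lambda_2^{k-2}(\lambda_1-\lambda_2)\Big(\delta_{ij}-\frac{x_ix_j}{|x|^2}\Big)\right)$$ (the second term is absent when $k=1$). Classical solution: $u\in C^2(B_1)\cap C(\overline{B_1})$, $u=0$ on $\partial B_1$, $\sigma_i(\lambda(D^2u))>0$ in $B_1$ for $i=1,\dots,k$, and $S_k(D^2u)=g(u)$ in $B_1$.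 Weak solution: $u\in L^{k+1}(B_1)$, $\int_{B_1}\sum u_iu_jS_k^{ij}(D^2u)<\infty$, $g(u)\in L^1(B_1)$ and $\int_{B_1}\{\frac1k\sum u_i\eta_jS_k^{ij}(D^2u)+g(u)\eta\}=0$ for all $\eta\in C_c^1(B_1)$ (for radial $u$, $\sum u_iu_jS_k^{ij}(D^2u)=k\,c_{n,k}(u'/r)^{k-1}(u')^2$ and $\sum u_i\eta_jS_k^{ij}(D^2u)=k\,c_{n,k}(u'/r)^k(x,\nabla\eta)$, which do not involve $u''$). "Solution" means classical or weak solution. Radial solutions are understood with $u'\ge0$ (weak radial solutions are then $C^2$ functions of $r$ on $(0,1]$). A solution $u$ is semistable if $$\int_{B_1}\left\{\sum\varphi_i\varphi_jS_k^{ij}(D^2u)+g'(u)\varphi^2\right\}dx\ge0\quad\text{for all }\varphi\in C_c^1(B_1\setminus\{0\})$$ ($\varphi$ not necessarily radial).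
   Formalization: The dimension is assumed to be n ≥ 2: for n = k = 1 the claim fails, e.g. u = 2 ln(cosh(bx)/cosh b), g(t) = (2b²/cosh²b)e^{-t} with b large. Integrals are read as extended-real; an undefined one (∞ − ∞) imposes no condition. *)

theory Defs
  imports "HOL-Analysis.Analysis" "HOL-Computational_Algebra.Computational_Algebra"
begin

section \<open>Derivatives and function classes\<close>

definition partial :: "'n \<Rightarrow> (real^'n \<Rightarrow> real) \<Rightarrow> real^'n \<Rightarrow> real" where
  "partial i f x = frechet_derivative f (at x) (axis i 1)"

definition grad :: "(real^'n \<Rightarrow> real) \<Rightarrow> real^'n \<Rightarrow> real^'n" where
  "grad f x = (\<chi> i. partial i f x)"

definition hessian :: "(real^'n \<Rightarrow> real) \<Rightarrow> real^'n \<Rightarrow> real^'n^'n" where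
  "hessian f x = (\<chi> i j. partial j (partial i f) x)"

text \<open>The following two classes are only used for open sets.\<close>

definition C1_on :: "(real^'n) set \<Rightarrow> (real^'n \<Rightarrow> real) \<Rightarrow> bool" where
  "C1_on S f \<longleftrightarrow> (\<forall>x\<in>S. f differentiable (at x)) \<and> (\<forall>i. continuous_on S (partial i f))"

definition C2_on :: "(real^'n) set \<Rightarrow> (real^'n \<Rightarrow> real) \<Rightarrow> bool" where
  "C2_on S f \<longleftrightarrow> C1_on S f \<and> (\<forall>i. C1_on S (partial i f))"

text \<open>Elements of \<open>C\<^sub>c\<^sup>1(S)\<close>, \<open>S\<close> open, are represented by their extension by zero to the whole space.\<close>

definition C1_compact_support :: "(real^'n) set \<Rightarrow> (real^'n \<Rightarrow> real) \<Rightarrow> bool" where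
  "C1_compact_support S f \<longleftrightarrow>
     C1_on UNIV f \<and> compact (closure {x. f x \<noteq> 0}) \<and> closure {x. f x \<noteq> 0} \<subseteq> S"

definition radially_symmetric :: "(real^'n \<Rightarrow> real) \<Rightarrow> bool" where
  "radially_symmetric f \<longleftrightarrow> (\<forall>x y. norm x = norm y \<longrightarrow> f x = f y)"

section \<open>The k-Hessian operator\<close>

definition elem_sym :: "nat \<Rightarrow> ('n::finite \<Rightarrow> 'a::comm_ring_1) \<Rightarrow> 'a" where
  "elem_sym k l = (\<Sum>I | card I = k. \<Prod>i\<in>I. l i)"

definition charpoly :: "real^'n^'n \<Rightarrow> complex poly" where
  "charpoly A = det (\<chi> i j. [: - complex_of_real (A $ i $ j), if i = j then 1 else 0 :])"

text \<open>The eigenvalues with algebraic multiplicity, in an arbitrary order. They are taken in the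
  complex numbers because the partial derivatives of \<open>S\<^sub>k\<close> below treat all entries of
  the matrix as independent variables, so that \<open>S\<^sub>k\<close> is also needed at matrices that
  are not symmetric.\<close>

definition eigvals :: "real^'n^'n \<Rightarrow> 'n \<Rightarrow> complex" where
  "eigvals A = (SOME l. charpoly A = (\<Prod>i\<in>UNIV. [: - l i, 1 :]))"

text \<open>The symmetric function of the eigenvalues is a real number, as they come in conjugate pairs;
  for symmetric matrices all eigenvalues are real.\<close>

definition Sk :: "nat \<Rightarrow> real^'n^'n \<Rightarrow> real" where
  "Sk k A = Re (elem_sym k (eigvals A))"

definition Sk_deriv :: "nat \<Rightarrow> real^'n^'n \<Rightarrow> 'n \<Rightarrow> 'n \<Rightarrow> real" where
  "Sk_deriv k A i j = deriv (\<lambda>t. Sk k (\<chi> p q. if p = i \<and> q = j then t else A $ p $ q)) (A $ i $ j)"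

text \<open>The bilinear form \<open>\<Sum> v\<^sub>i w\<^sub>j S\<^sub>k\<^sup>i\<^sup>j(D\<^sup>2u)\<close> at the point \<open>x\<close>.\<close>

definition Sk_form :: "nat \<Rightarrow> (real^'n \<Rightarrow> real) \<Rightarrow> real^'n \<Rightarrow> real^'n \<Rightarrow> real^'n \<Rightarrow> real" where
  "Sk_form k u x v w = (\<Sum>i\<in>UNIV. \<Sum>j\<in>UNIV. v $ i * w $ j * Sk_deriv k (hessian u x) i j)"

section \<open>Solutions\<close>

definition classical_solution :: "nat \<Rightarrow> (real \<Rightarrow> real) \<Rightarrow> (real^'n \<Rightarrow> real) \<Rightarrow> bool" where
  "classical_solution k g u \<longleftrightarrow>
     C2_on (ball 0 1) u \<and> continuous_on (cball 0 1) u \<and> (\<forall>x\<in>sphere 0 1. u x = 0) \<and>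
     (\<forall>x\<in>ball 0 1. \<forall>i\<in>{1..k}. Sk i (hessian u x) > 0) \<and>
     (\<forall>x\<in>ball 0 1. Sk k (hessian u x) = g (u x))"

text \<open>Radial weak solutions are of class \<open>C\<^sup>2\<close> away from the origin (for the
  representative we work with). This regularity is recorded in the first conjunct, so that
  \<open>u\<^sub>i\<close> and \<open>D\<^sup>2u\<close> are the classical derivatives, defined almost everywhere. No
  condition is imposed at the origin, where \<open>u\<close> may be singular.\<close>

definition weak_solution :: "nat \<Rightarrow> (real \<Rightarrow> real) \<Rightarrow> (real^'n \<Rightarrow> real) \<Rightarrow> bool" where
  "weak_solution k g u \<longleftrightarrow>
     C2_on (ball 0 1 - {0}) u \<and>
     set_borel_measurable lborel (ball 0 1) u \<and>
     set_integrable lborel (ball 0 1) (\<lambda>x. \<bar>u x\<bar> ^ (k + 1)) \<and>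
     set_integrable lborel (ball 0 1) (\<lambda>x. Sk_form k u x (grad u x) (grad u x)) \<and>
     set_integrable lborel (ball 0 1) (\<lambda>x. g (u x)) \<and>
     (\<forall>\<eta>. C1_compact_support (ball 0 1) \<eta> \<longrightarrow>
        (LINT x:ball 0 1|lborel. 1 / real k * Sk_form k u x (grad u x) (grad \<eta> x) + g (u x) * \<eta> x) = 0)"

section \<open>Semistability\<close>

text \<open>The inequality \<open>\<integral>\<^sub>S f \<ge> 0\<close> for the Lebesgue integral with values in the extended reals: the
  integral of the negative part is at most that of the positive part. In contrast to the Bochner
  integral, whose value is 0 for functions that are not integrable, an integral equal to \<open>-\<infinity>\<close>
  violates the inequality. If both parts have infinite integral, so that the integral is
  undefined, the inequality counts as satisfied.\<close>

definition integral_nonneg :: "'a::euclidean_space set \<Rightarrow> ('a \<Rightarrow> real) \<Rightarrow> bool" where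
  "integral_nonneg S f \<longleftrightarrow>
     (\<integral>\<^sup>+x\<in>S. ennreal (- f x) \<partial>lborel) \<le> (\<integral>\<^sup>+x\<in>S. ennreal (f x) \<partial>lborel)"

lemma integral_nonneg_iff:
  assumes "set_integrable lborel S f"
  shows "integral_nonneg S f \<longleftrightarrow> (LINT x:S|lborel. f x) \<ge> 0"
proof -
  let ?h = "\<lambda>x. indicator S x *\<^sub>R f x"
  have h: "integrable lborel ?h"
    using assms by (simp add: set_integrable_def)
  have pos: "(\<integral>\<^sup>+x\<in>S. ennreal (f x) \<partial>lborel) = (\<integral>\<^sup>+x. ennreal (?h x) \<partial>lborel)"
    by (intro nn_integral_cong) (auto simp: indicator_def)
  have neg: "(\<integral>\<^sup>+x\<in>S. ennreal (- f x) \<partial>lborel) = (\<integral>\<^sup>+x. ennreal (- ?h x) \<partial>lborel)"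
    by (intro nn_integral_cong) (auto simp: indicator_def)
  have fin: "(\<integral>\<^sup>+x. ennreal (?h x) \<partial>lborel) < \<infinity>" "(\<integral>\<^sup>+x. ennreal (- ?h x) \<partial>lborel) < \<infinity>"
    using h by (auto simp: real_integrable_def top.not_eq_extremum)
  have "integral\<^sup>L lborel ?h =
      enn2real (\<integral>\<^sup>+x. ennreal (?h x) \<partial>lborel) - enn2real (\<integral>\<^sup>+x. ennreal (- ?h x) \<partial>lborel)"
    using real_lebesgue_integral_def[OF h] .
  then show ?thesis
    unfolding integral_nonneg_def set_lebesgue_integral_def pos neg
    using fin by (cases "\<integral>\<^sup>+x. ennreal (?h x) \<partial>lborel"; cases "\<integral>\<^sup>+x. ennreal (- ?h x) \<partial>lborel")
      (auto simp: ennreal_le_iff)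
qed

definition semistable :: "nat \<Rightarrow> (real \<Rightarrow> real) \<Rightarrow> (real^'n \<Rightarrow> real) \<Rightarrow> bool" where
  "semistable k g u \<longleftrightarrow>
     (\<forall>\<phi>. C1_compact_support (ball 0 1 - {0}) \<phi> \<longrightarrow>
        integral_nonneg (ball 0 1)
          (\<lambda>x. Sk_form k u x (grad \<phi> x) (grad \<phi> x) + deriv g (u x) * (\<phi> x)\<^sup>2))"

end

theory Submission imports Defs begin

text \<open>
  Write \<open>n\<close> for the dimension, \<open>r = |x|\<close>, \<open>\<lambda>\<^sub>1 = u''\<close>, \<open>\<lambda>\<^sub>2 = u' / r\<close> and
  \<open>A = k c \<lambda>\<^sub>2\<^sup>k\<^sup>-\<^sup>1\<close> with \<open>c = c\<^bsub>n,k\<^esub>\<close>. Away from the origin the Hessian of \<open>u\<close> is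
  \<open>\<lambda>\<^sub>2 I + (\<lambda>\<^sub>1 - \<lambda>\<^sub>2) x x\<^sup>T / r\<^sup>2\<close>, and differentiating the characteristic polynomial entry by entry
  gives (\<open>Sk_form_u\<close>) the quadratic form
  \<open>A |\<nabla>\<phi>|\<^sup>2 + T (|\<nabla>\<phi>|\<^sup>2 - \<phi>\<^sub>r\<^sup>2) = A \<phi>\<^sub>r\<^sup>2 + (A + T) (|\<nabla>\<phi>|\<^sup>2 - \<phi>\<^sub>r\<^sup>2)\<close>,
  where \<open>\<phi>\<^sub>r\<close> is the radial derivative. So the form equals \<open>A |\<nabla>\<phi>|\<^sup>2\<close> for radial \<open>\<phi>\<close>.

  \<^emph>\<open>From radial test functions to all test functions.\<close> The tangential coefficient \<open>A + T\<close> is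
  nonnegative: up to positive factors it is \<open>(n - k) \<lambda>\<^sub>2 + (k - 1) \<lambda>\<^sub>1\<close> when \<open>k > 1\<close>, whereas
  \<open>S\<^sub>k = g(u) > 0\<close> says that \<open>(n - k) \<lambda>\<^sub>2 + k \<lambda>\<^sub>1\<close> is positive (\<open>tangential_weight_nonneg\<close>). Hence it is
  enough to treat the form \<open>A \<phi>\<^sub>r\<^sup>2 + g'(u) \<phi>\<^sup>2\<close>, which involves \<open>\<phi>\<close> along each ray separately. The
  restriction of \<open>\<phi>\<close> to the ray through a unit vector \<open>\<theta>\<close>, extended radially, is an admissible radial
  test function, and integrating the resulting inequalities over all directions \<open>\<theta>\<close> gives the claim
  (\<open>nn_integral_le_of_rays\<close>, \<open>semistable_if_radially\<close>).

  \<^emph>\<open>From all test functions to radial ones.\<close> Semistability speaks about test functions that vanish near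
  the origin, so a radial \<open>\<xi>\<close> has to be cut off there. This costs nothing in the limit because the origin
  has zero capacity for the weight \<open>A\<close>: as \<open>r\<^sup>n\<^sup>-\<^sup>1 A(r) \<le> C r\<close> near \<open>0\<close>, a cutoff that is linear in
  \<open>ln r / m\<close> up to smoothing has energy \<open>O(1 / m)\<close> (\<open>cutoff_energy\<close>). The potential \<open>g'(u)\<close> may fail to
  be integrable at the origin; its positive and negative parts are kept apart, and the negative part
  passes to the limit by Fatou's lemma (\<open>radially_if_semistable\<close>).

  \<^emph>\<open>The growth bound.\<close> The equation reads \<open>c P' = r\<^sup>n\<^sup>-\<^sup>1 g(u)\<close> for the flux
  \<open>P = r\<^sup>n\<^sup>-\<^sup>k (u')\<^sup>k\<close>, and \<open>P(0+) = 0\<close>. For weak solutions both statements come from test functions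
  that are constant near the origin (\<open>weak_flux_eq_integral\<close>). If \<open>n \<ge> 2 k\<close>, boundedness of \<open>P\<close> already
  yields the bound. If \<open>n < 2 k\<close>, it shows that \<open>u\<close> is bounded near the origin, so that integrating the equation
  from \<open>P(0+) = 0\<close> gives \<open>P = O(r\<^sup>n)\<close> and \<open>u' = O(r)\<close> (\<open>flux_weight_bound\<close>).
\<close>

text \<open>The symbol \<open>$\<close> also denotes coefficients of power series; in what follows it only denotes vector components.\<close>

unbundle no fps_syntax

section \<open>Elementary symmetric functions of a rank one perturbation\<close>

text \<open>Vieta's formulas. They let the symmetric functions of the eigenvalues be read off the characteristic
polynomial without ever naming the eigenvalues.\<close>

lemma coeff_prod_linear_factors:
  fixes l :: "'n::finite \<Rightarrow> 'a::comm_ring_1"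
  assumes "k \<le> CARD('n)"
  shows "coeff (\<Prod>i\<in>UNIV. [:- l i, 1:]) (CARD('n) - k) = (-1) ^ k * elem_sym k l"
proof -
  have lin: "[:- l i, 1:] = [:- l i:] + monom 1 1" for i
    by (simp add: monom_altdef)
  have summand: "coeff ((\<Prod>i\<in>I. [:- l i:]) * (\<Prod>i\<in>UNIV - I. monom 1 1)) (CARD('n) - k)
      = (if card I = k then (-1) ^ k * (\<Prod>i\<in>I. l i) else 0)" for I :: "'n set"
  proof -
    have "(\<Prod>i\<in>I. [:- l i:]) = [:\<Prod>i\<in>I. - l i:]"
      by (induction I rule: infinite_finite_induct) auto
    moreover have "(\<Prod>i\<in>UNIV - I. monom 1 1 :: 'a poly) = monom 1 (CARD('n) - card I)"
      by (simp add: monom_power card_Diff_subset)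
    moreover have "card I \<le> CARD('n)"
      by (rule card_mono) auto
    ultimately show ?thesis
      using assms by (auto simp: prod_uminus)
  qed
  have "coeff (\<Prod>i\<in>UNIV. [:- l i, 1:]) (CARD('n) - k)
      = (\<Sum>I\<in>UNIV. if card I = k then (-1) ^ k * (\<Prod>i\<in>I. l i) else 0)"
    unfolding lin prod_add[OF finite] by (simp only: coeff_sum summand Pow_UNIV)
  also have "\<dots> = (\<Sum>I | card I = k. (-1) ^ k * (\<Prod>i\<in>I. l i))"
    by (simp add: sum.If_cases)
  finally show ?thesis
    by (simp add: elem_sym_def sum_distrib_left)
qed

lemma poly_charpoly_of_real:
  fixes A :: "real^'n^'n"
  shows "poly (charpoly A) (complex_of_real z) = complex_of_real (det (mat z - A))"
proof -
  have "poly [:- complex_of_real (A $ i $ j), if i = j then 1 else 0:] (complex_of_real z)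
      = complex_of_real ((mat z - A) $ i $ j)" for i j
    by (simp add: mat_def)
  then show ?thesis
    by (simp add: charpoly_def det_def poly_sum poly_prod del: poly_pCons)
qed

lemma monic_complex_poly_splits:
  fixes p :: "complex poly"
  assumes "degree p = CARD('n::finite)" "lead_coeff p = 1"
  shows "\<exists>l :: 'n \<Rightarrow> complex. p = (\<Prod>i\<in>UNIV. [:- l i, 1:])"
proof -
  from assms have "p \<noteq> 0" by auto
  then obtain M where M: "size M = CARD('n)" "p = (\<Prod>x\<in>#M. [:- x, 1:])"
    using alg_closed_imp_factorization[of p] assms by auto
  obtain xs where xs: "mset xs = M"
    using ex_mset by blast
  obtain b where b: "bij_betw b (UNIV :: 'n set) {0..<CARD('n)}"
    using ex_bij_betw_finite_nat[of "UNIV :: 'n set"] by auto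
  have len: "length xs = CARD('n)"
    using M xs by auto
  have "p = prod_list (map (\<lambda>x. [:- x, 1:]) xs)"
    using M(2) xs by (metis mset_map prod_mset_prod_list)
  also have "\<dots> = (\<Prod>m\<in>{0..<CARD('n)}. [:- xs ! m, 1:])"
    by (simp add: prod.list_conv_set_nth len)
  also have "\<dots> = (\<Prod>i\<in>(UNIV :: 'n set). [:- xs ! b i, 1:])"
    using prod.reindex_bij_betw[OF b, of "\<lambda>m. [:- xs ! m, 1:]"] by simp
  finally show ?thesis by (rule exI[of _ "\<lambda>i. xs ! b i"])
qed

text \<open>The choice of eigenvalues in the definition is harmless as soon as the characteristic polynomial splits,
and a monic complex polynomial of the right degree does.\<close>

lemma Sk_eq_coeff_charpoly:
  fixes A :: "real^'n^'n"
  assumes "degree (charpoly A) = CARD('n)" "lead_coeff (charpoly A) = 1" "k \<le> CARD('n)"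
  shows "Sk k A = Re ((-1) ^ k * coeff (charpoly A) (CARD('n) - k))"
proof -
  have "charpoly A = (\<Prod>i\<in>UNIV. [:- eigvals A i, 1:])"
    using someI_ex[OF monic_complex_poly_splits[OF assms(1,2)]] by (simp only: eigvals_def)
  from arg_cong[OF this, of "\<lambda>p. coeff p (CARD('n) - k)"]
  have "coeff (charpoly A) (CARD('n) - k) = (-1) ^ k * elem_sym k (eigvals A)"
    by (simp add: coeff_prod_linear_factors[OF assms(3)])
  then have "(-1) ^ k * coeff (charpoly A) (CARD('n) - k) = elem_sym k (eigvals A)"
    by (simp flip: mult.assoc power_mult_distrib)
  then show ?thesis
    by (simp add: Sk_def)
qed

text \<open>An orthogonal change of basis taking a coordinate axis to \<open>x\<close> makes the matrix diagonal.\<close>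

lemma det_rank_one_update:
  fixes x :: "real^'n"
  assumes "norm x = 1"
  shows "det (\<chi> p q. (if p = q then y else 0) - m * x $ p * x $ q) = y ^ (CARD('n) - 1) * (y - m)"
proof -
  fix k :: 'n
  obtain Q :: "real^'n^'n" where Q: "orthogonal_matrix Q" "Q *v axis k 1 = x"
    using orthogonal_matrix_exists_basis[OF assms] by metis
  have xQ: "x $ p = Q $ p $ k" for p
    unfolding Q(2)[symmetric]
    by (simp add: matrix_vector_mult_def axis_def if_distrib cong: if_cong)
  define d where "d l = (if l = k then y - m else y)" for l
  define D :: "real^'n^'n" where "D = (\<chi> p q. if p = q then d p else 0)"
  have QQ: "Q ** transpose Q = mat 1"
    using Q(1) by (simp add: orthogonal_matrix_def)
  have ortho: "(\<Sum>l\<in>UNIV. Q $ p $ l * Q $ q $ l) = (if p = q then 1 else 0)" for p q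
    using QQ by (simp add: matrix_matrix_mult_def transpose_def mat_def vec_eq_iff)
  have "(Q ** D ** transpose Q) $ p $ q = (if p = q then y else 0) - m * x $ p * x $ q" for p q
  proof -
    have "(Q ** D ** transpose Q) $ p $ q
        = (\<Sum>l\<in>UNIV. Q $ p $ l * d l * Q $ q $ l)"
      by (simp add: matrix_matrix_mult_def transpose_def D_def if_distrib cong: if_cong)
    also have "\<dots> = (\<Sum>l\<in>UNIV. y * (Q $ p $ l * Q $ q $ l) - (if l = k then m * (Q $ p $ l * Q $ q $ l) else 0))"
      by (intro sum.cong) (auto simp: d_def algebra_simps)
    also have "\<dots> = y * (if p = q then 1 else 0) - m * (Q $ p $ k * Q $ q $ k)"
      by (simp add: sum_subtractf ortho flip: sum_distrib_left)
    finally show ?thesis by (simp add: xQ)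
  qed
  then have "(\<chi> p q. (if p = q then y else 0) - m * x $ p * x $ q) = Q ** D ** transpose Q"
    by (simp add: vec_eq_iff)
  also have "det \<dots> = det D * det (Q ** transpose Q)"
    by (simp add: det_mul)
  also have "\<dots> = det D"
    by (simp add: QQ)
  also have "\<dots> = (\<Prod>i\<in>UNIV. if i = k then y - m else y)"
    unfolding D_def by (subst det_diagonal) (auto simp: d_def)
  also have "\<dots> = y ^ (CARD('n) - 1) * (y - m)"
    by (subst prod.remove[of _ k]) (auto simp: card_Diff_subset)
  finally show ?thesis .
qed

text \<open>The determinant is affine in each single entry, and by Cramer's rule its slope is the determinant times
an entry of the inverse matrix, which is explicit for a rank one perturbation of a multiple of the
identity. The excluded values of \<open>y\<close> are those where that matrix is singular.\<close>

lemma det_rank_one_update_entry: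
  fixes x :: "real^'n"
  assumes x: "norm x = 1" and y: "y \<noteq> 0" "y \<noteq> m" and n: "CARD('n) \<ge> 2"
  shows "det (\<chi> p q. (if p = q then y else 0) - m * x $ p * x $ q - (if p = i \<and> q = j then s else 0))
    = y ^ (CARD('n) - 2) *
        (y * (y - m) - s * ((if i = j then 1 else 0) * (y - m) + m * x $ i * x $ j))"
proof -
  define B :: "real^'n^'n" where "B = (\<chi> p q. (if p = q then y else 0) - m * x $ p * x $ q)"
  define w :: "real^'n" where
    "w = (\<chi> p. ((if p = j then 1 else 0) + m * x $ j * x $ p / (y - m)) / y)"
  have xx: "(\<Sum>p\<in>UNIV. x $ p * x $ p) = 1"
    using x by (simp add: norm_eq_1 inner_vec_def)
  \<comment> \<open>\<open>w\<close> is the \<open>j\<close>-th row of the inverse of \<open>B\<close>.\<close>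
  have wB: "(\<Sum>p\<in>UNIV. w $ p *s row p B) = axis j 1"
  proof (rule vec_eq_iff[THEN iffD2], rule allI)
    fix q
    have "(\<Sum>p\<in>UNIV. w $ p *s row p B) $ q = (\<Sum>p\<in>UNIV. w $ p * B $ p $ q)"
      by (simp add: row_def)
    also have "\<dots> = (\<Sum>p\<in>UNIV. (if p = q then w $ p * y else 0) - (m * x $ q / y) * ((if p = j then x $ p else 0)
          + (m * x $ j / (y - m)) * (x $ p * x $ p)))"
      by (intro sum.cong) (auto simp: B_def w_def divide_inverse algebra_simps)
    also have "\<dots> = w $ q * y - (m * x $ q / y) * (x $ j + (m * x $ j / (y - m)))"
      by (simp only: sum_subtractf sum.distrib sum_distrib_left[symmetric] xx) simp
    also have "x $ j + (m * x $ j / (y - m)) = x $ j * y / (y - m)"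
      using y by (simp add: divide_simps) (simp add: algebra_simps)
    also have "w $ q * y - (m * x $ q / y) * (x $ j * y / (y - m)) = (if q = j then 1 else 0)"
      using y by (simp add: w_def)
    finally show "(\<Sum>p\<in>UNIV. w $ p *s row p B) $ q = axis j 1 $ q"
      by (simp add: axis_def)
  qed
  have "(\<chi> p q. (if p = q then y else 0) - m * x $ p * x $ q - (if p = i \<and> q = j then s else 0))
      = (\<chi> p. if p = i then row p B + (- s) *s axis j 1 else row p B)"
    by (auto simp: vec_eq_iff B_def row_def axis_def)
  also have "det \<dots> = det (\<chi> p. if p = i then row p B else row p B)
      + det (\<chi> p. if p = i then (- s) *s axis j 1 else row p B)"
    by (rule det_row_add)
  also have "det (\<chi> p. if p = i then (- s) *s axis j 1 else row p B)
      = (- s) * det (\<chi> p. if p = i then axis j 1 else row p B)"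
    by (rule det_row_mul)
  also have "det (\<chi> p. if p = i then axis j 1 else row p B) = w $ i * det B"
    using cramer_lemma_transpose[where x = w and k = i and A = B] unfolding wB .
  also have "(\<chi> p. if p = i then row p B else row p B) = B"
    by (auto simp: vec_eq_iff row_def)
  also have "det B = y ^ (CARD('n) - 1) * (y - m)"
    unfolding B_def by (rule det_rank_one_update[OF x])
  also have "CARD('n) - 1 = Suc (CARD('n) - 2)"
    using n by simp
  also have "w $ i = ((if i = j then 1 else 0) * (y - m) + m * x $ i * x $ j) / (y * (y - m))"
    using y by (simp add: w_def divide_simps)
  finally show ?thesis
    using y by (simp add: divide_simps) (simp add: algebra_simps)
qed

text \<open>The preceding determinant, evaluated at all but two real points, determines the polynomial.\<close>

lemma charpoly_rank_one_update_entry: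
  fixes x :: "real^'n" and A :: "real^'n^'n" and a m s :: real and i j :: 'n
  defines "A \<equiv> \<chi> p q. (if p = q then a else 0) + m * x $ p * x $ q + (if p = i \<and> q = j then s else 0)"
  defines "d \<equiv> (if i = j then 1 else 0) :: real"
  assumes x: "norm x = 1" and n: "CARD('n) \<ge> 2"
  shows "charpoly A = [:- complex_of_real a, 1:] ^ (CARD('n) - 2)
    * ([:- complex_of_real a, 1:]\<^sup>2 - smult (complex_of_real (m + s * d)) [:- complex_of_real a, 1:]
       + [:complex_of_real (m * s * (d - x $ i * x $ j)):])" (is "_ = ?P")
proof -
  define Z where "Z = complex_of_real ` (UNIV - {a, a + m})"
  have "poly (charpoly A) z = poly ?P z" if "z \<in> Z" for z
  proof -
    from that obtain t where t: "z = complex_of_real t" "t - a \<noteq> 0" "t - a \<noteq> m"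
      by (fastforce simp: Z_def)
    have "mat t - A = (\<chi> p q. (if p = q then t - a else 0) - m * x $ p * x $ q - (if p = i \<and> q = j then s else 0))"
      by (auto simp: A_def vec_eq_iff mat_def)
    then have "det (mat t - A) = (t - a) ^ (CARD('n) - 2) *
        ((t - a) * ((t - a) - m) - s * (d * ((t - a) - m) + m * x $ i * x $ j))"
      using det_rank_one_update_entry[OF x t(2,3) n, of i j s] by (simp add: d_def)
    also have "complex_of_real \<dots> = poly ?P z"
      by (simp add: t(1) power2_eq_square algebra_simps)
    finally show ?thesis
      by (simp add: t(1) poly_charpoly_of_real)
  qed
  moreover have "infinite Z"
    unfolding Z_def by (subst finite_image_iff) (auto intro: inj_onI simp: infinite_UNIV_char_0)
  ultimately have "infinite {z. poly (charpoly A - ?P) z = 0}"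
    by (elim contrapos_nn) (auto elim!: finite_subset[rotated])
  then have "charpoly A - ?P = 0"
    using poly_roots_finite by blast
  then show ?thesis
    by (simp only: right_minus_eq)
qed

lemma coeff_linear_power_sub:
  assumes "r \<le> N"
  shows "coeff ([:- complex_of_real a, 1:] ^ N) (N - r) = complex_of_real (real (N choose r) * (- a) ^ r)"
  unfolding coeff_linear_poly_power[OF diff_le_self] diff_diff_cancel[OF assms]
    binomial_symmetric[OF assms, symmetric] by simp

text \<open>In powers of \<open>X - a\<close> the characteristic polynomial has only three terms, and their coefficients are
binomial. The result is affine in \<open>s\<close>, so the derivative with respect to an entry can be read off.\<close>

theorem Sk_rank_one_update_entry:
  fixes x :: "real^'n"
  defines "n \<equiv> CARD('n)"
  assumes x: "norm x = 1" and n: "n \<ge> 2" and k: "k \<in> {1..n}"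
  shows "Sk k (\<chi> p q. (if p = q then a else 0) + m * x $ p * x $ q + (if p = i \<and> q = j then s else 0))
    = real (n choose k) * a ^ k
      + (m + s * (if i = j then 1 else 0)) * real ((n - 1) choose (k - 1)) * a ^ (k - 1)
      + m * s * ((if i = j then 1 else 0) - x $ i * x $ j)
          * (if k = 1 then 0 else real ((n - 2) choose (k - 2)) * a ^ (k - 2))"
    (is "Sk k ?A = _")
proof -
  define p where "p = m + s * (if i = j then 1 else 0)"
  define q where "q = m * s * ((if i = j then 1 else 0) - x $ i * x $ j)"
  define L where "L = [:- complex_of_real a, 1:]"
  have cp: "charpoly ?A = L ^ (n - 2) * (L\<^sup>2 - smult (complex_of_real p) L + [:complex_of_real q:])"
    using charpoly_rank_one_update_entry[OF x, of a m i j s] n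
    by (simp add: L_def n_def p_def q_def)
  have quad: "L\<^sup>2 - smult (complex_of_real p) L + [:complex_of_real q:]
      = [:a\<^sup>2 + p * a + q, - (2 * a) - p, 1:]"
    by (simp add: L_def power2_eq_square)
  have deg_quad: "degree (L\<^sup>2 - smult (complex_of_real p) L + [:complex_of_real q:]) = 2"
    unfolding quad by simp
  have deg: "degree (charpoly ?A) = CARD('n)"
    unfolding cp using n deg_quad
    by (subst degree_mult_eq) (auto simp: L_def degree_power_eq n_def)
  have lead: "lead_coeff (charpoly ?A) = 1"
    unfolding cp lead_coeff_mult deg_quad unfolding quad by (simp add: L_def lead_coeff_power numeral_2_eq_2)
  have "charpoly ?A = L ^ n - smult (complex_of_real p) (L ^ (n - 1)) + smult (complex_of_real q) (L ^ (n - 2))"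
  proof -
    obtain m where m: "n = Suc (Suc m)"
      using n by (metis Suc_le_D numeral_2_eq_2 Suc_le_mono)
    have "L ^ n = L ^ (n - 2) * L\<^sup>2" "L ^ (n - 1) = L ^ (n - 2) * L"
      unfolding m by (simp_all add: power2_eq_square mult_ac)
    then show ?thesis
      unfolding cp by (simp only: ring_distribs mult_smult_right) simp
  qed
  then have "coeff (charpoly ?A) (n - k)
      = coeff (L ^ n) (n - k) - p * coeff (L ^ (n - 1)) (n - k) + q * coeff (L ^ (n - 2)) (n - k)"
    by simp
  also have "coeff (L ^ n) (n - k) = real (n choose k) * (- a) ^ k"
    unfolding L_def using k by (intro coeff_linear_power_sub) simp
  also have "coeff (L ^ (n - 1)) (n - k) = real ((n - 1) choose (k - 1)) * (- a) ^ (k - 1)"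
  proof -
    have "n - k = (n - 1) - (k - 1)" "k - 1 \<le> n - 1" using k by auto
    then show ?thesis unfolding L_def by (simp only: coeff_linear_power_sub)
  qed
  also have "coeff (L ^ (n - 2)) (n - k)
      = (if k = 1 then 0 else real ((n - 2) choose (k - 2)) * (- a) ^ (k - 2))"
  proof (cases "k = 1")
    case True
    then have "degree (L ^ (n - 2)) < n - k"
      using n by (simp add: L_def degree_power_eq)
    then show ?thesis
      using True by (simp add: coeff_eq_0)
  next
    case False
    then have "n - k = (n - 2) - (k - 2)" "k - 2 \<le> n - 2" using k by auto
    then have "coeff (L ^ (n - 2)) (n - k) = real ((n - 2) choose (k - 2)) * (- a) ^ (k - 2)"
      unfolding L_def by (simp only: coeff_linear_power_sub)
    then show ?thesis using False by simp
  qed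
  finally have co: "coeff (charpoly ?A) (n - k) = complex_of_real
      (real (n choose k) * (- a) ^ k - p * (real ((n - 1) choose (k - 1)) * (- a) ^ (k - 1))
        + q * (if k = 1 then 0 else real ((n - 2) choose (k - 2)) * (- a) ^ (k - 2)))"
    by (simp only: of_real_add of_real_diff of_real_mult)
  have sgn: "(-1) ^ r * (- a) ^ r = a ^ r" for r
    unfolding power_mult_distrib[symmetric] by simp
  obtain r where r: "k = Suc r"
    using k by (cases k) auto
  have sgn1: "(-1) ^ k * (- a) ^ k = a ^ k"
    by (rule sgn)
  have sgn2: "(-1) ^ k * (- a) ^ (k - 1) = - (a ^ (k - 1))"
    by (simp only: r power_Suc diff_Suc_1 mult_minus_left mult_1_left sgn)
  have sgn3: "(-1) ^ k * (- a) ^ (k - 2) = a ^ (k - 2)" if k1: "k \<noteq> 1"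
  proof -
    from k1 r obtain r' where r': "r = Suc r'"
      by (cases r) auto
    show ?thesis
      by (simp only: r r' power_Suc numeral_2_eq_2 diff_Suc_Suc diff_zero mult_minus_left mult_1_left minus_minus sgn)
  qed
  have distr: "e * (b * X - p * (c * Y) + q * (d * Z)) = b * (e * X) + p * c * (- (e * Y)) + q * (d * (e * Z))"
    for e b X c Y d Z :: real
    by algebra
  have "(-1) ^ k * (real (n choose k) * (- a) ^ k - p * (real ((n - 1) choose (k - 1)) * (- a) ^ (k - 1))
        + q * (if k = 1 then 0 else real ((n - 2) choose (k - 2)) * (- a) ^ (k - 2)))
      = real (n choose k) * a ^ k + p * real ((n - 1) choose (k - 1)) * a ^ (k - 1)
        + q * (if k = 1 then 0 else real ((n - 2) choose (k - 2)) * a ^ (k - 2))"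
  proof (cases "k = 1")
    case True
    then show ?thesis by simp
  next
    case False
    then show ?thesis by (simp only: if_False distr sgn1 sgn2 sgn3[OF False] minus_minus)
  qed
  from arg_cong[OF this, of complex_of_real]
  have "(-1) ^ k * coeff (charpoly ?A) (n - k) = complex_of_real (real (n choose k) * a ^ k
        + p * real ((n - 1) choose (k - 1)) * a ^ (k - 1)
        + q * (if k = 1 then 0 else real ((n - 2) choose (k - 2)) * a ^ (k - 2)))"
    unfolding co by (simp only: of_real_mult of_real_power of_real_minus of_real_1)
  then have "Sk k ?A = (n choose k) * a ^ k + p * ((n - 1) choose (k - 1)) * a ^ (k - 1)
        + q * (if k = 1 then 0 else ((n - 2) choose (k - 2)) * a ^ (k - 2))"
    using Sk_eq_coeff_charpoly[OF deg lead, of k] k by (simp only: n_def atLeastAtMost_iff Re_complex_of_real)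
  then show ?thesis
    by (simp only: p_def q_def)
qed

corollary Sk_rank_one_update:
  fixes x :: "real^'n"
  assumes "norm x = 1" and "CARD('n) \<ge> 2" and "k \<in> {1..CARD('n)}"
  shows "Sk k (\<chi> p q. (if p = q then a else 0) + m * x $ p * x $ q)
    = real (CARD('n) choose k) * a ^ k + m * real ((CARD('n) - 1) choose (k - 1)) * a ^ (k - 1)"
proof -
  have *: "(\<chi> p q. (if p = q then a else 0) + m * x $ p * x $ q + (if p = undefined \<and> q = undefined then 0 else 0))
    = (\<chi> p q. (if p = q then a else 0) + m * x $ p * x $ q)"
    by simp
  note e = Sk_rank_one_update_entry[OF assms, where s = 0 and a = a and m = m and i = undefined and j = undefined]
  show ?thesis
    using e unfolding * by simp
qed

lemma Sk_deriv_rank_one_update: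
  fixes x :: "real^'n"
  assumes x: "norm x = 1" and n: "CARD('n) \<ge> 2" and k: "k \<in> {1..CARD('n)}"
  shows "Sk_deriv k (\<chi> p q. (if p = q then a else 0) + m * x $ p * x $ q) i j
    = (if i = j then 1 else 0) * real ((CARD('n) - 1) choose (k - 1)) * a ^ (k - 1)
      + m * ((if i = j then 1 else 0) - x $ i * x $ j)
          * (if k = 1 then 0 else real ((CARD('n) - 2) choose (k - 2)) * a ^ (k - 2))"
    (is "Sk_deriv k ?A i j = ?D")
proof -
  let ?S = "Sk k ?A"
  have "Sk k (\<chi> p q. if p = i \<and> q = j then t else ?A $ p $ q) = ?S + (t - ?A $ i $ j) * ?D" for t
  proof -
    have "(\<chi> p q. if p = i \<and> q = j then t else ?A $ p $ q)
        = (\<chi> p q. (if p = q then a else 0) + m * x $ p * x $ q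
              + (if p = i \<and> q = j then t - ?A $ i $ j else 0))"
      by (auto simp: vec_eq_iff)
    then show ?thesis
      by (simp only: Sk_rank_one_update_entry[OF assms] Sk_rank_one_update[OF assms])
         (simp add: algebra_simps)
  qed
  moreover have "deriv (\<lambda>t. ?S + (t - ?A $ i $ j) * ?D) (?A $ i $ j) = ?D"
    by (rule DERIV_imp_deriv) (auto intro!: derivative_eq_intros)
  ultimately show ?thesis
    by (simp add: Sk_deriv_def)
qed

lemma quadratic_form_delta:
  fixes v w :: "real^'n"
  shows "(\<Sum>i\<in>UNIV. \<Sum>j\<in>UNIV. v $ i * w $ j * (if i = j then 1 else 0)) = v \<bullet> w"
  by (simp add: inner_vec_def if_distrib cong: if_cong)

text \<open>The first term is isotropic; the second one acts only on the components orthogonal to \<open>x\<close>.\<close>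

theorem Sk_form_rank_one_hessian:
  fixes x v w :: "real^'n"
  assumes H: "hessian u z = (\<chi> p q. (if p = q then a else 0) + m * x $ p * x $ q)"
    and x: "norm x = 1" and n: "CARD('n) \<ge> 2" and k: "k \<in> {1..CARD('n)}"
  shows "Sk_form k u z v w = real ((CARD('n) - 1) choose (k - 1)) * a ^ (k - 1) * (v \<bullet> w)
      + m * (if k = 1 then 0 else real ((CARD('n) - 2) choose (k - 2)) * a ^ (k - 2))
          * (v \<bullet> w - (v \<bullet> x) * (w \<bullet> x))"
proof -
  let ?d = "\<lambda>i j :: 'n. if i = j then 1 else 0 :: real"
  let ?C = "real ((CARD('n) - 1) choose (k - 1)) * a ^ (k - 1)"
  let ?E = "m * (if k = 1 then 0 else real ((CARD('n) - 2) choose (k - 2)) * a ^ (k - 2))"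
  have "Sk_form k u z v w = (\<Sum>i\<in>UNIV. \<Sum>j\<in>UNIV.
      (?C + ?E) * (v $ i * w $ j * ?d i j) - ?E * ((v $ i * x $ i) * (w $ j * x $ j)))"
    unfolding Sk_form_def H Sk_deriv_rank_one_update[OF x n k]
    by (intro sum.cong refl) (auto simp: algebra_simps)
  also have "\<dots> = (?C + ?E) * (\<Sum>i\<in>UNIV. \<Sum>j\<in>UNIV. v $ i * w $ j * ?d i j)
      - ?E * ((\<Sum>i\<in>UNIV. v $ i * x $ i) * (\<Sum>j\<in>UNIV. w $ j * x $ j))"
    by (simp only: sum_subtractf sum_product) (simp only: sum_distrib_left)
  also have "\<dots> = (?C + ?E) * (v \<bullet> w) - ?E * ((v \<bullet> x) * (w \<bullet> x))"
    unfolding quadratic_form_delta by (simp add: inner_vec_def)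
  finally show ?thesis
    by (simp add: algebra_simps)
qed

section \<open>Integration along rays\<close>

lemma nn_integral_lborel_scaleR:
  fixes F :: "'a::euclidean_space \<Rightarrow> ennreal"
  assumes [measurable]: "F \<in> borel_measurable borel" and s: "s > 0"
  shows "(\<integral>\<^sup>+y. F (s *\<^sub>R y) \<partial>lborel) = ennreal (1 / s ^ DIM('a)) * (\<integral>\<^sup>+z. F z \<partial>lborel)"
proof -
  have "(\<integral>\<^sup>+z. F z \<partial>lborel)
      = (\<integral>\<^sup>+z. F z \<partial>density (distr lborel borel (\<lambda>x. 0 + s *\<^sub>R x)) (\<lambda>_. ennreal (\<bar>s\<bar> ^ DIM('a))))"
    using lborel_affine[of s "0::'a"] s by simp
  also have "\<dots> = ennreal (s ^ DIM('a)) * (\<integral>\<^sup>+y. F (s *\<^sub>R y) \<partial>lborel)"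
    using s by (simp add: nn_integral_density nn_integral_distr nn_integral_cmult)
  finally show ?thesis
    using s by (simp flip: mult.assoc ennreal_mult)
qed

text \<open>Every ray from the origin meets this shell in a segment whose radii have logarithmic length 1. It
stands in for the unit sphere as the set of directions, with Lebesgue measure in the role of the
surface measure.\<close>

definition unit_log_shell :: "'a::euclidean_space set" where
  "unit_log_shell = {y. 1 \<le> norm y \<and> norm y \<le> exp 1}"

lemma unit_log_shell_sets [measurable]: "unit_log_shell \<in> sets borel"
  unfolding unit_log_shell_def by measurable

text \<open>The condition on \<open>s\<close> says that it lies between \<open>|z| / exp 1\<close> and \<open>|z|\<close>.\<close>

lemma nn_integral_reciprocal_shell:
  fixes z :: "'a::euclidean_space"
  assumes "z \<noteq> 0"
  shows "(\<integral>\<^sup>+s. ennreal (1 / s) * indicator unit_log_shell ((1 / s) *\<^sub>R z) * indicator {0<..} s \<partial>lborel) = 1"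
proof -
  define r where "r = norm z"
  have r: "r > 0" using assms by (simp add: r_def)
  have *: "ennreal (1 / s) * indicator unit_log_shell ((1 / s) *\<^sub>R z) * indicator {0<..} s
      = ennreal (1 / s) * indicator {r / exp 1..r} s" for s
  proof (cases "s > 0")
    case True
    have "norm ((1 / s) *\<^sub>R z) = r / s"
      using True by (simp add: r_def)
    moreover have "1 \<le> r / s \<longleftrightarrow> s \<le> r" "r / s \<le> exp 1 \<longleftrightarrow> r / exp 1 \<le> s"
      using True by (simp_all add: le_divide_eq divide_le_eq mult.commute)
    ultimately show ?thesis
      using True by (simp add: unit_log_shell_def indicator_def conj_commute)
  next
    case False
    then have "\<not> r / exp 1 \<le> s"
      using r by (meson divide_pos_pos exp_gt_zero less_le_trans)
    then show ?thesis using False by simp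
  qed
  have "(\<integral>\<^sup>+s. ennreal (1 / s) * indicator {r / exp 1..r} s \<partial>lborel) = ln r - ln (r / exp 1)"
  proof (rule nn_integral_FTC_Icc)
    have pos: "s > 0" if "r / exp 1 \<le> s" for s
      using r that by (meson divide_pos_pos exp_gt_zero less_le_trans)
    show "(ln has_real_derivative 1 / s) (at s)" if "s \<in> {r / exp 1..r}" for s
      using pos[of s] that by (auto intro!: derivative_eq_intros simp: divide_simps)
    show "0 \<le> 1 / s" if "s \<in> {r / exp 1..r}" for s
      using pos[of s] that by simp
    show "r / exp 1 \<le> r"
      using r by (simp add: divide_le_eq)
  qed measurable
  also have "ln r - ln (r / exp 1) = 1"
    using r by (simp add: ln_div)
  finally show ?thesis
    unfolding * by simp
qed

text \<open>Polar coordinates with directions averaged over the shell. Substituting \<open>z = s y\<close> for fixed \<open>s\<close> and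
exchanging the integrals leaves, for each \<open>z\<close>, the integral of \<open>ds / s\<close> over those \<open>s\<close> with \<open>z / s\<close> in
the shell, which is the logarithmic length 1.\<close>

theorem nn_integral_rays:
  fixes F :: "'a::euclidean_space \<Rightarrow> ennreal"
  assumes [measurable]: "F \<in> borel_measurable borel"
  shows "(\<integral>\<^sup>+z. F z \<partial>lborel)
    = (\<integral>\<^sup>+y\<in>unit_log_shell. (\<integral>\<^sup>+s\<in>{0<..}. F (s *\<^sub>R y) * ennreal (s ^ (DIM('a) - 1)) \<partial>lborel) \<partial>lborel)"
proof -
  define d where "d = DIM('a)"
  have pos: "d = Suc (d - 1)" unfolding d_def by simp
  have scale: "(\<integral>\<^sup>+y. F (s *\<^sub>R y) * ennreal (s ^ (d - 1)) * indicator {0<..} s * indicator unit_log_shell y \<partial>lborel)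
      = (\<integral>\<^sup>+z. F z * (ennreal (1 / s) * indicator unit_log_shell ((1 / s) *\<^sub>R z) * indicator {0<..} s) \<partial>lborel)" for s
  proof (cases "s > 0")
    case True
    have "(\<integral>\<^sup>+y. F (s *\<^sub>R y) * ennreal (s ^ (d - 1)) * indicator {0<..} s * indicator unit_log_shell y \<partial>lborel)
        = ennreal (s ^ (d - 1)) * (\<integral>\<^sup>+y. F (s *\<^sub>R y) * indicator unit_log_shell ((1 / s) *\<^sub>R (s *\<^sub>R y)) \<partial>lborel)"
      using True by (subst nn_integral_cmult[symmetric]) (auto intro!: nn_integral_cong simp: mult_ac)
    also have "\<dots> = ennreal (s ^ (d - 1)) * (ennreal (1 / s ^ d) *
        (\<integral>\<^sup>+z. F z * indicator unit_log_shell ((1 / s) *\<^sub>R z) \<partial>lborel))"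
      unfolding d_def
      by (subst nn_integral_lborel_scaleR[where F = "\<lambda>z. F z * indicator unit_log_shell ((1 / s) *\<^sub>R z)"]) (use True in auto)
    also have "\<dots> = ennreal (1 / s) * (\<integral>\<^sup>+z. F z * indicator unit_log_shell ((1 / s) *\<^sub>R z) \<partial>lborel)"
    proof -
      have "s ^ (d - 1) * (1 / s ^ d) = 1 / s"
        by (subst (2) pos) (use True in simp)
      then show ?thesis
        using True by (simp flip: mult.assoc ennreal_mult)
    qed
    also have "\<dots> = (\<integral>\<^sup>+z. F z * (ennreal (1 / s) * indicator unit_log_shell ((1 / s) *\<^sub>R z) * indicator {0<..} s) \<partial>lborel)"
      using True by (subst nn_integral_cmult[symmetric]) (auto intro!: nn_integral_cong simp: mult_ac)
    finally show ?thesis .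
  qed simp
  have "(\<integral>\<^sup>+y\<in>unit_log_shell. (\<integral>\<^sup>+s\<in>{0<..}. F (s *\<^sub>R y) * ennreal (s ^ (d - 1)) \<partial>lborel) \<partial>lborel)
      = (\<integral>\<^sup>+y. (\<integral>\<^sup>+s. F (s *\<^sub>R y) * ennreal (s ^ (d - 1)) * indicator {0<..} s * indicator unit_log_shell y \<partial>lborel) \<partial>(lborel :: 'a measure))"
    by (intro nn_integral_cong nn_integral_multc[symmetric]) measurable
  also have "\<dots> = (\<integral>\<^sup>+s. (\<integral>\<^sup>+y. F (s *\<^sub>R y) * ennreal (s ^ (d - 1)) * indicator {0<..} s * indicator unit_log_shell y \<partial>(lborel :: 'a measure)) \<partial>lborel)"
    by (rule lborel_pair.Fubini') measurable
  also have "\<dots> = (\<integral>\<^sup>+s. (\<integral>\<^sup>+z. F z * (ennreal (1 / s) * indicator unit_log_shell ((1 / s) *\<^sub>R z) * indicator {0<..} s) \<partial>lborel) \<partial>lborel)"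
    by (simp only: scale)
  also have "\<dots> = (\<integral>\<^sup>+z. (\<integral>\<^sup>+s. F z * (ennreal (1 / s) * indicator unit_log_shell ((1 / s) *\<^sub>R z) * indicator {0<..} s) \<partial>lborel) \<partial>lborel)"
    by (rule lborel_pair.Fubini') measurable
  also have "\<dots> = (\<integral>\<^sup>+z. F z * (\<integral>\<^sup>+s. (ennreal (1 / s) * indicator unit_log_shell ((1 / s) *\<^sub>R z) * indicator {0<..} s) \<partial>lborel) \<partial>lborel)"
    by (intro nn_integral_cong nn_integral_cmult) measurable
  also have "\<dots> = (\<integral>\<^sup>+z. F z \<partial>lborel)"
    by (intro nn_integral_cong_AE) (use AE_lborel_singleton[of "0::'a"] in \<open>auto simp: nn_integral_reciprocal_shell elim!: eventually_mono\<close>)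
  finally show ?thesis
    unfolding d_def by simp
qed

text \<open>The surface area of the unit sphere, written as an integral over the shell.\<close>

definition sphere_mass :: "'a::euclidean_space itself \<Rightarrow> real" where
  "sphere_mass _ = enn2real (\<integral>\<^sup>+y\<in>unit_log_shell. ennreal (1 / norm (y::'a) ^ DIM('a)) \<partial>lborel)"

lemma nn_integral_ray_rescale:
  assumes [measurable]: "f \<in> borel_measurable borel" and c: "c > 0"
  shows "(\<integral>\<^sup>+s\<in>{0<..}. f (s * c) * ennreal (s ^ (d - 1)) \<partial>lborel)
    = ennreal (1 / c ^ Suc (d - 1)) * (\<integral>\<^sup>+r\<in>{0<..}. f r * ennreal (r ^ (d - 1)) \<partial>lborel)"
proof -
  let ?H = "\<lambda>r. f r * ennreal (r ^ (d - 1)) * indicator {0<..} r"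
  have "?H (c * s) = ennreal (c ^ (d - 1)) * (f (s * c) * ennreal (s ^ (d - 1)) * indicator {0<..} s)" for s
    using c by (cases "s > 0")
      (auto simp: zero_less_mult_iff power_mult_distrib ennreal_mult mult_ac)
  then have "ennreal (c ^ (d - 1)) * (\<integral>\<^sup>+s\<in>{0<..}. f (s * c) * ennreal (s ^ (d - 1)) \<partial>lborel)
      = (\<integral>\<^sup>+s. ?H (c *\<^sub>R s) \<partial>lborel)"
    by (simp add: nn_integral_cmult)
  also have "\<dots> = ennreal (1 / c) * (\<integral>\<^sup>+r. ?H r \<partial>lborel)"
    using nn_integral_lborel_scaleR[of ?H c] c by simp
  finally have "ennreal (1 / c ^ (d - 1)) * (ennreal (c ^ (d - 1)) * (\<integral>\<^sup>+s\<in>{0<..}. f (s * c) * ennreal (s ^ (d - 1)) \<partial>lborel))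
    = ennreal (1 / c ^ (d - 1)) * (ennreal (1 / c) * (\<integral>\<^sup>+r. ?H r \<partial>lborel))"
    by simp
  moreover have "ennreal (1 / c ^ (d - 1)) * ennreal (c ^ (d - 1)) = 1"
    using c by (simp flip: ennreal_mult)
  moreover have "ennreal (1 / c ^ (d - 1)) * ennreal (1 / c) = ennreal (1 / c ^ Suc (d - 1))"
    using c by (simp add: mult.commute flip: ennreal_mult)
  ultimately show ?thesis
    by (simp only: mult.assoc[symmetric] mult_1_left)
qed

lemma sphere_mass:
  shows "sphere_mass TYPE('a::euclidean_space) > 0"
    and "ennreal (sphere_mass TYPE('a)) = (\<integral>\<^sup>+y\<in>unit_log_shell. ennreal (1 / norm (y::'a) ^ DIM('a)) \<partial>lborel)"
proof -
  let ?I = "\<integral>\<^sup>+y\<in>unit_log_shell. ennreal (1 / norm (y::'a) ^ DIM('a)) \<partial>lborel"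
  have "?I \<le> (\<integral>\<^sup>+y. indicator (cball 0 (exp 1)) (y::'a) \<partial>lborel)"
  proof (rule nn_integral_mono)
    fix y :: 'a
    show "ennreal (1 / norm y ^ DIM('a)) * indicator unit_log_shell y \<le> indicator (cball 0 (exp 1)) y"
      using one_le_power[of "norm y" "DIM('a)"]
      by (auto simp: indicator_def unit_log_shell_def divide_le_eq_1)
  qed
  also have "\<dots> < \<infinity>"
    using emeasure_lborel_cball_finite[of "0::'a" "exp 1"] by (simp add: top.not_eq_extremum)
  finally have fin: "?I < \<infinity>" .
  then show I: "ennreal (sphere_mass TYPE('a)) = ?I"
    by (simp add: sphere_mass_def)
  have "?I \<noteq> 0"
  proof
    assume "?I = 0"
    then have "AE y in (lborel :: 'a measure). ennreal (1 / norm y ^ DIM('a)) * indicator unit_log_shell y = 0"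
      by (subst (asm) nn_integral_0_iff_AE) auto
    then have "AE y in (lborel :: 'a measure). y \<notin> unit_log_shell"
    proof (rule eventually_mono)
      fix y :: 'a
      assume *: "ennreal (1 / norm y ^ DIM('a)) * indicator unit_log_shell y = 0"
      show "y \<notin> unit_log_shell"
      proof
        assume y: "y \<in> unit_log_shell"
        then have "norm y > 0"
          unfolding unit_log_shell_def mem_Collect_eq by linarith
        then have "1 / norm y ^ DIM('a) > 0" by simp
        with * y show False
          by (simp only: indicator_simps mult_1_right ennreal_eq_0_iff)
      qed
    qed
    then have null: "emeasure lborel (unit_log_shell :: 'a set) = 0"
      using AE_iff_measurable[of unit_log_shell lborel "\<lambda>y::'a. y \<notin> unit_log_shell"] by simp
    obtain e :: 'a where "e \<in> Basis"
      using nonempty_Basis by blast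
    then have e: "norm e = 1" by simp
    define c :: real where "c = (1 + exp 1) / 2"
    define \<delta> :: real where "\<delta> = (exp 1 - 1) / 2"
    have "(1::real) < exp 1" by simp
    then have \<delta>: "\<delta> > 0" "c - \<delta> = 1" "c + \<delta> = exp 1" "c > 0"
      by (auto simp: \<delta>_def c_def field_simps intro: add_pos_pos)
    \<comment> \<open>The ball centred in the middle of the shell and touching both of its boundary spheres.\<close>
    have "ball (c *\<^sub>R e) \<delta> \<subseteq> unit_log_shell"
    proof
      fix y assume "y \<in> ball (c *\<^sub>R e) \<delta>"
      then have "norm (c *\<^sub>R e - y) < \<delta>" by (simp add: dist_norm)
      moreover have "norm (c *\<^sub>R e) = c" using e \<delta> by simp
      ultimately show "y \<in> unit_log_shell"
        using norm_triangle_ineq2[of "c *\<^sub>R e" y] norm_triangle_ineq3[of "c *\<^sub>R e" y] \<delta>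
        unfolding unit_log_shell_def mem_Collect_eq by linarith
    qed
    then have "emeasure lborel (ball (c *\<^sub>R e) \<delta>) \<le> emeasure lborel (unit_log_shell :: 'a set)"
      by (intro emeasure_mono) auto
    then show False
      using null content_ball_pos[OF \<delta>(1), of "c *\<^sub>R e"] by (simp add: measure_def)
  qed
  then show "sphere_mass TYPE('a) > 0"
    using fin by (simp add: sphere_mass_def enn2real_positive_iff top.not_eq_extremum zero_less_iff_neq_zero)
qed

theorem nn_integral_radial:
  assumes [measurable]: "f \<in> borel_measurable borel"
  shows "(\<integral>\<^sup>+x. f (norm (x::'a::euclidean_space)) \<partial>lborel)
    = ennreal (sphere_mass TYPE('a)) * (\<integral>\<^sup>+r\<in>{0<..}. f r * ennreal (r ^ (DIM('a) - 1)) \<partial>lborel)"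
proof -
  let ?J = "\<integral>\<^sup>+r\<in>{0<..}. f r * ennreal (r ^ (DIM('a) - 1)) \<partial>lborel"
  have ray: "(\<integral>\<^sup>+s\<in>{0<..}. f (norm (s *\<^sub>R y)) * ennreal (s ^ (DIM('a) - 1)) \<partial>lborel)
      = ennreal (1 / norm y ^ DIM('a)) * ?J" if "y \<in> unit_log_shell" for y :: 'a
  proof -
    have "norm y > 0"
      using that by (simp add: unit_log_shell_def) (metis norm_zero not_one_le_zero)
    have "(\<integral>\<^sup>+s\<in>{0<..}. f (norm (s *\<^sub>R y)) * ennreal (s ^ (DIM('a) - 1)) \<partial>lborel)
        = (\<integral>\<^sup>+s\<in>{0<..}. f (s * norm y) * ennreal (s ^ (DIM('a) - 1)) \<partial>lborel)"
      by (intro nn_integral_cong) (auto simp: indicator_def)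
    then show ?thesis
      using nn_integral_ray_rescale[OF assms \<open>norm y > 0\<close>, of "DIM('a)"] by simp
  qed
  have "(\<integral>\<^sup>+x. f (norm (x::'a)) \<partial>lborel)
    = (\<integral>\<^sup>+y\<in>unit_log_shell. (\<integral>\<^sup>+s\<in>{0<..}. f (norm (s *\<^sub>R (y::'a))) * ennreal (s ^ (DIM('a) - 1)) \<partial>lborel) \<partial>lborel)"
    by (rule nn_integral_rays) measurable
  also have "\<dots> = (\<integral>\<^sup>+y. (ennreal (1 / norm (y::'a) ^ DIM('a)) * indicator unit_log_shell y) * ?J \<partial>lborel)"
  proof (rule nn_integral_cong)
    fix y :: 'a
    show "(\<integral>\<^sup>+s\<in>{0<..}. f (norm (s *\<^sub>R y)) * ennreal (s ^ (DIM('a) - 1)) \<partial>lborel) * indicator unit_log_shell y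
        = (ennreal (1 / norm y ^ DIM('a)) * indicator unit_log_shell y) * ?J"
    proof (cases "y \<in> unit_log_shell")
      case True
      then show ?thesis by (simp only: ray indicator_simps mult_1_right)
    next
      case False
      then have "indicator unit_log_shell y = (0 :: ennreal)" by simp
      then show ?thesis by (simp only: mult_zero_right mult_zero_left)
    qed
  qed
  also have "\<dots> = ennreal (sphere_mass TYPE('a)) * ?J"
    unfolding sphere_mass(2) by (rule nn_integral_multc) measurable
  finally show ?thesis .
qed

text \<open>Radial extension of the values on a single ray reduces an inequality of integrals over the space to
inequalities for functions of one variable: on the ray through \<open>y\<close> both sides of the hypothesis are the
same multiple of the ray integrals in \<open>nn_integral_rays\<close>.\<close>

theorem nn_integral_le_of_rays:
  fixes F G :: "'a::euclidean_space \<Rightarrow> ennreal"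
  assumes [measurable]: "F \<in> borel_measurable borel" "G \<in> borel_measurable borel"
    and rays: "\<And>\<theta>. norm \<theta> = 1 \<Longrightarrow>
      (\<integral>\<^sup>+x. F (norm (x::'a) *\<^sub>R \<theta>) \<partial>lborel) \<le> (\<integral>\<^sup>+x. G (norm (x::'a) *\<^sub>R \<theta>) \<partial>lborel)"
  shows "(\<integral>\<^sup>+z. F z \<partial>lborel) \<le> (\<integral>\<^sup>+z. G z \<partial>lborel)"
proof -
  have "(\<integral>\<^sup>+s\<in>{0<..}. F (s *\<^sub>R y) * ennreal (s ^ (DIM('a) - 1)) \<partial>lborel)
      \<le> (\<integral>\<^sup>+s\<in>{0<..}. G (s *\<^sub>R y) * ennreal (s ^ (DIM('a) - 1)) \<partial>lborel)" if "y \<in> unit_log_shell" for y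
  proof -
    define c where "c = norm y"
    define \<theta> where "\<theta> = (1 / c) *\<^sub>R y"
    have c: "c > 0"
      using that by (simp add: unit_log_shell_def c_def) (metis norm_zero not_one_le_zero)
    have \<theta>: "norm \<theta> = 1" and y: "\<And>s. s *\<^sub>R y = (s * c) *\<^sub>R \<theta>"
      using c by (auto simp: \<theta>_def c_def)
    have ray: "(\<integral>\<^sup>+s\<in>{0<..}. H (s *\<^sub>R y) * ennreal (s ^ (DIM('a) - 1)) \<partial>lborel)
        = ennreal (1 / c ^ DIM('a)) * (\<integral>\<^sup>+r\<in>{0<..}. H (r *\<^sub>R \<theta>) * ennreal (r ^ (DIM('a) - 1)) \<partial>lborel)"
      if [measurable]: "H \<in> borel_measurable borel" for H
      using nn_integral_ray_rescale[of "\<lambda>r. H (r *\<^sub>R \<theta>)" c "DIM('a)"] c unfolding y by simp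
    have "ennreal (sphere_mass TYPE('a)) * (\<integral>\<^sup>+r\<in>{0<..}. F (r *\<^sub>R \<theta>) * ennreal (r ^ (DIM('a) - 1)) \<partial>lborel)
        \<le> ennreal (sphere_mass TYPE('a)) * (\<integral>\<^sup>+r\<in>{0<..}. G (r *\<^sub>R \<theta>) * ennreal (r ^ (DIM('a) - 1)) \<partial>lborel)"
      using rays[OF \<theta>] by (subst (asm) (1 2) nn_integral_radial) auto
    then have "(\<integral>\<^sup>+r\<in>{0<..}. F (r *\<^sub>R \<theta>) * ennreal (r ^ (DIM('a) - 1)) \<partial>lborel)
        \<le> (\<integral>\<^sup>+r\<in>{0<..}. G (r *\<^sub>R \<theta>) * ennreal (r ^ (DIM('a) - 1)) \<partial>lborel)"
      using sphere_mass(1)[where 'a = 'a] by (simp add: ennreal_mult_le_mult_iff)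
    then show ?thesis
      unfolding ray[OF assms(1)] ray[OF assms(2)] by (intro mult_left_mono) auto
  qed
  then show ?thesis
    unfolding nn_integral_rays[OF assms(1)] nn_integral_rays[OF assms(2)]
    by (intro nn_integral_mono) (auto simp: indicator_def)
qed

text \<open>Neither side sees the origin, so \<open>F\<close> need only be radial off it and the profile need only be continuous
on the open interval; both may be singular at \<open>0\<close>.\<close>

corollary nn_integral_ball_radial:
  fixes F :: "'a::euclidean_space \<Rightarrow> real"
  assumes f: "continuous_on {0<..<1} f" and F: "\<And>x. x \<in> ball 0 1 - {0} \<Longrightarrow> F x = f (norm x)"
  shows "(\<integral>\<^sup>+x\<in>ball 0 1. ennreal (F x) \<partial>lborel)
    = ennreal (sphere_mass TYPE('a)) * (\<integral>\<^sup>+r\<in>{0<..<1}. ennreal (r ^ (DIM('a) - 1) * f r) \<partial>lborel)"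
proof -
  define f0 where "f0 r = ennreal (indicator {0<..<1} r *\<^sub>R f r)" for r
  have [measurable]: "f0 \<in> borel_measurable borel"
    unfolding f0_def using borel_measurable_continuous_on_indicator[OF _ f] by measurable
  have "(\<integral>\<^sup>+x\<in>ball 0 1. ennreal (F x) \<partial>lborel) = (\<integral>\<^sup>+x. f0 (norm (x::'a)) \<partial>lborel)"
  proof (rule nn_integral_cong_AE, use AE_lborel_singleton[of "0::'a"] in \<open>rule eventually_mono\<close>)
    fix x :: 'a assume "x \<noteq> 0"
    then show "ennreal (F x) * indicator (ball 0 1) x = f0 (norm x)"
      using F[of x] by (cases "x \<in> ball 0 1") (auto simp: f0_def)
  qed
  also have "\<dots> = ennreal (sphere_mass TYPE('a)) * (\<integral>\<^sup>+r\<in>{0<..}. f0 r * ennreal (r ^ (DIM('a) - 1)) \<partial>lborel)"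
    by (rule nn_integral_radial) measurable
  also have "(\<integral>\<^sup>+r\<in>{0<..}. f0 r * ennreal (r ^ (DIM('a) - 1)) \<partial>lborel)
      = (\<integral>\<^sup>+r\<in>{0<..<1}. ennreal (r ^ (DIM('a) - 1) * f r) \<partial>lborel)"
  proof (rule nn_integral_cong)
    fix r :: real
    show "f0 r * ennreal (r ^ (DIM('a) - 1)) * indicator {0<..} r
        = ennreal (r ^ (DIM('a) - 1) * f r) * indicator {0<..<1} r"
    proof (cases "r \<in> {0<..<1}")
      case True
      then have "ennreal (r ^ (DIM('a) - 1) * f r) = ennreal (r ^ (DIM('a) - 1)) * ennreal (f r)"
        by (intro ennreal_mult') auto
      then show ?thesis
        using True by (simp add: f0_def mult.commute)
    qed (auto simp: f0_def indicator_def)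
  qed
  finally show ?thesis .
qed

section \<open>Radial functions and test functions\<close>

lemma has_derivative_grad:
  fixes f :: "real^'n \<Rightarrow> real"
  assumes "f differentiable (at x)"
  shows "(f has_derivative (\<lambda>h. grad f x \<bullet> h)) (at x)"
proof -
  let ?D = "frechet_derivative f (at x)"
  have D: "(f has_derivative ?D) (at x)"
    using assms by (simp add: frechet_derivative_works)
  then interpret D: linear ?D
    by (rule has_derivative_linear)
  have "?D = (\<lambda>h. grad f x \<bullet> h)"
  proof
    fix h
    have "?D h = ?D (\<Sum>i\<in>UNIV. (h $ i) *\<^sub>R axis i 1)"
      by (simp add: basis_expansion flip: scalar_mult_eq_scaleR)
    also have "\<dots> = (\<Sum>i\<in>UNIV. h $ i * ?D (axis i 1))"
      by (simp add: D.sum D.scaleR)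
    finally show "?D h = grad f x \<bullet> h"
      by (simp add: grad_def partial_def inner_vec_def mult.commute)
  qed
  with D show ?thesis
    by simp
qed

lemma grad_eqI:
  fixes f :: "real^'n \<Rightarrow> real"
  assumes "(f has_derivative (\<lambda>h. v \<bullet> h)) (at x)"
  shows "grad f x = v"
  using frechet_derivative_at[OF assms]
  by (simp add: grad_def partial_def vec_eq_iff inner_axis flip: frechet_derivative_at[OF assms])

lemma C1_on_grad:
  fixes f :: "real^'n \<Rightarrow> real"
  shows "C1_on S f \<longleftrightarrow> (\<forall>x\<in>S. f differentiable (at x)) \<and> continuous_on S (grad f)"
proof -
  have "continuous_on S (grad f) \<longleftrightarrow> (\<forall>i. continuous_on S (partial i f))"
  proof
    assume *: "continuous_on S (grad f)"
    show "\<forall>i. continuous_on S (partial i f)"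
    proof
      fix i
      have "continuous_on S (\<lambda>x. grad f x $ i)"
        by (intro continuous_intros *)
      then show "continuous_on S (partial i f)"
        by (simp add: grad_def)
    qed
  next
    assume "\<forall>i. continuous_on S (partial i f)"
    then show "continuous_on S (grad f)"
      unfolding grad_def by (intro continuous_on_vec_lambda) auto
  qed
  then show ?thesis
    by (simp add: C1_on_def)
qed

lemma C1_onI:
  fixes f :: "real^'n \<Rightarrow> real"
  assumes D: "\<And>x. x \<in> S \<Longrightarrow> (f has_derivative (\<lambda>h. G x \<bullet> h)) (at x)" and G: "continuous_on S G"
  shows "C1_on S f"
proof -
  have "continuous_on S (grad f)"
    using G by (rule continuous_on_eq) (simp add: grad_eqI[OF D])
  then show ?thesis
    using D unfolding C1_on_grad differentiable_def by blast
qed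

lemma C1_on_subset: "C1_on S f \<Longrightarrow> T \<subseteq> S \<Longrightarrow> C1_on T f"
  unfolding C1_on_def by (blast intro: continuous_on_subset)

lemma C1_on_continuous_on:
  fixes f :: "real^'n \<Rightarrow> real"
  shows "C1_on S f \<Longrightarrow> continuous_on S f"
  unfolding C1_on_def
  by (meson continuous_at_imp_continuous_on differentiable_imp_continuous_within)

lemma C1_on_mult:
  fixes f g :: "real^'n \<Rightarrow> real"
  assumes f: "C1_on S f" and g: "C1_on S g"
  shows "C1_on S (\<lambda>x. f x * g x)"
    and "x \<in> S \<Longrightarrow> grad (\<lambda>x. f x * g x) x = f x *\<^sub>R grad g x + g x *\<^sub>R grad f x"
proof -
  have D: "((\<lambda>x. f x * g x) has_derivative (\<lambda>h. (f x *\<^sub>R grad g x + g x *\<^sub>R grad f x) \<bullet> h)) (at x)"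
    if "x \<in> S" for x
  proof -
    have "(f has_derivative (\<lambda>h. grad f x \<bullet> h)) (at x)" "(g has_derivative (\<lambda>h. grad g x \<bullet> h)) (at x)"
      using f g that unfolding C1_on_def by (auto intro: has_derivative_grad)
    from has_derivative_mult[OF this] show ?thesis
      by (simp add: inner_add_left mult_ac)
  qed
  show "C1_on S (\<lambda>x. f x * g x)"
  proof (rule C1_onI[OF D])
    show "continuous_on S (\<lambda>x. f x *\<^sub>R grad g x + g x *\<^sub>R grad f x)"
      using f g C1_on_continuous_on[OF f] C1_on_continuous_on[OF g] unfolding C1_on_grad
      by (intro continuous_intros) auto
  qed
  show "grad (\<lambda>x. f x * g x) x = f x *\<^sub>R grad g x + g x *\<^sub>R grad f x" if "x \<in> S"
    by (rule grad_eqI[OF D[OF that]])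
qed

lemma has_derivative_radial:
  fixes x :: "real^'n"
  assumes "(h has_real_derivative D) (at (norm x))" and "x \<noteq> 0"
  shows "((\<lambda>x. h (norm x)) has_derivative (\<lambda>v. ((D / norm x) *\<^sub>R x) \<bullet> v)) (at x)"
proof -
  have "((\<lambda>x. h (norm x)) has_derivative (\<lambda>v. D * (sgn x \<bullet> v))) (at x)"
    using has_derivative_compose[OF has_derivative_norm[OF \<open>x \<noteq> 0\<close>] assms(1)[unfolded has_field_derivative_def]]
    by (simp add: inner_commute)
  then show ?thesis
    by (simp add: sgn_div_norm divide_inverse mult_ac)
qed

text \<open>The profile is differentiable because it is the restriction of \<open>f\<close> to a ray; the gradient then follows
from the chain rule for the norm.\<close>

lemma radial_profile_derivative:
  fixes f :: "real^'n \<Rightarrow> real"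
  assumes S: "open S" "x \<in> S" "x \<noteq> 0" and fF: "\<And>y. y \<in> S \<Longrightarrow> f y = F (norm y)"
    and f: "f differentiable (at x)"
  shows "(F has_real_derivative (grad f x \<bullet> x / norm x)) (at (norm x))"
    and "grad f x = (deriv F (norm x) / norm x) *\<^sub>R x"
proof -
  define \<theta> where "\<theta> = (1 / norm x) *\<^sub>R x"
  have x: "norm x *\<^sub>R \<theta> = x" "norm \<theta> = 1"
    using \<open>x \<noteq> 0\<close> by (auto simp: \<theta>_def)
  have fx: "(f has_derivative (\<lambda>h. grad f x \<bullet> h)) (at (norm x *\<^sub>R \<theta>))"
    using has_derivative_grad[OF f] by (simp add: x)
  have "((\<lambda>r. r *\<^sub>R \<theta>) has_derivative (\<lambda>h. h *\<^sub>R \<theta>)) (at (norm x))"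
    by (auto intro!: derivative_eq_intros)
  from has_derivative_compose[OF this fx]
  have D: "((\<lambda>r. f (r *\<^sub>R \<theta>)) has_real_derivative (grad f x \<bullet> \<theta>)) (at (norm x))"
    by (simp add: has_field_derivative_def mult_commute_abs)
  define T where "T = {0<..} \<inter> (\<lambda>r. r *\<^sub>R \<theta>) -` S"
  have "open T"
    unfolding T_def by (intro open_Int open_vimage continuous_intros S)
  moreover have "norm x \<in> T"
    using S x by (simp add: T_def)
  moreover have "f (r *\<^sub>R \<theta>) = F r" if "r \<in> T" for r
    using that fF[of "r *\<^sub>R \<theta>"] x(2) by (simp add: T_def)
  ultimately have F: "(F has_real_derivative (grad f x \<bullet> \<theta>)) (at (norm x))"
    using DERIV_cong_ev[OF refl, of _ F "norm x"] D has_field_derivative_transform_within_open by blast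
  then show "(F has_real_derivative (grad f x \<bullet> x / norm x)) (at (norm x))"
    by (simp add: \<theta>_def)
  have "(f has_derivative (\<lambda>v. ((deriv F (norm x) / norm x) *\<^sub>R x) \<bullet> v)) (at x)"
  proof (rule has_derivative_transform_within_open[OF _ S(1,2)])
    show "((\<lambda>x. F (norm x)) has_derivative (\<lambda>v. ((deriv F (norm x) / norm x) *\<^sub>R x) \<bullet> v)) (at x)"
      using has_derivative_radial[OF F \<open>x \<noteq> 0\<close>] DERIV_imp_deriv[OF F] by simp
  qed (simp add: fF)
  then show "grad f x = (deriv F (norm x) / norm x) *\<^sub>R x"
    by (rule grad_eqI)
qed

text \<open>Constancy near \<open>0\<close> takes care of the origin, where the norm is not differentiable.\<close>

lemma C1_radial:
  fixes h h' :: "real \<Rightarrow> real"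
  assumes h: "\<And>r. r > 0 \<Longrightarrow> (h has_real_derivative h' r) (at r)" and h': "continuous_on {0<..} h'"
    and \<epsilon>: "\<epsilon> > 0" "\<And>r. 0 \<le> r \<Longrightarrow> r < \<epsilon> \<Longrightarrow> h r = c"
  shows "C1_on UNIV (\<lambda>x::real^'n. h (norm x))"
    and "grad (\<lambda>x::real^'n. h (norm x)) x = (h' (norm x) / norm x) *\<^sub>R x"
proof -
  let ?G = "\<lambda>x::real^'n. (h' (norm x) / norm x) *\<^sub>R x"
  have h'0: "h' r = 0" if "0 < r" "r < \<epsilon>" for r
  proof (rule DERIV_unique[OF h[OF that(1)]])
    have "((\<lambda>_. c) has_real_derivative 0) (at r)" by simp
    then show "(h has_real_derivative 0) (at r)"
      by (rule has_field_derivative_transform_within_open[of _ _ _ "{0<..<\<epsilon>}"]) (use that \<epsilon>(2) in auto)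
  qed
  have G0: "?G x = 0" if "norm x < \<epsilon>" for x
    using h'0[of "norm x"] that by (cases "x = 0") auto
  have D: "((\<lambda>x::real^'n. h (norm x)) has_derivative (\<lambda>v. ?G x \<bullet> v)) (at x)" for x
  proof (cases "x = 0")
    case True
    have "((\<lambda>_::real^'n. c) has_derivative (\<lambda>v. ?G x \<bullet> v)) (at x)"
      using True by simp
    then show ?thesis
      by (rule has_derivative_transform_within_open[of _ _ _ _ "ball 0 \<epsilon>"]) (use True \<epsilon> in auto)
  next
    case False
    then show ?thesis
      by (intro has_derivative_radial h) simp
  qed
  have "continuous_on (- {0}) ?G"
    by (intro continuous_intros continuous_on_compose2[OF h']) auto
  moreover have "continuous_on (ball 0 \<epsilon>) ?G"
    by (rule continuous_on_eq[of _ "\<lambda>_. 0"]) (auto simp: G0)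
  moreover have "- {0} \<union> ball 0 \<epsilon> = (UNIV :: (real^'n) set)"
    using \<epsilon> by auto
  ultimately have "continuous_on UNIV ?G"
    using continuous_on_open_Un[of "- {0}" "ball 0 \<epsilon>" ?G] by (simp add: open_Compl)
  then show "C1_on UNIV (\<lambda>x::real^'n. h (norm x))"
    by (intro C1_onI[OF D])
  show "grad (\<lambda>x::real^'n. h (norm x)) x = ?G x"
    by (rule grad_eqI[OF D])
qed

lemma C1_compact_supportI:
  fixes f :: "real^'n \<Rightarrow> real"
  assumes "C1_on UNIV f" "compact K" "K \<subseteq> S" "\<And>x. x \<notin> K \<Longrightarrow> f x = 0"
  shows "C1_compact_support S f"
proof -
  have "closure {x. f x \<noteq> 0} \<subseteq> K"
    using assms by (intro closure_minimal compact_imp_closed) auto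
  moreover from this have "compact (closure {x. f x \<noteq> 0})"
    using assms(2) by (meson closed_closure compact_closure bounded_subset compact_imp_bounded bounded_closure closure_subset)
  ultimately show ?thesis
    using assms by (auto simp: C1_compact_support_def)
qed

lemma C1_compact_support_mono:
  "C1_compact_support S f \<Longrightarrow> S \<subseteq> T \<Longrightarrow> C1_compact_support T f"
  by (auto simp: C1_compact_support_def)

lemma C1_compact_support_ballD:
  fixes f :: "real^'n \<Rightarrow> real"
  assumes "C1_compact_support (ball 0 1) f"
  obtains \<rho> where "0 < \<rho>" "\<rho> < 1" "\<And>x. norm x > \<rho> \<Longrightarrow> f x = 0" "\<And>x. norm x > \<rho> \<Longrightarrow> grad f x = 0"
proof -
  let ?K = "closure {x. f x \<noteq> 0}"
  have K: "compact ?K" "?K \<subseteq> ball 0 1"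
    using assms by (auto simp: C1_compact_support_def)
  have "\<exists>\<rho>. 0 < \<rho> \<and> \<rho> < 1 \<and> (\<forall>x\<in>?K. norm x \<le> \<rho>)"
  proof (cases "?K = {}")
    case True
    then show ?thesis by (intro exI[of _ "1/2"]) auto
  next
    case False
    obtain y where y: "y \<in> ?K" "\<And>x. x \<in> ?K \<Longrightarrow> norm x \<le> norm y"
      using continuous_attains_sup[OF K(1) False, of norm] continuous_on_norm_id by blast
    then show ?thesis
      using K(2) by (intro exI[of _ "max (1/2) (norm y)"]) (fastforce simp: subset_iff)
  qed
  then obtain \<rho> where \<rho>: "0 < \<rho>" "\<rho> < 1" "\<And>x. x \<in> ?K \<Longrightarrow> norm x \<le> \<rho>"
    by blast
  have 0: "f x = 0" if "norm x > \<rho>" for x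
    using \<rho>(3)[of x] closure_subset[of "{x. f x \<noteq> 0}"] that by force
  have "grad f x = 0" if "norm x > \<rho>" for x
  proof (rule grad_eqI)
    have "((\<lambda>_. 0) has_derivative (\<lambda>h. 0 \<bullet> h)) (at x)" by simp
    then show "(f has_derivative (\<lambda>h. 0 \<bullet> h)) (at x)"
    proof (rule has_derivative_transform_within_open)
      show "open {x::real^'n. norm x > \<rho>}"
        by (intro open_Collect_less continuous_intros)
    qed (use that 0 in auto)
  qed
  with 0 \<rho> show ?thesis using that by blast
qed

lemma C1_compact_support_puncturedD:
  fixes f :: "real^'n \<Rightarrow> real"
  assumes "C1_compact_support (ball 0 1 - {0}) f"
  obtains \<epsilon> where "0 < \<epsilon>" "\<And>x. norm x < \<epsilon> \<Longrightarrow> f x = 0"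
proof -
  let ?K = "closure {x. f x \<noteq> 0}"
  have K: "closed ?K" "0 \<notin> ?K"
    using assms by (auto simp: C1_compact_support_def)
  then obtain \<epsilon> where "\<epsilon> > 0" "ball 0 \<epsilon> \<subseteq> - ?K"
    using open_contains_ball[of "- ?K"] by (auto simp: open_Compl)
  then show ?thesis
    using that[of \<epsilon>] closure_subset[of "{x. f x \<noteq> 0}"] by force
qed

text \<open>Differentiating \<open>u\<^sub>i = U'(r) x\<^sub>i / r\<close> once more gives \<open>(U' / r) I + (U'' - U' / r) x x\<^sup>T / r\<^sup>2\<close>. That
\<open>U'\<close> is differentiable is seen on a coordinate axis, where \<open>U'\<close> is a partial derivative of \<open>u\<close>.\<close>

theorem hessian_radial:
  fixes u :: "real^'n \<Rightarrow> real"
  assumes C2: "C2_on (ball 0 1 - {0}) u" and uU: "\<And>x. x \<in> ball 0 1 - {0} \<Longrightarrow> u x = U (norm x)"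
  shows "\<And>r. r \<in> {0<..<1} \<Longrightarrow> (U has_real_derivative deriv U r) (at r)"
    and "\<And>r. r \<in> {0<..<1} \<Longrightarrow> (deriv U has_real_derivative deriv (deriv U) r) (at r)"
    and "\<And>x. x \<in> ball 0 1 - {0} \<Longrightarrow> grad u x = (deriv U (norm x) / norm x) *\<^sub>R x"
    and "\<And>x. x \<in> ball 0 1 - {0} \<Longrightarrow> hessian u x =
       (\<chi> p q. (if p = q then deriv U (norm x) / norm x else 0)
          + (deriv (deriv U) (norm x) - deriv U (norm x) / norm x)
             * ((1 / norm x) *\<^sub>R x) $ p * ((1 / norm x) *\<^sub>R x) $ q)"
proof -
  let ?A = "ball 0 1 - {0} :: (real^'n) set"
  have A: "open ?A" by (intro open_Diff) auto
  have du: "u differentiable (at x)" if "x \<in> ?A" for x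
    using C2 that by (auto simp: C2_on_def C1_on_def)
  have ddu: "partial i u differentiable (at x)" if "x \<in> ?A" for x i
    using C2 that by (auto simp: C2_on_def C1_on_def)
  show grad: "grad u x = (deriv U (norm x) / norm x) *\<^sub>R x" if "x \<in> ?A" for x
    using that by (intro radial_profile_derivative(2)[OF A _ _ uU du]) auto
  fix i0 :: 'n
  define e :: "real^'n" where "e = axis i0 1"
  have e: "norm e = 1" by (simp add: e_def)
  have re: "r *\<^sub>R e \<in> ?A" "norm (r *\<^sub>R e) = r" if "r \<in> {0<..<1}" for r
    using that e by auto
  show U1: "(U has_real_derivative deriv U r) (at r)" if "r \<in> {0<..<1}" for r
    using radial_profile_derivative(1)[OF A re(1)[OF that] _ uU du[OF re(1)[OF that]]] re[OF that]
      DERIV_imp_deriv by fastforce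
  show U2: "(deriv U has_real_derivative deriv (deriv U) r) (at r)" if r: "r \<in> {0<..<1}" for r
  proof -
    have "((\<lambda>r. r *\<^sub>R e) has_derivative (\<lambda>h. h *\<^sub>R e)) (at r)"
      by (auto intro!: derivative_eq_intros)
    from has_derivative_compose[OF this has_derivative_grad[OF ddu[OF re(1)[OF r]]]]
    have "((\<lambda>r. partial i0 u (r *\<^sub>R e)) has_derivative (\<lambda>h. h * (grad (partial i0 u) (r *\<^sub>R e) \<bullet> e))) (at r)"
      by simp
    then have "((\<lambda>r. partial i0 u (r *\<^sub>R e)) has_real_derivative (grad (partial i0 u) (r *\<^sub>R e) \<bullet> e)) (at r)"
      by (simp add: has_field_derivative_def mult_commute_abs)
    moreover have "partial i0 u (r *\<^sub>R e) = deriv U r" if "r \<in> {0<..<1}" for r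
    proof -
      have "grad u (r *\<^sub>R e) $ i0 = deriv U r"
        using grad[OF re(1)[OF that]] re(2)[OF that] that by (simp add: e_def axis_def)
      then show ?thesis by (simp add: grad_def)
    qed
    ultimately have "(deriv U has_real_derivative (grad (partial i0 u) (r *\<^sub>R e) \<bullet> e)) (at r)"
      using r by (elim has_field_derivative_transform_within_open[of _ _ _ "{0<..<1}"]) auto
    then show ?thesis
      using DERIV_imp_deriv by fastforce
  qed
  show "hessian u x =
       (\<chi> p q. (if p = q then deriv U (norm x) / norm x else 0)
          + (deriv (deriv U) (norm x) - deriv U (norm x) / norm x)
             * ((1 / norm x) *\<^sub>R x) $ p * ((1 / norm x) *\<^sub>R x) $ q)" if x: "x \<in> ?A" for x
  proof -
    define r where "r = norm x"
    have r: "r \<in> {0<..<1}" using x by (auto simp: r_def)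
    have axis_component: "axis q (1::real) $ p = (if p = q then 1 else 0)" for p q :: 'n
      by (simp add: axis_def)
    have "partial q (partial p u) x = (if p = q then deriv U r / r else 0)
          + (deriv (deriv U) r - deriv U r / r) * (x $ p / r) * (x $ q / r)" for p q
    proof -
      have V: "((\<lambda>s. deriv U s / s) has_real_derivative ((deriv (deriv U) r * r - deriv U r) / r\<^sup>2)) (at (norm x))"
        using U2[OF r] r unfolding r_def by (auto intro!: derivative_eq_intros simp: power2_eq_square)
      have 1: "((\<lambda>y. (deriv U (norm y) / norm y) * (y $ p)) has_derivative
          (\<lambda>h. (deriv U r / r) * (h $ p)
             + (((((deriv (deriv U) r * r - deriv U r) / r\<^sup>2) / norm x) *\<^sub>R x) \<bullet> h) * (x $ p))) (at x)"
        using has_derivative_mult[OF has_derivative_radial[OF V] bounded_linear_imp_has_derivative[OF bounded_linear_vec_nth[of p]]] x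
        by (simp add: r_def)
      have "(partial p u has_derivative (\<lambda>h. (deriv U r / r) * (h $ p)
             + (((((deriv (deriv U) r * r - deriv U r) / r\<^sup>2) / norm x) *\<^sub>R x) \<bullet> h) * (x $ p))) (at x)"
      proof (rule has_derivative_transform_within_open[OF 1 A x])
        fix y assume "y \<in> ?A"
        from arg_cong[OF grad[OF this], of "\<lambda>v. v $ p"]
        show "(deriv U (norm y) / norm y) * (y $ p) = partial p u y"
          by (simp add: grad_def)
      qed
      from frechet_derivative_at[OF this, symmetric]
      have "partial q (partial p u) x = (deriv U r / r) * (axis q 1 $ p)
             + (((((deriv (deriv U) r * r - deriv U r) / r\<^sup>2) / norm x) *\<^sub>R x) \<bullet> axis q 1) * (x $ p)"
        unfolding partial_def by simp
      also have "\<dots> = (if p = q then deriv U r / r else 0)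
          + ((deriv (deriv U) r * r - deriv U r) / r\<^sup>2 / r) * x $ q * (x $ p)"
        by (simp add: axis_component inner_axis r_def)
      also have "(deriv (deriv U) r * r - deriv U r) / r\<^sup>2 / r = (deriv (deriv U) r - deriv U r / r) / r / r"
        using r by (simp add: divide_simps power2_eq_square)
      finally show ?thesis by simp
    qed
    then show ?thesis
      unfolding hessian_def by (simp add: vec_eq_iff r_def)
  qed
qed

section \<open>A continuously differentiable step\<close>

text \<open>Twice a second difference, with increment \<open>1/2\<close>, of the continuously differentiable function
\<open>(max 0 t)\<^sup>2\<close>: a step from 0 to 1 across the unit interval whose derivative is the piecewise linear \<open>tent\<close>.\<close>

definition c1_step :: "real \<Rightarrow> real" where
  "c1_step t = 2 * (max 0 t)\<^sup>2 - 4 * (max 0 (t - 1/2))\<^sup>2 + 2 * (max 0 (t - 1))\<^sup>2"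

definition tent :: "real \<Rightarrow> real" where
  "tent t = 4 * max 0 t - 8 * max 0 (t - 1/2) + 4 * max 0 (t - 1)"

lemma has_real_derivative_max_0_squared:
  "((\<lambda>t. (max 0 t)\<^sup>2) has_real_derivative 2 * max 0 t) (at t)" for t :: real
proof -
  consider "t < 0" | "t = 0" | "t > 0" by linarith
  then show ?thesis
  proof cases
    case 1
    have "((\<lambda>_. 0) has_real_derivative 2 * max 0 t) (at t)" using 1 by simp
    then show ?thesis
      by (rule has_field_derivative_transform_within_open[of _ _ _ "{..<0}"]) (use 1 in auto)
  next
    case 3
    have "((\<lambda>t. t\<^sup>2) has_real_derivative 2 * max 0 t) (at t)"
      using 3 by (auto intro!: derivative_eq_intros)
    then show ?thesis
      by (rule has_field_derivative_transform_within_open[of _ _ _ "{0<..}"]) (use 3 in auto)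
  next
    case 2
    have "((\<lambda>h. (max 0 h)\<^sup>2 / h) \<longlongrightarrow> 0) (at (0::real))"
    proof (rule Lim_null_comparison)
      show "\<forall>\<^sub>F h in at (0::real). norm ((max 0 h)\<^sup>2 / h) \<le> \<bar>h\<bar>"
        by (auto simp: max_def power2_eq_square)
      show "((\<lambda>h::real. \<bar>h\<bar>) \<longlongrightarrow> 0) (at 0)"
        by (intro tendsto_eq_intros) auto
    qed
    then show ?thesis
      using 2 by (simp add: DERIV_def)
  qed
qed

lemma c1_step_has_real_derivative: "(c1_step has_real_derivative tent t) (at t)"
proof -
  have shift: "((\<lambda>t. (max 0 (t - c))\<^sup>2) has_real_derivative 2 * max 0 (t - c)) (at t)" for c :: real
  proof -
    have "((\<lambda>t. t - c) has_real_derivative 1) (at t)"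
      by (auto intro!: derivative_eq_intros)
    from DERIV_chain2[where f = "\<lambda>t. (max 0 t)\<^sup>2", OF has_real_derivative_max_0_squared this]
    show ?thesis by simp
  qed
  show ?thesis
    unfolding c1_step_def[abs_def] tent_def
    by (rule derivative_eq_intros has_real_derivative_max_0_squared shift refl)+ simp
qed

lemma tent_bounds: "0 \<le> tent t" "tent t \<le> 2"
  by (auto simp: tent_def max_def)

lemma tent_eq_0: "t \<le> 0 \<or> t \<ge> 1 \<Longrightarrow> tent t = 0"
  by (auto simp: tent_def max_def)

lemma tent_pos: "0 < t \<Longrightarrow> t < 1 \<Longrightarrow> tent t > 0"
  by (auto simp: tent_def max_def)

lemma continuous_on_tent: "continuous_on S tent"
  unfolding tent_def[abs_def] by (intro continuous_intros)

lemma c1_step_eq_0: "t \<le> 0 \<Longrightarrow> c1_step t = 0"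
  by (simp add: c1_step_def)

lemma c1_step_eq_1: "t \<ge> 1 \<Longrightarrow> c1_step t = 1"
  by (simp add: c1_step_def power2_eq_square algebra_simps)

lemma c1_step_mono: "s \<le> t \<Longrightarrow> c1_step s \<le> c1_step t"
  by (rule DERIV_nonneg_imp_nondecreasing) (auto intro: c1_step_has_real_derivative tent_bounds)

lemma c1_step_bounds: "0 \<le> c1_step t" "c1_step t \<le> 1"
  using c1_step_mono[of "min 0 t" t] c1_step_mono[of t "max 1 t"]
  by (auto simp: c1_step_eq_0 c1_step_eq_1)

section \<open>Growth of the weight at the origin\<close>

text \<open>Here \<open>P = r\<^sup>n\<^sup>-\<^sup>k V\<^sup>k\<close> is increasing, hence bounded, and \<open>w = r\<^sup>n\<^sup>-\<^sup>k V\<^sup>k\<^sup>-\<^sup>1\<close> satisfies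
\<open>w\<^sup>k = r\<^sup>n\<^sup>-\<^sup>k P\<^sup>k\<^sup>-\<^sup>1\<close>. For \<open>n \<ge> 2 k\<close> this is at most a constant times \<open>r\<^sup>k\<close>. For \<open>n < 2 k\<close> the bound on
\<open>P\<close> makes \<open>V\<close> integrable at \<open>0\<close>, so \<open>U\<close> and \<open>g(U)\<close> are bounded; integrating the equation from
\<open>P(0+) = 0\<close> gives \<open>P = O(r\<^sup>n)\<close>, hence \<open>V = O(r)\<close> and \<open>w = O(r\<^sup>n\<^sup>-\<^sup>1)\<close>. The bound by \<open>C r\<close> is what makes
the integral of \<open>1 / w\<close> diverge at \<open>0\<close>, that is, the origin has zero capacity.\<close>

lemma flux_weight_bound:
  fixes U V g P :: "real \<Rightarrow> real" and n k :: nat and c \<rho> :: real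
  assumes n: "n \<ge> 2" and k: "1 \<le> k" "k \<le> n" and c: "c > 0"
    and g: "continuous_on UNIV g" "\<And>t. g t > 0"
    and U: "\<And>r. r \<in> {0<..<1} \<Longrightarrow> (U has_real_derivative V r) (at r)"
    and V: "\<And>r. r \<in> {0<..<1} \<Longrightarrow> V r \<ge> 0"
    and P: "\<And>r. P r = r ^ (n - k) * V r ^ k"
    and P': "\<And>r. r \<in> {0<..<1} \<Longrightarrow> (P has_real_derivative (r ^ (n - 1) * g (U r) / c)) (at r)"
    and P0: "(P \<longlongrightarrow> 0) (at_right 0)"
    and \<rho>: "0 < \<rho>" "\<rho> < 1"
  shows "\<exists>C>0. \<forall>r\<in>{0<..\<rho>}. r ^ (n - k) * V r ^ (k - 1) \<le> C * r"
proof -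
  have P_mono: "P r \<le> P s" if "0 < r" "r \<le> s" "s < 1" for r s
  proof (rule DERIV_nonneg_imp_nondecreasing[OF that(2)])
    fix x assume x: "r \<le> x" "x \<le> s"
    then have "(P has_real_derivative (x ^ (n - 1) * g (U x) / c)) (at x)"
      using that by (intro P') auto
    moreover have "x ^ (n - 1) * g (U x) / c \<ge> 0"
      using x that c g(2)[of "U x"] by (intro divide_nonneg_nonneg mult_nonneg_nonneg) auto
    ultimately show "\<exists>y. (P has_real_derivative y) (at x) \<and> y \<ge> 0" by blast
  qed
  have U_mono: "U r \<le> U s" if "0 < r" "r \<le> s" "s < 1" for r s
  proof (rule DERIV_nonneg_imp_nondecreasing[OF that(2)])
    fix x assume x: "r \<le> x" "x \<le> s"
    then have "x \<in> {0<..<1}" using that by auto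
    then show "\<exists>y. (U has_real_derivative y) (at x) \<and> y \<ge> 0"
      using U V by blast
  qed
  obtain j where j: "k = Suc j" using k by (cases k) auto
  define m where "m = n - k"
  have nm: "n = m + Suc j" using k j by (simp add: m_def)
  define M where "M = max 1 (P \<rho>)"
  have M: "M \<ge> 1" by (simp add: M_def)
  have P_nonneg: "0 \<le> P r" if "r \<in> {0<..<1}" for r
    unfolding P using that V by auto
  have P_le: "P r \<le> M" if "r \<in> {0<..\<rho>}" for r
    using P_mono[of r \<rho>] that \<rho> by (auto simp: M_def)
  have w_nonneg: "0 \<le> r ^ m * V r ^ j" if "r \<in> {0<..<1}" for r
    using that V by auto
  have goal_eq: "r ^ (n - k) * V r ^ (k - 1) = r ^ m * V r ^ j" for r
    by (simp only: m_def j diff_Suc_1)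
  show ?thesis
  proof (cases "2 * k \<le> n")
    case True
    have "r ^ m * V r ^ j \<le> M * r" if r: "r \<in> {0<..\<rho>}" for r
    proof -
      have r01: "r \<in> {0<..<1}" using r \<rho> by auto
      have "(r ^ m * V r ^ j) ^ Suc j = r ^ m * (P r) ^ j"
      proof -
        have 1: "(V r ^ j) ^ Suc j = (V r ^ Suc j) ^ j"
          by (simp only: power_mult[symmetric] mult.commute)
        have 2: "(r ^ m) ^ Suc j = r ^ m * (r ^ m) ^ j"
          by (rule power_Suc)
        have 3: "P r = r ^ m * V r ^ Suc j"
          by (simp only: P m_def j)
        show ?thesis
          by (simp only: 3 power_mult_distrib 1 2 mult.assoc)
      qed
      also have "\<dots> \<le> r ^ Suc j * M ^ j"
      proof (rule mult_mono)
        show "r ^ m \<le> r ^ Suc j"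
          using r01 True nm j by (intro power_decreasing) auto
        show "P r ^ j \<le> M ^ j"
          using P_nonneg[OF r01] P_le[OF r] by (rule power_mono[rotated])
      qed (use r01 P_nonneg[OF r01] in auto)
      also have "\<dots> \<le> r ^ Suc j * M ^ Suc j"
        using r01 M by (intro mult_left_mono power_increasing) auto
      also have "\<dots> = (M * r) ^ Suc j"
        by (simp add: power_mult_distrib)
      finally show ?thesis
        by (rule power_le_imp_le_base) (use M r01 in simp)
    qed
    then show ?thesis
      unfolding goal_eq using M by (intro exI[of _ M] conjI ballI) simp_all
  next
    case False
    then have mj: "m \<le> j" using nm j by simp
    define B where "B = U \<rho> - real k * M"
    \<comment> \<open>In the variable \<open>x = root k r\<close> the profile has derivative at most \<open>k M\<close>, since \<open>n - k \<le> k - 1\<close> turns the bound on \<open>P\<close> into \<open>(x ^ (k - 1) * V (x ^ k)) ^ k \<le> M\<close>.\<close>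
    have U_ge: "B \<le> U r" if r: "r \<in> {0<..\<rho>}" for r
    proof -
      define s where "s = root k r"
      define t where "t = root k \<rho>"
      have st: "s ^ k = r" "t ^ k = \<rho>" "0 < s" "s \<le> t" "t < 1"
        using r \<rho> k by (auto simp: s_def t_def real_root_pow_pos)
      define Q where "Q x = U (x ^ k) - real k * M * x" for x
      have "Q t \<le> Q s"
      proof (rule DERIV_nonpos_imp_nonincreasing[OF st(4)])
        fix x assume x: "s \<le> x" "x \<le> t"
        then have x01: "0 < x" "x < 1" using st by auto
        then have xk: "x ^ k \<in> {0<..<1}" using k by (auto simp: power_less_one_iff)
        have "x ^ k \<le> \<rho>"
          using x st(2,3) power_mono[of x t k] by simp
        have "(x ^ j * V (x ^ k)) ^ k \<le> (x ^ m * V (x ^ k)) ^ k"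
          using x01 V[OF xk] mj by (intro power_mono mult_right_mono power_decreasing) auto
        also have "\<dots> = P (x ^ k)"
          by (simp add: P m_def[symmetric] power_mult_distrib mult.commute flip: power_mult)
        also have "\<dots> \<le> M"
          using xk \<open>x ^ k \<le> \<rho>\<close> by (intro P_le) auto
        also have "\<dots> \<le> M ^ k"
          using M k by (simp add: self_le_power)
        finally have le: "x ^ j * V (x ^ k) \<le> M"
          by (rule power_le_imp_le_base[of _ j, folded j]) (use M in simp)
        have "(Q has_real_derivative (V (x ^ k) * (real k * x ^ (k - 1)) - real k * M)) (at x)"
        proof -
          have "((\<lambda>x. x ^ k) has_real_derivative (real k * x ^ (k - 1))) (at x)"
            using DERIV_pow[of k x UNIV] by simp
          from DERIV_chain2[OF U[OF xk] this] show ?thesis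
            unfolding Q_def by (auto intro!: derivative_eq_intros)
        qed
        moreover have "V (x ^ k) * (real k * x ^ (k - 1)) - real k * M = real k * (x ^ j * V (x ^ k) - M)"
          by (simp add: j algebra_simps)
        moreover have "\<dots> \<le> 0"
          using le by (intro mult_nonneg_nonpos) auto
        ultimately show "\<exists>y. (Q has_real_derivative y) (at x) \<and> y \<le> 0" by auto
      qed
      moreover have "real k * M * (t - s) \<le> real k * M * 1"
        using M st by (intro mult_left_mono) auto
      moreover have "real k * M * s \<ge> 0" using M st by auto
      ultimately show ?thesis
        using st by (simp add: Q_def B_def algebra_simps)
    qed
    have "bounded (g ` {B..U \<rho>})"
      by (intro compact_imp_bounded compact_continuous_image continuous_on_subset[OF g(1)]) auto
    then obtain G where "\<forall>t\<in>{B..U \<rho>}. \<bar>g t\<bar> \<le> G"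
      by (auto simp: bounded_iff)
    then have G: "\<bar>g t\<bar> \<le> G" if "t \<in> {B..U \<rho>}" for t
      using that by blast
    define D where "D = G / (c * real n)"
    define D' where "D' = max 1 D"
    have P_power: "P r \<le> D * r ^ n" if r: "r \<in> {0<..\<rho>}" for r
    proof -
      define Q where "Q x = P x - D * x ^ n" for x
      have "Q r \<le> Q s" if s: "0 < s" "s \<le> r" for s
      proof (rule DERIV_nonpos_imp_nonincreasing[OF s(2)])
        fix x assume x: "s \<le> x" "x \<le> r"
        then have x01: "x \<in> {0<..\<rho>}" "x \<in> {0<..<1}" using s r \<rho> by auto
        have "g (U x) \<le> G"
          using G[of "U x"] U_ge[OF x01(1)] U_mono[of x \<rho>] x01 \<rho> by auto
        have "(Q has_real_derivative (x ^ (n - 1) * g (U x) / c - D * (real n * x ^ (n - 1)))) (at x)"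
          unfolding Q_def using DERIV_diff[OF P'[OF x01(2)] DERIV_cmult[OF DERIV_pow[of n x UNIV], of D]] by simp
        moreover have "x ^ (n - 1) * g (U x) / c - D * (real n * x ^ (n - 1)) = (x ^ (n - 1) / c) * (g (U x) - G)"
          using n c by (simp add: D_def field_simps)
        moreover have "\<dots> \<le> 0"
          using \<open>g (U x) \<le> G\<close> x01 c by (intro mult_nonneg_nonpos) auto
        ultimately show "\<exists>y. (Q has_real_derivative y) (at x) \<and> y \<le> 0" by auto
      qed
      moreover have "(Q \<longlongrightarrow> 0 - D * 0 ^ n) (at_right 0)"
        unfolding Q_def by (intro tendsto_intros P0)
      ultimately have "Q r \<le> 0 - D * 0 ^ n"
        using r by (intro tendsto_lowerbound) (auto simp: eventually_at_right[OF zero_less_one] intro!: exI[of _ r])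
      then show ?thesis
        using n by (simp add: Q_def power_0_left)
    qed
    have "r ^ m * V r ^ j \<le> D' ^ j * r" if r: "r \<in> {0<..\<rho>}" for r
    proof -
      have r01: "r \<in> {0<..<1}" using r \<rho> by auto
      have "r ^ m * V r ^ Suc j \<le> r ^ m * (D * r ^ Suc j)"
        using P_power[OF r] by (simp add: P m_def[symmetric] nm j power_add mult_ac)
      then have "V r ^ Suc j \<le> D * r ^ Suc j"
        using r01 by (simp add: mult_le_cancel_left)
      also have "\<dots> \<le> D' ^ Suc j * r ^ Suc j"
      proof (rule mult_right_mono)
        have "D' \<le> D' ^ Suc j"
          by (rule self_le_power) (auto simp: D'_def)
        moreover have "D \<le> D'" by (simp add: D'_def)
        ultimately show "D \<le> D' ^ Suc j" by linarith
      qed (use r01 in auto)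
      also have "\<dots> = (D' * r) ^ Suc j"
        by (simp add: power_mult_distrib)
      finally have "V r \<le> D' * r"
        by (rule power_le_imp_le_base) (use r01 in \<open>simp add: D'_def\<close>)
      then have "r ^ m * V r ^ j \<le> r ^ m * (D' * r) ^ j"
        using r01 V[OF r01] by (intro mult_left_mono power_mono) auto
      also have "\<dots> = D' ^ j * r ^ (m + j)"
        by (simp add: power_mult_distrib power_add mult_ac)
      also have "\<dots> \<le> D' ^ j * r ^ 1"
        using r01 n nm by (intro mult_left_mono power_decreasing) (auto simp: D'_def)
      finally show ?thesis by simp
    qed
    then show ?thesis
      unfolding goal_eq by (intro exI[of _ "D' ^ j"] conjI ballI) (simp_all add: D'_def)
  qed
qed

section \<open>The radial equation\<close>

lemma nn_integral_Icc_continuous: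
  fixes f :: "real \<Rightarrow> real"
  assumes "continuous_on {a..b} f" "\<And>r. r \<in> {a..b} \<Longrightarrow> f r \<ge> 0"
  shows "(\<integral>\<^sup>+r\<in>{a..b}. ennreal (f r) \<partial>lborel) = ennreal (integral {a..b} f)"
proof -
  have int: "set_integrable lborel {a..b} f"
    using assms(1) by (intro borel_integrable_atLeastAtMost') 
  have "(\<integral>\<^sup>+r\<in>{a..b}. ennreal (f r) \<partial>lborel) = (\<integral>\<^sup>+r. ennreal (indicator {a..b} r *\<^sub>R f r) \<partial>lborel)"
    by (intro nn_integral_cong) (auto simp: indicator_def)
  also have "\<dots> = ennreal (LINT r:{a..b}|lborel. f r)"
    unfolding set_lebesgue_integral_def
    by (rule nn_integral_eq_integral) (use int assms(2) in \<open>auto simp: set_integrable_def indicator_def\<close>)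
  also have "(LINT r:{a..b}|lborel. f r) = integral {a..b} f"
    by (rule set_borel_integral_eq_integral[OF int])
  finally show ?thesis .
qed

locale radial_solution =
  fixes u :: "real^'n \<Rightarrow> real" and U g :: "real \<Rightarrow> real" and k :: nat
  assumes dim: "CARD('n) \<ge> 2" and k: "k \<in> {1..CARD('n)}"
    and g_C1: "g C1_differentiable_on UNIV" and g_pos: "\<And>t. g t > 0"
    and sol: "classical_solution k g u \<or> weak_solution k g u"
    and u_eq: "\<And>x. x \<in> ball 0 1 \<Longrightarrow> u x = U (norm x)"
    and U'_nonneg: "\<And>r. r \<in> {0<..<1} \<Longrightarrow> deriv U r \<ge> 0"
begin

definition coef :: real where
  "coef = real (CARD('n) choose k) / real CARD('n)"

definition radial_weight :: "real \<Rightarrow> real" where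
  "radial_weight r = real k * coef * (deriv U r / r) ^ (k - 1)"

text \<open>The coefficient by which the form exceeds \<open>radial_weight\<close> in directions orthogonal to \<open>x\<close>.\<close>

definition tangential_excess :: "real \<Rightarrow> real" where
  "tangential_excess r = (deriv (deriv U) r - deriv U r / r)
     * (if k = 1 then 0 else real ((CARD('n) - 2) choose (k - 2)) * (deriv U r / r) ^ (k - 2))"

text \<open>The operator \<open>S\<^sub>k(D\<^sup>2u)\<close> of the radial function with profile \<open>U\<close>.\<close>

definition Sk_profile :: "real \<Rightarrow> real" where
  "Sk_profile r = coef * (real (CARD('n) - k) * (deriv U r / r) ^ k
     + real k * deriv (deriv U) r * (deriv U r / r) ^ (k - 1))"

definition flux :: "real \<Rightarrow> real" where
  "flux r = r ^ (CARD('n) - k) * deriv U r ^ k"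

lemma coef_pos: "coef > 0"
  using k by (auto simp: coef_def intro!: divide_pos_pos)

lemma k_coef: "real k * coef = real ((CARD('n) - 1) choose (k - 1))"
proof -
  have "k * (CARD('n) choose k) = CARD('n) * ((CARD('n) - 1) choose (k - 1))"
    using k by (intro times_binomial_minus1_eq) auto
  then have "real k * real (CARD('n) choose k) = real CARD('n) * real ((CARD('n) - 1) choose (k - 1))"
    by (metis of_nat_mult)
  then show ?thesis
    using dim by (simp add: coef_def field_simps)
qed

lemma u_C2: "C2_on (ball 0 1 - {0}) u"
  using sol
proof
  assume "classical_solution k g u"
  then have "C2_on (ball 0 1) u" by (simp add: classical_solution_def)
  then show ?thesis
    unfolding C2_on_def by (meson C1_on_subset Diff_subset)
qed (simp add: weak_solution_def)

lemma u_eq': "x \<in> ball 0 1 - {0} \<Longrightarrow> u x = U (norm x)"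
  using u_eq by auto

lemma U_deriv: "r \<in> {0<..<1} \<Longrightarrow> (U has_real_derivative deriv U r) (at r)"
  by (rule hessian_radial(1)[OF u_C2 u_eq'])

lemma U_deriv2: "r \<in> {0<..<1} \<Longrightarrow> (deriv U has_real_derivative deriv (deriv U) r) (at r)"
  by (rule hessian_radial(2)[OF u_C2 u_eq'])

lemma grad_u: "x \<in> ball 0 1 - {0} \<Longrightarrow> grad u x = (deriv U (norm x) / norm x) *\<^sub>R x"
  by (rule hessian_radial(3)[OF u_C2 u_eq'])

lemma hessian_u:
  "x \<in> ball 0 1 - {0} \<Longrightarrow> hessian u x =
     (\<chi> p q. (if p = q then deriv U (norm x) / norm x else 0)
        + (deriv (deriv U) (norm x) - deriv U (norm x) / norm x)
           * ((1 / norm x) *\<^sub>R x) $ p * ((1 / norm x) *\<^sub>R x) $ q)"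
  by (rule hessian_radial(4)[OF u_C2 u_eq'])

lemma continuous_on_U: "continuous_on {0<..<1} U"
  by (meson DERIV_isCont U_deriv continuous_at_imp_continuous_on)

lemma continuous_on_U': "continuous_on {0<..<1} (deriv U)"
  by (meson DERIV_isCont U_deriv2 continuous_at_imp_continuous_on)

lemma g_continuous: "continuous_on UNIV g"
  using g_C1 C1_differentiable_imp_continuous_on by blast

lemma Sk_form_u:
  assumes x: "x \<in> ball 0 1 - {0}"
  shows "Sk_form k u x v w = radial_weight (norm x) * (v \<bullet> w)
     + tangential_excess (norm x) * (v \<bullet> w - (v \<bullet> x) * (w \<bullet> x) / (norm x)\<^sup>2)"
proof -
  have 1: "norm ((1 / norm x) *\<^sub>R x) = 1"
    using x by simp
  show ?thesis
    unfolding Sk_form_rank_one_hessian[OF hessian_u[OF x] 1 dim k]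
    by (simp add: radial_weight_def tangential_excess_def k_coef power2_eq_square)
qed

lemma Sk_u:
  assumes x: "x \<in> ball 0 1 - {0}"
  shows "Sk k (hessian u x) = Sk_profile (norm x)"
proof -
  have 1: "norm ((1 / norm x) *\<^sub>R x) = 1"
    using x by simp
  define l where "l = deriv U (norm x) / norm x"
  have "real (CARD('n) choose k) = coef * CARD('n)"
    using dim by (simp add: coef_def)
  moreover have "l ^ k = l * l ^ (k - 1)"
    using k by (cases k) auto
  moreover have "real (CARD('n) - k) = real CARD('n) - real k"
    using k by (simp add: of_nat_diff)
  ultimately show ?thesis
    unfolding hessian_u[OF x] Sk_rank_one_update[OF 1 dim k] k_coef[symmetric] Sk_profile_def l_def[symmetric]
    by (simp add: algebra_simps)
qed

text \<open>The divergence structure of the operator: \<open>r\<^sup>n\<^sup>-\<^sup>1 S\<^sub>k(D\<^sup>2u) = c (r\<^sup>n\<^sup>-\<^sup>k (u')\<^sup>k)'\<close>.\<close>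

lemma flux_deriv:
  assumes r: "r \<in> {0<..<1}"
  shows "(flux has_real_derivative (r ^ (CARD('n) - 1) * Sk_profile r / coef)) (at r)"
proof -
  let ?n = "CARD('n)" and ?V = "deriv U r" and ?V' = "deriv (deriv U) r"
  have pow: "r ^ (i + j) * (?V / r) ^ j = r ^ i * ?V ^ j" for i j
    using r by (simp add: power_add power_divide)
  have "(flux has_real_derivative
      (real (?n - k) * r ^ (?n - k - 1) * ?V ^ k + r ^ (?n - k) * (real k * ?V' * ?V ^ (k - 1)))) (at r)"
    unfolding flux_def[abs_def] using U_deriv2[OF r]
    by (auto intro!: derivative_eq_intros)
  moreover have "r ^ (?n - 1) * (?V / r) ^ (k - 1) = r ^ (?n - k) * ?V ^ (k - 1)"
    using pow[of "?n - k" "k - 1"] k by (simp add: algebra_simps)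
  moreover have "real (?n - k) * (r ^ (?n - 1) * (?V / r) ^ k) = real (?n - k) * (r ^ (?n - k - 1) * ?V ^ k)"
  proof (cases "k = ?n")
    case False
    then have "?n - 1 = (?n - k - 1) + k" using k by auto
    then show ?thesis by (simp only: pow)
  qed simp
  moreover have "r ^ (?n - 1) * Sk_profile r / coef
      = real (?n - k) * (r ^ (?n - 1) * (?V / r) ^ k) + real k * ?V' * (r ^ (?n - 1) * (?V / r) ^ (k - 1))"
  proof -
    have "x * (coef * (y * s + z * v * t)) / coef = y * (x * s) + z * v * (x * t)" for x y s z v t
      using coef_pos by (simp add: field_simps)
    then show ?thesis unfolding Sk_profile_def .
  qed
  ultimately show ?thesis
    by (simp only: mult_ac)
qed

lemma classical_flux_tendsto:
  assumes "classical_solution k g u"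
  shows "(flux \<longlongrightarrow> 0) (at_right 0)"
proof -
  fix i :: 'n
  define e :: "real^'n" where "e = axis i 1"
  have e: "norm e = 1" "e \<noteq> 0" by (auto simp: e_def axis_eq_0_iff)
  have "C1_on (ball 0 1) u"
    using assms by (simp add: classical_solution_def C2_on_def)
  then have "continuous_on (ball 0 1) (grad u)"
    by (simp add: C1_on_grad)
  then have cont: "isCont (grad u) 0"
    by (simp add: continuous_on_eq_continuous_at)
  have lim: "((\<lambda>r. grad u (r *\<^sub>R v)) \<longlongrightarrow> grad u 0) (at_right 0)" for v
  proof (rule isCont_tendsto_compose[OF cont])
    have "((\<lambda>r. r *\<^sub>R v) \<longlongrightarrow> 0 *\<^sub>R v) (at_right 0)"
      by (intro tendsto_intros)
    then show "((\<lambda>r. r *\<^sub>R v) \<longlongrightarrow> 0) (at_right 0)" by simp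
  qed
  have val: "grad u (r *\<^sub>R e) = deriv U r *\<^sub>R e" "grad u (r *\<^sub>R (- e)) = - (deriv U r *\<^sub>R e)"
    if "r \<in> {0<..<1}" for r
    using grad_u[of "r *\<^sub>R e"] grad_u[of "r *\<^sub>R (- e)"] that e by auto
  have ev: "\<forall>\<^sub>F r in at_right 0. r \<in> {0<..<1::real}"
    by (rule eventually_at_right_real) simp
  \<comment> \<open>The gradient at the origin is the limit along both \<open>e\<close> and \<open>- e\<close>, hence zero.\<close>
  have "grad u 0 = - grad u 0"
  proof (rule tendsto_unique[OF _ lim[of "- e"]])
    show "((\<lambda>r. grad u (r *\<^sub>R (- e))) \<longlongrightarrow> - grad u 0) (at_right 0)"
      by (rule Lim_transform_eventually[OF tendsto_minus[OF lim[of e]]])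
        (use ev in \<open>auto elim!: eventually_mono simp: val simp del: scaleR_minus_right\<close>)
  qed simp
  then have "grad u 0 = 0"
    by (simp add: vec_eq_iff)
  then have "((\<lambda>r. grad u (r *\<^sub>R e) \<bullet> e) \<longlongrightarrow> 0) (at_right 0)"
    using tendsto_inner[OF lim[of e] tendsto_const[of e]] by simp
  then have V: "(deriv U \<longlongrightarrow> 0) (at_right 0)"
  proof (rule Lim_transform_eventually)
    show "\<forall>\<^sub>F r in at_right 0. grad u (r *\<^sub>R e) \<bullet> e = deriv U r"
      using ev by eventually_elim (simp add: val, simp add: e_def inner_axis_axis)
  qed
  have "(flux \<longlongrightarrow> 0 ^ (CARD('n) - k) * 0 ^ k) (at_right 0)"
    unfolding flux_def[abs_def] by (intro tendsto_intros V)
  then show ?thesis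
    using k by (simp add: power_0_left split: if_splits)
qed

lemma classical_Sk_profile:
  assumes "classical_solution k g u" and r: "r \<in> {0<..<1}"
  shows "Sk_profile r = g (U r)"
proof -
  fix i :: 'n
  define x :: "real^'n" where "x = r *\<^sub>R axis i 1"
  have x: "x \<in> ball 0 1 - {0}" "norm x = r"
    using r by (auto simp: x_def)
  then have "Sk k (hessian u x) = g (u x)"
    using assms(1) by (auto simp: classical_solution_def)
  then show ?thesis
    using Sk_u[OF x(1)] u_eq'[OF x(1)] x(2) by simp
qed

text \<open>The weak equation tested with a radial cutoff that is 1 up to radius \<open>a\<close> and 0 from \<open>b\<close> on; \<open>- \<beta>\<close> is
its radial derivative. Both integrands are nonnegative since \<open>u' \<ge> 0\<close> and \<open>g > 0\<close>, which is why the
identity can be stated, and used, with integrals in the extended nonnegative reals.\<close>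

lemma weak_radial_identity:
  assumes weak: "weak_solution k g u" and ab: "0 < a" "a < b" "b < 1"
  defines "\<beta> \<equiv> \<lambda>r. tent ((r - a) / (b - a)) / (b - a)"
    and "\<eta> \<equiv> \<lambda>r. 1 - c1_step ((r - a) / (b - a))"
  shows "(\<integral>\<^sup>+r\<in>{0<..<1}. ennreal (coef * flux r * \<beta> r) \<partial>lborel)
    = (\<integral>\<^sup>+r\<in>{0<..<1}. ennreal (r ^ (CARD('n) - 1) * (g (U r) * \<eta> r)) \<partial>lborel)"
proof -
  let ?B = "ball 0 1 :: (real^'n) set"
  have \<eta>': "(\<eta> has_real_derivative - \<beta> r) (at r)" for r
  proof -
    have "((\<lambda>r. (r - a) / (b - a)) has_real_derivative 1 / (b - a)) (at r)"
      using ab by (auto intro!: derivative_eq_intros)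
    from DERIV_chain2[where f = c1_step, OF c1_step_has_real_derivative this]
    show ?thesis
      unfolding \<eta>_def \<beta>_def by (auto intro!: derivative_eq_intros)
  qed
  have \<beta>_cont: "continuous_on S \<beta>" for S
    unfolding \<beta>_def using ab by (intro continuous_intros continuous_on_compose2[OF continuous_on_tent]) auto
  have \<beta>_nonneg: "\<beta> r \<ge> 0" for r
    unfolding \<beta>_def using ab tent_bounds by simp
  have \<beta>_0: "\<beta> r = 0" if "r \<le> a \<or> b \<le> r" for r
    unfolding \<beta>_def using ab that by (auto intro!: tent_eq_0 simp: divide_le_0_iff)
  have \<eta>_bounds: "0 \<le> \<eta> r" "\<eta> r \<le> 1" for r
    unfolding \<eta>_def using c1_step_bounds by auto
  have \<eta>_1: "\<eta> r = 1" if "r \<le> a" for r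
    unfolding \<eta>_def using ab that by (simp add: c1_step_eq_0 divide_le_0_iff)
  have \<eta>_0: "\<eta> r = 0" if "b \<le> r" for r
    unfolding \<eta>_def using ab that by (simp add: c1_step_eq_1)
  have \<eta>_C1: "C1_on UNIV (\<lambda>x::real^'n. \<eta> (norm x))"
    and grad_\<eta>: "grad (\<lambda>x::real^'n. \<eta> (norm x)) x = (- \<beta> (norm x) / norm x) *\<^sub>R x" for x
    using C1_radial[where h = \<eta> and h' = "\<lambda>r. - \<beta> r" and c = 1 and \<epsilon> = a, OF \<eta>' _ ab(1)] \<eta>_1
    by (auto intro: continuous_on_minus \<beta>_cont)
  have test: "C1_compact_support ?B (\<lambda>x. \<eta> (norm x))"
    by (rule C1_compact_supportI[OF \<eta>_C1, of "cball 0 b"]) (use ab \<eta>_0 in auto)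
  define p where "p r = coef * (deriv U r / r) ^ (k - 1) * deriv U r * \<beta> r" for r
  define q where "q r = g (U r) * \<eta> r" for r
  have p_cont: "continuous_on {0<..<1} p"
    unfolding p_def by (intro continuous_intros continuous_on_U' \<beta>_cont) auto
  have \<eta>_cont: "continuous_on S \<eta>" for S
    by (meson DERIV_isCont \<eta>' continuous_at_imp_continuous_on)
  have gU_cont: "continuous_on {0<..<1} (\<lambda>r. g (U r))"
    by (rule continuous_on_compose2[OF g_continuous continuous_on_U]) auto
  have q_cont: "continuous_on {0<..<1} q"
    unfolding q_def by (intro continuous_intros gU_cont \<eta>_cont)
  have p_nonneg: "p r \<ge> 0" if "r \<in> {0<..<1}" for r
    unfolding p_def using that U'_nonneg[OF that] \<beta>_nonneg coef_pos
    by (intro mult_nonneg_nonneg zero_le_power divide_nonneg_nonneg) auto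
  have q_nonneg: "q r \<ge> 0" for r
    unfolding q_def using g_pos[of "U r"] \<eta>_bounds by simp
  have integrand: "1 / real k * Sk_form k u x (grad u x) (grad (\<lambda>x. \<eta> (norm x)) x) + g (u x) * \<eta> (norm x)
      = q (norm x) - p (norm x)" if x: "x \<in> ?B - {0}" for x
  proof -
    have x0: "x \<noteq> 0" "norm x \<noteq> 0" using x by auto
    have xx: "x \<bullet> x = norm x * norm x" by (simp add: dot_square_norm power2_eq_square)
    have "Sk_form k u x (grad u x) (grad (\<lambda>x. \<eta> (norm x)) x)
        = - (radial_weight (norm x) * deriv U (norm x) * \<beta> (norm x))"
      using x0 by (simp add: Sk_form_u[OF x] grad_u[OF x] grad_\<eta> xx power2_eq_square)
    then show ?thesis
      using k u_eq'[OF x] by (simp add: p_def q_def radial_weight_def)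
  qed
  define A where "A = {x::real^'n. a \<le> norm x \<and> norm x \<le> b}"
  have A: "compact A" "A \<subseteq> ?B - {0}"
  proof -
    have "A = cball 0 b - ball 0 a" by (auto simp: A_def)
    then show "compact A" by (simp add: compact_diff)
    show "A \<subseteq> ?B - {0}" using ab by (auto simp: A_def)
  qed
  have p_int: "integrable lborel (\<lambda>x::real^'n. indicator ?B x *\<^sub>R p (norm x))"
  proof -
    have "continuous_on A (\<lambda>x. p (norm x))"
      by (rule continuous_on_compose2[OF p_cont]) (use A in \<open>auto intro!: continuous_intros\<close>)
    then have "integrable lborel (\<lambda>x. indicator A x *\<^sub>R p (norm x))"
      by (intro borel_integrable_compact A)
    also have "(\<lambda>x. indicator A x *\<^sub>R p (norm x)) = (\<lambda>x::real^'n. indicator ?B x *\<^sub>R p (norm x))"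
    proof
      fix x :: "real^'n"
      show "indicator A x *\<^sub>R p (norm x) = indicator ?B x *\<^sub>R p (norm x)"
        using A(2) \<beta>_0[of "norm x"] by (cases "x \<in> A") (auto simp: A_def p_def)
    qed
    finally show ?thesis .
  qed
  have q_int: "integrable lborel (\<lambda>x::real^'n. indicator ?B x *\<^sub>R (g (u x) * \<eta> (norm x)))"
  proof (rule Bochner_Integration.integrable_bound)
    show int: "integrable lborel (\<lambda>x. indicator ?B x *\<^sub>R g (u x))"
      using weak by (simp add: weak_solution_def set_integrable_def)
    have "(\<lambda>x::real^'n. \<eta> (norm x)) \<in> borel_measurable lborel"
      using C1_on_continuous_on[OF \<eta>_C1] by (simp add: borel_measurable_continuous_onI)
    moreover have "(\<lambda>x. indicator ?B x *\<^sub>R g (u x)) \<in> borel_measurable lborel"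
      using int by auto
    ultimately have "(\<lambda>x. (indicator ?B x *\<^sub>R g (u x)) * \<eta> (norm x)) \<in> borel_measurable lborel"
      by (intro borel_measurable_times)
    then show "(\<lambda>x. indicator ?B x *\<^sub>R (g (u x) * \<eta> (norm x))) \<in> borel_measurable lborel"
      by (simp add: mult.assoc)
    show "AE x in lborel. norm (indicator ?B x *\<^sub>R (g (u x) * \<eta> (norm x))) \<le> norm (indicator ?B x *\<^sub>R g (u x))"
    proof (rule AE_I2)
      fix x :: "real^'n"
      have "\<bar>g (u x)\<bar> * \<bar>\<eta> (norm x)\<bar> \<le> \<bar>g (u x)\<bar> * 1"
        using \<eta>_bounds[of "norm x"] by (intro mult_left_mono) auto
      then show "norm (indicator ?B x *\<^sub>R (g (u x) * \<eta> (norm x))) \<le> norm (indicator ?B x *\<^sub>R g (u x))"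
        by (auto simp: indicator_def abs_mult)
    qed
  qed
  have "0 = (LINT x:?B|lborel. 1 / real k * Sk_form k u x (grad u x) (grad (\<lambda>x. \<eta> (norm x)) x) + g (u x) * \<eta> (norm x))"
    using weak test by (simp add: weak_solution_def)
  also have "\<dots> = (LINT x|lborel. indicator ?B x *\<^sub>R (g (u x) * \<eta> (norm x)) - indicator ?B x *\<^sub>R p (norm x))"
    unfolding set_lebesgue_integral_def
  proof (rule Bochner_Integration.integral_cong_AE)
    let ?f = "\<lambda>x. indicator ?B x *\<^sub>R (1 / real k * Sk_form k u x (grad u x) (grad (\<lambda>x. \<eta> (norm x)) x)
        + g (u x) * \<eta> (norm x))"
    let ?h = "\<lambda>x. indicator ?B x *\<^sub>R (g (u x) * \<eta> (norm x)) - indicator ?B x *\<^sub>R p (norm x)"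
    show h: "?h \<in> borel_measurable lborel"
      using p_int q_int by (intro borel_measurable_diff) auto
    have "?f = (\<lambda>x. if x = 0 then ?f 0 else ?h x)"
    proof
      fix x :: "real^'n"
      show "?f x = (if x = 0 then ?f 0 else ?h x)"
      proof (cases "x = 0")
        case True
        then show ?thesis by (simp only: if_True simp_thms)
      next
        case False
        then show ?thesis
          using integrand[of x] u_eq[of x] by (cases "x \<in> ?B") (simp_all add: q_def)
      qed
    qed
    also have "\<dots> \<in> borel_measurable lborel"
      using h by (intro measurable_If) auto
    finally show "?f \<in> borel_measurable lborel" .
    show "AE x in lborel. indicator ?B x *\<^sub>R (1 / real k * Sk_form k u x (grad u x) (grad (\<lambda>x. \<eta> (norm x)) x)
        + g (u x) * \<eta> (norm x)) = indicator ?B x *\<^sub>R (g (u x) * \<eta> (norm x)) - indicator ?B x *\<^sub>R p (norm x)"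
      using AE_lborel_singleton[of "0 :: real^'n"]
    proof (rule eventually_mono)
      fix x :: "real^'n" assume "x \<noteq> 0"
      then show "indicator ?B x *\<^sub>R (1 / real k * Sk_form k u x (grad u x) (grad (\<lambda>x. \<eta> (norm x)) x)
        + g (u x) * \<eta> (norm x)) = indicator ?B x *\<^sub>R (g (u x) * \<eta> (norm x)) - indicator ?B x *\<^sub>R p (norm x)"
        using integrand[of x] u_eq[of x] by (cases "x \<in> ?B") (simp_all add: q_def)
    qed
  qed
  also have "\<dots> = (LINT x|lborel. indicator ?B x *\<^sub>R (g (u x) * \<eta> (norm x)))
      - (LINT x|lborel. indicator ?B x *\<^sub>R p (norm x))"
    by (rule Bochner_Integration.integral_diff[OF q_int p_int])
  finally have eq: "(LINT x|lborel. indicator ?B x *\<^sub>R p (norm x)) = (LINT x|lborel. indicator ?B x *\<^sub>R (g (u x) * \<eta> (norm x)))"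
    by simp
  have p_ball_nonneg: "0 \<le> indicator ?B x *\<^sub>R p (norm x)" for x
    using p_nonneg[of "norm x"] by (cases "x = 0") (auto simp: indicator_def p_def \<beta>_0 ab less_imp_le)
  have q_ball_nonneg: "0 \<le> indicator ?B x *\<^sub>R (g (u x) * \<eta> (norm x))" for x
    using g_pos[of "u x"] \<eta>_bounds[of "norm x"] by (auto simp: indicator_def)
  have "(\<integral>\<^sup>+x\<in>?B. ennreal (p (norm x)) \<partial>lborel) = (\<integral>\<^sup>+x. ennreal (indicator ?B x *\<^sub>R p (norm x)) \<partial>lborel)"
    by (intro nn_integral_cong) (auto simp: indicator_def)
  also have "\<dots> = ennreal (LINT x|lborel. indicator ?B x *\<^sub>R p (norm x))"
    using p_int p_ball_nonneg by (intro nn_integral_eq_integral) auto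
  also have "\<dots> = (\<integral>\<^sup>+x. ennreal (indicator ?B x *\<^sub>R (g (u x) * \<eta> (norm x))) \<partial>lborel)"
    unfolding eq using q_int q_ball_nonneg by (intro nn_integral_eq_integral[symmetric]) auto
  also have "\<dots> = (\<integral>\<^sup>+x\<in>?B. ennreal (g (u x) * \<eta> (norm x)) \<partial>lborel)"
    by (intro nn_integral_cong) (auto simp: indicator_def)
  finally have "(\<integral>\<^sup>+x\<in>?B. ennreal (p (norm x)) \<partial>lborel) = (\<integral>\<^sup>+x\<in>?B. ennreal (g (u x) * \<eta> (norm x)) \<partial>lborel)" .
  also have "(\<integral>\<^sup>+x\<in>?B. ennreal (p (norm x)) \<partial>lborel) = ennreal (sphere_mass TYPE(real^'n)) *
      (\<integral>\<^sup>+r\<in>{0<..<1}. ennreal (r ^ (CARD('n) - 1) * p r) \<partial>lborel)"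
    using nn_integral_ball_radial[OF p_cont, where F = "\<lambda>x::real^'n. p (norm x)"] by simp
  also have "(\<integral>\<^sup>+x\<in>?B. ennreal (g (u x) * \<eta> (norm x)) \<partial>lborel) = ennreal (sphere_mass TYPE(real^'n)) *
      (\<integral>\<^sup>+r\<in>{0<..<1}. ennreal (r ^ (CARD('n) - 1) * q r) \<partial>lborel)"
    using nn_integral_ball_radial[OF q_cont, where F = "\<lambda>x::real^'n. g (u x) * \<eta> (norm x)"]
    by (simp add: q_def u_eq)
  finally have main: "(\<integral>\<^sup>+r\<in>{0<..<1}. ennreal (r ^ (CARD('n) - 1) * p r) \<partial>lborel)
      = (\<integral>\<^sup>+r\<in>{0<..<1}. ennreal (r ^ (CARD('n) - 1) * q r) \<partial>lborel)"
    using sphere_mass(1)[where 'a = "real^'n"] by (simp add: ennreal_mult_cancel_left)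
  have "(\<integral>\<^sup>+r\<in>{0<..<1}. ennreal (coef * flux r * \<beta> r) \<partial>lborel)
      = (\<integral>\<^sup>+r\<in>{0<..<1}. ennreal (r ^ (CARD('n) - 1) * p r) \<partial>lborel)"
  proof (rule nn_integral_cong)
    fix r :: real
    show "ennreal (coef * flux r * \<beta> r) * indicator {0<..<1} r
        = ennreal (r ^ (CARD('n) - 1) * p r) * indicator {0<..<1} r"
    proof (cases "r \<in> {0<..<1}")
      case True
      have "CARD('n) - 1 = (CARD('n) - k) + (k - 1)" using k by auto
      then have "r ^ (CARD('n) - 1) * (deriv U r / r) ^ (k - 1) = r ^ (CARD('n) - k) * deriv U r ^ (k - 1)"
        using True by (simp only: power_add power_divide) simp
      moreover have "deriv U r ^ k = deriv U r ^ (k - 1) * deriv U r"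
        using k by (cases k) auto
      ultimately have "coef * flux r * \<beta> r = r ^ (CARD('n) - 1) * p r"
        by (simp add: flux_def p_def mult_ac)
      then show ?thesis by simp
    qed simp
  qed
  then show ?thesis
    using main by (simp add: q_def)
qed

end

context radial_solution
begin

text \<open>The cutoff in the preceding identity is the tail integral of \<open>\<beta>\<close>, so Tonelli's theorem turns the
identity into \<open>\<integral> c P \<beta> = \<integral> G \<beta>\<close> with \<open>G(t) = \<integral>\<^sub>0\<^sup>t r\<^sup>n\<^sup>-\<^sup>1 g(u) dr\<close>. Since \<open>\<beta>\<close> can be concentrated at any
radius, the continuous functions \<open>c P\<close> and \<open>G\<close> agree. The cutoffs do not vanish at the origin, and
this is what excludes an additive constant: a conical singularity with \<open>P(0+) > 0\<close> is not a
weak solution.\<close>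

lemma weak_flux_eq_integral:
  assumes weak: "weak_solution k g u"
  defines "\<gamma> \<equiv> \<lambda>r. indicator {0<..<1} r *\<^sub>R (r ^ (CARD('n) - 1) * g (U r))"
  shows "\<gamma> integrable_on {0..1}"
    and "r \<in> {0<..<1} \<Longrightarrow> coef * flux r = integral {0..r} \<gamma>"
proof -
  have gU_cont: "continuous_on {0<..<1} (\<lambda>r. g (U r))"
    by (rule continuous_on_compose2[OF g_continuous continuous_on_U]) auto
  have \<gamma>_meas [measurable]: "\<gamma> \<in> borel_measurable borel"
    unfolding \<gamma>_def by (intro borel_measurable_continuous_on_indicator continuous_intros gU_cont) auto
  have \<gamma>_nonneg: "\<gamma> r \<ge> 0" for r
    unfolding \<gamma>_def using g_pos[of "U r"] by (auto simp: indicator_def)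
  have \<gamma>_int: "integrable lborel \<gamma>"
  proof (rule integrableI_nonneg)
    have "(\<integral>\<^sup>+x\<in>ball 0 1. ennreal (g (u x)) \<partial>lborel) = (\<integral>\<^sup>+x. ennreal (indicator (ball 0 1) x *\<^sub>R g (u x)) \<partial>lborel)"
      by (intro nn_integral_cong) (auto simp: indicator_def)
    also have "\<dots> < \<infinity>"
    proof -
      have "integrable lborel (\<lambda>x. indicator (ball 0 1) x *\<^sub>R g (u x))"
        using weak by (simp add: weak_solution_def set_integrable_def)
      then show ?thesis
        by (simp add: real_integrable_def top.not_eq_extremum)
    qed
    finally have "(\<integral>\<^sup>+x\<in>ball 0 1. ennreal (g (u x)) \<partial>lborel) < \<infinity>" .
    moreover have "(\<integral>\<^sup>+x\<in>ball 0 1. ennreal (g (u x)) \<partial>lborel) = ennreal (sphere_mass TYPE(real^'n)) *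
        (\<integral>\<^sup>+r\<in>{0<..<1}. ennreal (r ^ (CARD('n) - 1) * g (U r)) \<partial>lborel)"
      using nn_integral_ball_radial[OF gU_cont, where F = "\<lambda>x::real^'n. g (u x)"] by (simp add: u_eq)
    moreover have "(\<integral>\<^sup>+r\<in>{0<..<1}. ennreal (r ^ (CARD('n) - 1) * g (U r)) \<partial>lborel) = (\<integral>\<^sup>+r. ennreal (\<gamma> r) \<partial>lborel)"
      by (intro nn_integral_cong) (auto simp: \<gamma>_def indicator_def)
    ultimately show "(\<integral>\<^sup>+r. ennreal (\<gamma> r) \<partial>lborel) < \<infinity>"
      using sphere_mass(1)[where 'a = "real^'n"] by (auto simp: ennreal_mult_less_top)
  qed (use \<gamma>_nonneg in auto)
  have \<gamma>_set: "set_integrable lborel {0..t} \<gamma>" for t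
    unfolding set_integrable_def using \<gamma>_int by (intro integrable_mult_indicator) auto
  show \<gamma>_on: "\<gamma> integrable_on {0..1}"
    by (rule set_borel_integral_eq_integral(1)[OF \<gamma>_set])
  define G where "G t = integral {0..t} \<gamma>" for t
  have G_nn: "(\<integral>\<^sup>+r\<in>{0..t}. ennreal (\<gamma> r) \<partial>lborel) = ennreal (G t)" for t
  proof -
    have "(\<integral>\<^sup>+r\<in>{0..t}. ennreal (\<gamma> r) \<partial>lborel) = (\<integral>\<^sup>+r. ennreal (indicator {0..t} r *\<^sub>R \<gamma> r) \<partial>lborel)"
      by (intro nn_integral_cong) (auto simp: indicator_def)
    also have "\<dots> = ennreal (LINT r:{0..t}|lborel. \<gamma> r)"
      unfolding set_lebesgue_integral_def
      by (rule nn_integral_eq_integral) (use \<gamma>_set \<gamma>_nonneg in \<open>auto simp: set_integrable_def\<close>)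
    finally show ?thesis
      by (simp add: G_def set_borel_integral_eq_integral(2)[OF \<gamma>_set])
  qed
  have G_nonneg: "G t \<ge> 0" for t
    unfolding G_def by (rule integral_nonneg[OF set_borel_integral_eq_integral(1)[OF \<gamma>_set]]) (rule \<gamma>_nonneg)
  have G_cont: "continuous_on {0..1} G"
    unfolding G_def[abs_def] by (rule indefinite_integral_continuous_1[OF \<gamma>_on])
  have flux_cont: "continuous_on {0<..<1} flux"
    by (meson DERIV_isCont flux_deriv continuous_at_imp_continuous_on)
  have flux_nonneg: "flux r \<ge> 0" if "r \<in> {0<..<1}" for r
    unfolding flux_def using that U'_nonneg[OF that] by simp
  have tested: "integral {a..b} (\<lambda>r. coef * flux r * (tent ((r - a) / (b - a)) / (b - a)))
      = integral {a..b} (\<lambda>r. G r * (tent ((r - a) / (b - a)) / (b - a)))"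
    if ab: "0 < a" "a < b" "b < 1" for a b
  proof -
    define \<beta> where "\<beta> r = tent ((r - a) / (b - a)) / (b - a)" for r
    define S where "S r = c1_step ((r - a) / (b - a))" for r
    have S': "(S has_real_derivative \<beta> r) (at r)" for r
    proof -
      have "((\<lambda>r. (r - a) / (b - a)) has_real_derivative 1 / (b - a)) (at r)"
        using ab by (auto intro!: derivative_eq_intros)
      from DERIV_chain2[where f = c1_step, OF c1_step_has_real_derivative this]
      show ?thesis unfolding S_def[abs_def] \<beta>_def by simp
    qed
    have \<beta>_cont: "continuous_on T \<beta>" for T
      unfolding \<beta>_def using ab by (intro continuous_intros continuous_on_compose2[OF continuous_on_tent]) auto
    have \<beta>_meas [measurable]: "\<beta> \<in> borel_measurable borel"
      by (rule borel_measurable_continuous_onI[OF \<beta>_cont])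
    have \<beta>_nonneg: "\<beta> r \<ge> 0" for r
      unfolding \<beta>_def using ab tent_bounds by simp
    have \<beta>_0: "\<beta> r = 0" if "r \<notin> {a..b}" for r
      unfolding \<beta>_def using ab that by (auto intro!: tent_eq_0 simp: divide_le_0_iff)
    have tail: "(\<integral>\<^sup>+t. ennreal (\<beta> t) * indicator {r..} t \<partial>lborel) = ennreal (1 - S r)" for r
    proof (rule nn_integral_FTC_atLeast)
      have "\<forall>\<^sub>F t in at_top. S t = 1"
        using eventually_ge_at_top[of b] by eventually_elim (use ab in \<open>simp add: S_def c1_step_eq_1\<close>)
      then show "(S \<longlongrightarrow> 1) at_top"
        by (rule tendsto_eventually)
    qed (use S' \<beta>_nonneg in auto)
    have "(\<integral>\<^sup>+r\<in>{a..b}. ennreal (coef * flux r * \<beta> r) \<partial>lborel)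
        = (\<integral>\<^sup>+r\<in>{0<..<1}. ennreal (coef * flux r * \<beta> r) \<partial>lborel)"
      by (intro nn_integral_cong) (use \<beta>_0 ab in \<open>auto simp: indicator_def\<close>)
    also have "\<dots> = (\<integral>\<^sup>+r\<in>{0<..<1}. ennreal (r ^ (CARD('n) - 1) * (g (U r) * (1 - S r))) \<partial>lborel)"
      unfolding \<beta>_def S_def by (rule weak_radial_identity[OF weak ab])
    also have "\<dots> = (\<integral>\<^sup>+r. (\<integral>\<^sup>+t. ennreal (\<gamma> r) * (ennreal (\<beta> t) * indicator {r..} t) \<partial>lborel) \<partial>lborel)"
    proof (rule nn_integral_cong)
      fix r :: real
      have "(\<integral>\<^sup>+t. ennreal (\<gamma> r) * (ennreal (\<beta> t) * indicator {r..} t) \<partial>lborel) = ennreal (\<gamma> r) * ennreal (1 - S r)"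
        by (subst nn_integral_cmult) (auto simp: tail)
      also have "\<dots> = ennreal (\<gamma> r * (1 - S r))"
        by (rule ennreal_mult'[symmetric, OF \<gamma>_nonneg])
      finally show "ennreal (r ^ (CARD('n) - 1) * (g (U r) * (1 - S r))) * indicator {0<..<1} r
          = (\<integral>\<^sup>+t. ennreal (\<gamma> r) * (ennreal (\<beta> t) * indicator {r..} t) \<partial>lborel)"
        by (simp add: \<gamma>_def indicator_def mult.assoc)
    qed
    also have "\<dots> = (\<integral>\<^sup>+t. (\<integral>\<^sup>+r. ennreal (\<gamma> r) * (ennreal (\<beta> t) * indicator {r..} t) \<partial>lborel) \<partial>lborel)"
    proof (rule lborel_pair.Fubini')
      have "(\<lambda>(t, r). ennreal (\<gamma> r) * (ennreal (\<beta> t) * (if r \<le> t then 1 else 0))) \<in> borel_measurable (lborel \<Otimes>\<^sub>M lborel)"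
        by measurable
      also have "(\<lambda>(t, r). ennreal (\<gamma> r) * (ennreal (\<beta> t) * (if r \<le> t then 1 else 0)))
          = (\<lambda>(t, r). ennreal (\<gamma> r) * (ennreal (\<beta> t) * indicator {r..} t))"
        by (auto simp: indicator_def fun_eq_iff)
      finally show "(\<lambda>(t, r). ennreal (\<gamma> r) * (ennreal (\<beta> t) * indicator {r..} t)) \<in> borel_measurable (lborel \<Otimes>\<^sub>M lborel)" .
    qed
    also have "\<dots> = (\<integral>\<^sup>+t\<in>{a..b}. ennreal (G t * \<beta> t) \<partial>lborel)"
    proof (rule nn_integral_cong)
      fix t :: real
      have "(\<integral>\<^sup>+r. ennreal (\<gamma> r) * (ennreal (\<beta> t) * indicator {r..} t) \<partial>lborel)
          = (\<integral>\<^sup>+r. (ennreal (\<gamma> r) * indicator {0..t} r) * ennreal (\<beta> t) \<partial>lborel)"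
        by (intro nn_integral_cong) (auto simp: indicator_def \<gamma>_def mult_ac)
      also have "\<dots> = ennreal (G t) * ennreal (\<beta> t)"
        by (subst nn_integral_multc) (auto simp: G_nn)
      also have "\<dots> = ennreal (G t * \<beta> t)"
        by (rule ennreal_mult'[symmetric, OF G_nonneg])
      finally show "(\<integral>\<^sup>+r. ennreal (\<gamma> r) * (ennreal (\<beta> t) * indicator {r..} t) \<partial>lborel)
          = ennreal (G t * \<beta> t) * indicator {a..b} t"
        using \<beta>_0[of t] by (cases "t \<in> {a..b}") auto
    qed
    finally have eq: "(\<integral>\<^sup>+r\<in>{a..b}. ennreal (coef * flux r * \<beta> r) \<partial>lborel) = (\<integral>\<^sup>+t\<in>{a..b}. ennreal (G t * \<beta> t) \<partial>lborel)" .
    have 1: "continuous_on {a..b} (\<lambda>r. coef * flux r * \<beta> r)" "\<And>r. r \<in> {a..b} \<Longrightarrow> 0 \<le> coef * flux r * \<beta> r"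
      using ab flux_nonneg \<beta>_nonneg coef_pos
      by (auto intro!: continuous_intros continuous_on_subset[OF flux_cont] \<beta>_cont mult_nonneg_nonneg)
    have 2: "continuous_on {a..b} (\<lambda>r. G r * \<beta> r)" "\<And>r. r \<in> {a..b} \<Longrightarrow> 0 \<le> G r * \<beta> r"
      using ab G_nonneg \<beta>_nonneg
      by (auto intro!: continuous_intros continuous_on_subset[OF G_cont] \<beta>_cont mult_nonneg_nonneg)
    have "ennreal (integral {a..b} (\<lambda>r. coef * flux r * \<beta> r)) = ennreal (integral {a..b} (\<lambda>r. G r * \<beta> r))"
      using eq nn_integral_Icc_continuous[OF 1] nn_integral_Icc_continuous[OF 2] by simp
    moreover have "0 \<le> integral {a..b} (\<lambda>r. coef * flux r * \<beta> r)" "0 \<le> integral {a..b} (\<lambda>r. G r * \<beta> r)"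
      using 1 2 by (auto intro!: integral_nonneg integrable_continuous_interval)
    ultimately show ?thesis
      by (simp add: \<beta>_def)
  qed
  show "coef * flux r = integral {0..r} \<gamma>" if r: "r \<in> {0<..<1}"
  proof (rule ccontr)
    assume neq: "coef * flux r \<noteq> integral {0..r} \<gamma>"
    \<comment> \<open>The sign makes the difference positive at \<open>r\<close>, hence on a neighbourhood, where it is then tested with a positive \<open>\<beta>\<close>.\<close>
    define \<sigma> where "\<sigma> = sgn (coef * flux r - G r)"
    define D where "D t = \<sigma> * (coef * flux t - G t)" for t
    have D_cont: "continuous_on {0<..<1} D"
      unfolding D_def by (intro continuous_intros flux_cont continuous_on_subset[OF G_cont]) auto
    have "D r > 0"
      using neq unfolding D_def \<sigma>_def G_def by (auto simp: sgn_if)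
    moreover have "open ({0<..<1} \<inter> D -` {0<..})"
      by (rule continuous_open_preimage[OF D_cont]) auto
    moreover from calculation have "r \<in> {0<..<1} \<inter> D -` {0<..}"
      using r by simp
    ultimately obtain e where e: "e > 0" "cball r e \<subseteq> {0<..<1} \<inter> D -` {0<..}"
      unfolding open_contains_cball by blast
    define a where "a = r - e"
    define b where "b = r + e"
    define \<beta> where "\<beta> t = tent ((t - a) / (b - a)) / (b - a)" for t
    have sub: "t \<in> {0<..<1} \<and> D t > 0" if "t \<in> {a..b}" for t
      using that e by (auto simp: subset_iff a_def b_def dist_real_def)
    have ab: "0 < a" "a < b" "b < 1"
      using sub[of a] sub[of b] e by (auto simp: a_def b_def)
    have \<beta>_cont: "continuous_on T \<beta>" for T
      unfolding \<beta>_def using ab by (intro continuous_intros continuous_on_compose2[OF continuous_on_tent]) auto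
    have cont1: "continuous_on {a..b} (\<lambda>t. coef * flux t * \<beta> t)" and cont2: "continuous_on {a..b} (\<lambda>t. G t * \<beta> t)"
      using ab by (auto intro!: continuous_intros continuous_on_subset[OF flux_cont] continuous_on_subset[OF G_cont] \<beta>_cont)
    have "((\<lambda>t. coef * flux t * \<beta> t - G t * \<beta> t) has_integral
        integral {a..b} (\<lambda>t. coef * flux t * \<beta> t) - integral {a..b} (\<lambda>t. G t * \<beta> t)) {a..b}"
      by (intro has_integral_diff integrable_integral integrable_continuous_interval cont1 cont2)
    then have "((\<lambda>t. coef * flux t * \<beta> t - G t * \<beta> t) has_integral 0) {a..b}"
      using tested[OF ab] unfolding \<beta>_def by (simp only: diff_self)
    from has_integral_mult_right[OF this, of \<sigma>]
    have zero: "((\<lambda>t. D t * \<beta> t) has_integral 0) {a..b}"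
      by (simp add: D_def algebra_simps)
    have "D r * \<beta> r = 0"
    proof (rule has_integral_0_cbox_imp_0[of a b "\<lambda>t. D t * \<beta> t"])
      show "continuous_on (cbox a b) (\<lambda>t. D t * \<beta> t)"
        using ab by (auto intro!: continuous_intros continuous_on_subset[OF D_cont] \<beta>_cont)
      show "0 \<le> D t * \<beta> t" if "t \<in> box a b" for t
        using sub[of t] that ab tent_bounds(1) by (auto simp: \<beta>_def intro!: mult_nonneg_nonneg)
    qed (use zero ab e in \<open>auto simp: a_def b_def\<close>)
    moreover have "\<beta> r > 0"
      unfolding \<beta>_def using e by (auto simp: a_def b_def intro!: divide_pos_pos tent_pos)
    ultimately show False
      using \<open>D r > 0\<close> by simp
  qed
qed

text \<open>For classical solutions the equation holds by assumption and \<open>u'\<close> vanishes at the origin; for weak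
solutions both claims are read off the integral representation of the flux.\<close>

theorem radial_ode:
  shows "r \<in> {0<..<1} \<Longrightarrow> Sk_profile r = g (U r)"
    and "(flux \<longlongrightarrow> 0) (at_right 0)"
proof -
  have *: "(r \<in> {0<..<1} \<longrightarrow> Sk_profile r = g (U r)) \<and> (flux \<longlongrightarrow> 0) (at_right 0)" for r
    using sol
  proof
    assume "classical_solution k g u"
    then show ?thesis
      using classical_Sk_profile classical_flux_tendsto by blast
  next
    assume weak: "weak_solution k g u"
    define \<gamma> where "\<gamma> r = indicator {0<..<1} r *\<^sub>R (r ^ (CARD('n) - 1) * g (U r))" for r
    define G where "G t = integral {0..t} \<gamma>" for t
    have int: "\<gamma> integrable_on {0..1}" and eq: "\<And>r. r \<in> {0<..<1} \<Longrightarrow> coef * flux r = G r"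
      using weak_flux_eq_integral[OF weak] unfolding \<gamma>_def[abs_def] G_def by auto
    have "continuous_on {0..1} G"
      unfolding G_def[abs_def] by (rule indefinite_integral_continuous_1[OF int])
    then have "(G \<longlongrightarrow> G 0) (at 0 within {0..1})"
      by (simp add: continuous_on_def)
    then have "(G \<longlongrightarrow> 0) (at_right 0)"
      by (simp add: G_def at_within_Icc_at_right)
    then have "((\<lambda>r. G r / coef) \<longlongrightarrow> 0 / coef) (at_right 0)"
      using coef_pos by (intro tendsto_intros) auto
    moreover have "\<forall>\<^sub>F r in at_right 0. G r / coef = flux r"
      using eventually_at_right_real[of 0 1] by (rule eventually_mono) (use eq coef_pos in \<open>auto simp: field_simps\<close>)
    ultimately have lim: "(flux \<longlongrightarrow> 0) (at_right 0)"
      using Lim_transform_eventually by fastforce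
    have "Sk_profile r = g (U r)" if r: "r \<in> {0<..<1}"
    proof -
      have "continuous_on {0<..<1} (\<lambda>r. r ^ (CARD('n) - 1) * g (U r))"
        by (intro continuous_intros continuous_on_compose2[OF g_continuous continuous_on_U]) auto
      then have "continuous_on {0<..<1} \<gamma>"
        by (rule continuous_on_eq) (simp add: \<gamma>_def)
      then have "isCont \<gamma> r"
        using r by (simp add: continuous_on_eq_continuous_at)
      then have "continuous (at r within {0..1}) \<gamma>"
        by (rule continuous_at_imp_continuous_at_within)
      then have "(G has_vector_derivative \<gamma> r) (at r within {0..1})"
        using integral_has_vector_derivative_continuous_at[OF int, of r "{}"] r unfolding G_def[abs_def] by simp
      then have "(G has_real_derivative \<gamma> r) (at r)"
        using r by (simp add: has_real_derivative_iff_has_vector_derivative at_within_Icc_at)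
      then have "((\<lambda>r. coef * flux r) has_real_derivative \<gamma> r) (at r)"
        by (rule has_field_derivative_transform_within_open[of _ _ _ "{0<..<1}"]) (use r eq in auto)
      moreover have "((\<lambda>r. coef * flux r) has_real_derivative coef * (r ^ (CARD('n) - 1) * Sk_profile r / coef)) (at r)"
        by (rule DERIV_cmult[OF flux_deriv[OF r]])
      ultimately have "\<gamma> r = coef * (r ^ (CARD('n) - 1) * Sk_profile r / coef)"
        by (rule DERIV_unique)
      then show ?thesis
        using r coef_pos by (simp add: \<gamma>_def)
    qed
    with lim show ?thesis by blast
  qed
  show "r \<in> {0<..<1} \<Longrightarrow> Sk_profile r = g (U r)" "(flux \<longlongrightarrow> 0) (at_right 0)"
    using * by blast+
qed

lemma radial_weight_bound:
  assumes "0 < \<rho>" "\<rho> < 1"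
  obtains C where "C > 0" "\<And>r. r \<in> {0<..\<rho>} \<Longrightarrow> r ^ (CARD('n) - 1) * radial_weight r \<le> C * r"
proof -
  obtain C where C: "C > 0" "\<forall>r\<in>{0<..\<rho>}. r ^ (CARD('n) - k) * deriv U r ^ (k - 1) \<le> C * r"
    using flux_weight_bound[OF dim _ _ coef_pos g_continuous g_pos U_deriv U'_nonneg flux_def _ radial_ode(2) assms]
      flux_deriv radial_ode(1) k by fastforce
  have "r ^ (CARD('n) - 1) * radial_weight r \<le> (real k * coef * C) * r" if r: "r \<in> {0<..\<rho>}" for r
  proof -
    have "CARD('n) - 1 = (CARD('n) - k) + (k - 1)" using k by auto
    then have "r ^ (CARD('n) - 1) * (deriv U r / r) ^ (k - 1) = r ^ (CARD('n) - k) * deriv U r ^ (k - 1)"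
      using r by (simp only: power_add power_divide) simp
    then have "r ^ (CARD('n) - 1) * radial_weight r = (real k * coef) * (r ^ (CARD('n) - k) * deriv U r ^ (k - 1))"
      by (simp add: radial_weight_def mult_ac)
    also have "\<dots> \<le> (real k * coef) * (C * r)"
      using C(2) r coef_pos by (intro mult_left_mono) auto
    finally show ?thesis by (simp only: mult.assoc)
  qed
  moreover have "real k * coef * C > 0"
    using k coef_pos C(1) by simp
  ultimately show ?thesis using that by blast
qed

text \<open>With \<open>l = u' / r\<close> and \<open>v = u''\<close>, positivity of \<open>S\<^sub>k\<close> forces \<open>l > 0\<close> and \<open>(n - k) l + k v > 0\<close> for
\<open>k \<ge> 2\<close>, and the tangential coefficient is a nonnegative multiple of \<open>(n - k) l + (k - 1) v\<close>, which
is a nonnegative combination of \<open>(n - k) l + k v\<close> and \<open>(n - k) l\<close>.\<close>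

lemma tangential_weight_nonneg:
  assumes r: "r \<in> {0<..<1}"
  shows "radial_weight r + tangential_excess r \<ge> 0"
proof (cases "k = 1")
  case True
  then show ?thesis
    unfolding radial_weight_def tangential_excess_def using coef_pos by simp
next
  case False
  then have k2: "k \<ge> 2" using k by auto
  define n where "n = real CARD('n)"
  define l where "l = deriv U r / r"
  define v where "v = deriv (deriv U) r"
  define X where "X = l ^ (k - 2)"
  define c2 where "c2 = real ((CARD('n) - 2) choose (k - 2))"
  have l0: "l \<ge> 0"
    using r U'_nonneg[OF r] by (simp add: l_def)
  have X: "X \<ge> 0" "l ^ (k - 1) = l * X" "l ^ k = l * (l * X)"
  proof -
    obtain j where "k = Suc (Suc j)" using k2 by (metis Suc_le_D numeral_2_eq_2 Suc_le_mono)
    then show "X \<ge> 0" "l ^ (k - 1) = l * X" "l ^ k = l * (l * X)"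
      using l0 by (simp_all add: X_def)
  qed
  have nk: "real (CARD('n) - k) = n - real k" "n \<ge> real k" "n \<ge> 2"
    using k dim by (auto simp: n_def of_nat_diff)
  have "Sk_profile r = (coef * (l * X)) * ((n - real k) * l + real k * v)"
    unfolding Sk_profile_def l_def[symmetric] v_def[symmetric] X nk(1) by (simp add: algebra_simps)
  then have pos: "(coef * (l * X)) * ((n - real k) * l + real k * v) > 0"
    using radial_ode(1)[OF r] g_pos[of "U r"] by simp
  have "(n - real k) * l + real k * v > 0"
  proof (rule ccontr)
    assume "\<not> (n - real k) * l + real k * v > 0"
    then have "(coef * (l * X)) * ((n - real k) * l + real k * v) \<le> 0"
      using coef_pos l0 X(1) by (intro mult_nonneg_nonpos) auto
    then show False using pos by simp
  qed
  then have "(real k - 1) * ((n - real k) * l + real k * v) \<ge> 0"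
    using k2 by (intro mult_nonneg_nonneg[of "real k - 1"]) auto
  moreover have "(n - real k) * l \<ge> 0"
    using nk l0 by (intro mult_nonneg_nonneg) auto
  ultimately have "(real k - 1) * ((n - real k) * l + real k * v) + (n - real k) * l \<ge> 0"
    by (rule add_nonneg_nonneg)
  also have "(real k - 1) * ((n - real k) * l + real k * v) + (n - real k) * l
      = real k * ((n - real k) * l + (real k - 1) * v)"
    by (simp add: algebra_simps)
  finally have main: "(n - real k) * l + (real k - 1) * v \<ge> 0"
    using k2 by (simp add: zero_le_mult_iff)
  have "(k - 1) * ((CARD('n) - 1) choose (k - 1)) = (CARD('n) - 1) * ((CARD('n) - 1 - 1) choose (k - 1 - 1))"
    using k2 by (intro times_binomial_minus1_eq) auto
  then have "real (k - 1) * real ((CARD('n) - 1) choose (k - 1)) = real (CARD('n) - 1) * c2"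
    unfolding c2_def by (metis of_nat_mult diff_diff_left one_add_one)
  then have c2: "(real k - 1) * (real k * coef) = (n - 1) * c2"
    using k2 dim by (simp add: k_coef n_def of_nat_diff)
  have "(n - 1) * (radial_weight r + tangential_excess r)
      = (n - 1) * (real k * coef) * (l * X) + (v - l) * X * ((n - 1) * c2)"
    using False unfolding radial_weight_def tangential_excess_def l_def[symmetric] v_def[symmetric] X c2_def[symmetric]
      X_def[symmetric] by (simp add: algebra_simps)
  also have "\<dots> = (real k * coef * X) * ((n - real k) * l + (real k - 1) * v)"
    unfolding c2[symmetric] by (simp add: algebra_simps)
  also have "\<dots> \<ge> 0"
    using main coef_pos X(1) by (intro mult_nonneg_nonneg) auto
  finally show ?thesis
    using nk by (simp add: zero_le_mult_iff)
qed

end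

section \<open>Sign of an integral whose positive and negative parts may be infinite\<close>

lemma nn_integrand_measurable:
  assumes "open S" "continuous_on S f"
  shows "(\<lambda>x::'a::euclidean_space. ennreal (f x) * indicator S x) \<in> borel_measurable lborel"
proof -
  have "(\<lambda>x. ennreal (indicator S x *\<^sub>R f x)) \<in> borel_measurable lborel"
    using borel_measurable_continuous_on_indicator[OF _ assms(2)] assms(1) by simp
  also have "(\<lambda>x. ennreal (indicator S x *\<^sub>R f x)) = (\<lambda>x. ennreal (f x) * indicator S x)"
    by (auto simp: indicator_def)
  finally show ?thesis .
qed

lemma nn_integral_puncture:
  fixes c :: "'a::euclidean_space"
  shows "(\<integral>\<^sup>+x\<in>S - {c}. h x \<partial>lborel) = (\<integral>\<^sup>+x\<in>S. h x \<partial>lborel)"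
proof (rule nn_integral_cong_AE, use AE_lborel_singleton[of c] in \<open>rule eventually_mono\<close>)
  fix x assume "x \<noteq> c"
  then show "h x * indicator (S - {c}) x = h x * indicator S x"
    by (simp add: indicator_def)
qed

lemma integral_nonneg_puncture:
  "integral_nonneg (S - {c}) f \<longleftrightarrow> integral_nonneg S f"
  by (simp only: integral_nonneg_def nn_integral_puncture)

lemma integral_nonneg_cong:
  assumes "\<And>x. x \<in> S \<Longrightarrow> f x = h x"
  shows "integral_nonneg S f \<longleftrightarrow> integral_nonneg S h"
proof -
  have "(\<integral>\<^sup>+x\<in>S. ennreal (f x) \<partial>lborel) = (\<integral>\<^sup>+x\<in>S. ennreal (h x) \<partial>lborel)"
    "(\<integral>\<^sup>+x\<in>S. ennreal (- f x) \<partial>lborel) = (\<integral>\<^sup>+x\<in>S. ennreal (- h x) \<partial>lborel)"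
    using assms by (auto intro!: nn_integral_cong simp: indicator_def)
  then show ?thesis
    by (simp add: integral_nonneg_def)
qed

lemma integral_nonneg_mono:
  assumes "integral_nonneg S f" "\<And>x. x \<in> S \<Longrightarrow> f x \<le> h x"
  shows "integral_nonneg S h"
proof -
  have "(\<integral>\<^sup>+x\<in>S. ennreal (- h x) \<partial>lborel) \<le> (\<integral>\<^sup>+x\<in>S. ennreal (- f x) \<partial>lborel)"
    using assms(2) by (intro nn_integral_mono) (auto simp: indicator_def intro!: ennreal_leI)
  also have "\<dots> \<le> (\<integral>\<^sup>+x\<in>S. ennreal (f x) \<partial>lborel)"
    using assms(1) by (simp add: integral_nonneg_def)
  also have "\<dots> \<le> (\<integral>\<^sup>+x\<in>S. ennreal (h x) \<partial>lborel)"
    using assms(2) by (intro nn_integral_mono) (auto simp: indicator_def intro!: ennreal_leI)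
  finally show ?thesis
    by (simp add: integral_nonneg_def)
qed

text \<open>The identity \<open>f\<^sup>+ + b\<^sup>- = f\<^sup>- + a + b\<^sup>+\<close> for \<open>f = a + b\<close> and \<open>a \<ge> 0\<close>, integrated. Written without
differences, it is meaningful when some of the integrals are infinite.\<close>

lemma integral_nonneg_add_balance:
  fixes a b :: "'a::euclidean_space \<Rightarrow> real"
  assumes S: "open S" and a: "continuous_on S a" and b: "continuous_on S b"
    and a0: "\<And>x. x \<in> S \<Longrightarrow> a x \<ge> 0"
  shows "(\<integral>\<^sup>+x\<in>S. ennreal (a x + b x) \<partial>lborel) + (\<integral>\<^sup>+x\<in>S. ennreal (- b x) \<partial>lborel)
    = (\<integral>\<^sup>+x\<in>S. ennreal (- (a x + b x)) \<partial>lborel)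
      + ((\<integral>\<^sup>+x\<in>S. ennreal (a x) \<partial>lborel) + (\<integral>\<^sup>+x\<in>S. ennreal (b x) \<partial>lborel))"
proof -
  note meas = nn_integrand_measurable[OF S]
  have pointwise: "ennreal (s + t) + ennreal (- t) = ennreal (- (s + t)) + (ennreal s + ennreal t)" if "s \<ge> 0" for s t :: real
  proof -
    consider "t \<ge> 0" | "t < 0" "s + t \<ge> 0" | "t < 0" "s + t < 0" by linarith
    then show ?thesis
    proof cases
      case 1
      then show ?thesis using that by (simp add: ennreal_neg flip: ennreal_plus)
    next
      case 2
      then show ?thesis using that by (simp add: ennreal_neg flip: ennreal_plus)
    next
      case 3
      then show ?thesis using that by (simp add: ennreal_neg flip: ennreal_plus)
    qed
  qed
  have "(\<integral>\<^sup>+x\<in>S. ennreal (a x + b x) \<partial>lborel) + (\<integral>\<^sup>+x\<in>S. ennreal (- b x) \<partial>lborel)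
      = (\<integral>\<^sup>+x. ennreal (a x + b x) * indicator S x + ennreal (- b x) * indicator S x \<partial>lborel)"
    by (intro nn_integral_add[symmetric] meas continuous_intros a b)
  also have "\<dots> = (\<integral>\<^sup>+x. ennreal (- (a x + b x)) * indicator S x
      + (ennreal (a x) * indicator S x + ennreal (b x) * indicator S x) \<partial>lborel)"
  proof (rule nn_integral_cong)
    fix x
    show "ennreal (a x + b x) * indicator S x + ennreal (- b x) * indicator S x
      = ennreal (- (a x + b x)) * indicator S x + (ennreal (a x) * indicator S x + ennreal (b x) * indicator S x)"
    proof (cases "x \<in> S")
      case True
      then show ?thesis using pointwise[OF a0[OF True], of "b x"] by simp
    qed simp
  qed
  also have "\<dots> = (\<integral>\<^sup>+x\<in>S. ennreal (- (a x + b x)) \<partial>lborel)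
      + (\<integral>\<^sup>+x. ennreal (a x) * indicator S x + ennreal (b x) * indicator S x \<partial>lborel)"
    by (intro nn_integral_add meas borel_measurable_add continuous_intros a b)
  also have "(\<integral>\<^sup>+x. ennreal (a x) * indicator S x + ennreal (b x) * indicator S x \<partial>lborel)
      = (\<integral>\<^sup>+x\<in>S. ennreal (a x) \<partial>lborel) + (\<integral>\<^sup>+x\<in>S. ennreal (b x) \<partial>lborel)"
    by (intro nn_integral_add meas a b)
  finally show ?thesis .
qed

lemma ennreal_add_le_cancel_left:
  fixes x y z :: ennreal
  shows "z < \<infinity> \<Longrightarrow> z + x \<le> z + y \<Longrightarrow> x \<le> y"
  using ennreal_add_left_cancel_le[of z x y] by (cases "z = \<infinity>") simp_all

text \<open>For \<open>a \<ge> 0\<close> of finite integral, the sign of \<open>\<integral> (a + b)\<close> is decided by comparing the negative part of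
\<open>b\<close> with \<open>a\<close> and the positive part of \<open>b\<close>, a form that survives limits of cutoffs.\<close>

lemma integral_nonneg_add_iff:
  fixes a b :: "'a::euclidean_space \<Rightarrow> real"
  assumes S: "open S" and a: "continuous_on S a" and b: "continuous_on S b"
    and a0: "\<And>x. x \<in> S \<Longrightarrow> a x \<ge> 0"
  shows integral_nonneg_addD: "integral_nonneg S (\<lambda>x. a x + b x) \<Longrightarrow>
      (\<integral>\<^sup>+x\<in>S. ennreal (- b x) \<partial>lborel) \<le> (\<integral>\<^sup>+x\<in>S. ennreal (a x) \<partial>lborel) + (\<integral>\<^sup>+x\<in>S. ennreal (b x) \<partial>lborel)"
    and integral_nonneg_addI: "(\<integral>\<^sup>+x\<in>S. ennreal (a x) \<partial>lborel) < \<infinity> \<Longrightarrow>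
      (\<integral>\<^sup>+x\<in>S. ennreal (- b x) \<partial>lborel) \<le> (\<integral>\<^sup>+x\<in>S. ennreal (a x) \<partial>lborel) + (\<integral>\<^sup>+x\<in>S. ennreal (b x) \<partial>lborel)
      \<Longrightarrow> integral_nonneg S (\<lambda>x. a x + b x)"
proof -
  define F where "F = (\<integral>\<^sup>+x\<in>S. ennreal (a x + b x) \<partial>lborel)"
  define F' where "F' = (\<integral>\<^sup>+x\<in>S. ennreal (- (a x + b x)) \<partial>lborel)"
  define Ia where "Ia = (\<integral>\<^sup>+x\<in>S. ennreal (a x) \<partial>lborel)"
  define B where "B = (\<integral>\<^sup>+x\<in>S. ennreal (b x) \<partial>lborel)"
  define B' where "B' = (\<integral>\<^sup>+x\<in>S. ennreal (- b x) \<partial>lborel)"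
  have balance: "F + B' = F' + (Ia + B)"
    unfolding F_def F'_def Ia_def B_def B'_def by (rule integral_nonneg_add_balance[OF assms])
  have B_le: "B \<le> F"
    unfolding B_def F_def using a0 by (intro nn_integral_mono) (auto simp: indicator_def intro!: ennreal_leI)
  have B'_ge: "F' \<le> B'"
    unfolding B'_def F'_def using a0 by (intro nn_integral_mono) (auto simp: indicator_def intro!: ennreal_leI)
  have F_le: "F \<le> Ia + B"
  proof -
    have "Ia + B = (\<integral>\<^sup>+x. ennreal (a x) * indicator S x + ennreal (b x) * indicator S x \<partial>lborel)"
      unfolding Ia_def B_def
      by (intro nn_integral_add[symmetric] nn_integrand_measurable[OF S] a b)
    moreover have "F \<le> \<dots>"
      unfolding F_def
    proof (rule nn_integral_mono)
      fix x
      show "ennreal (a x + b x) * indicator S x \<le> ennreal (a x) * indicator S x + ennreal (b x) * indicator S x"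
        using a0[of x] by (cases "b x \<ge> 0"; cases "x \<in> S") (auto simp: ennreal_neg intro!: ennreal_leI)
    qed
    ultimately show ?thesis by simp
  qed
  show "B' \<le> Ia + B" if "integral_nonneg S (\<lambda>x. a x + b x)"
  proof (cases "Ia + B < \<infinity>")
    case True
    have "F' \<le> F"
      using that by (simp add: integral_nonneg_def F_def F'_def)
    then have "F + B' \<le> F + (Ia + B)"
      unfolding balance by (rule add_right_mono)
    moreover have "F < \<infinity>"
      using F_le True by (rule le_less_trans)
    ultimately show ?thesis
      by (rule ennreal_add_le_cancel_left[rotated])
  next
    case False
    then have "Ia + B = \<infinity>" by (simp only: infinity_ennreal_def top.not_eq_extremum[symmetric] not_not)
    then have "B' \<le> \<infinity> \<Longrightarrow> ?thesis" by (simp only:)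
    then show ?thesis by simp
  qed
  show "integral_nonneg S (\<lambda>x. a x + b x)" if fin: "Ia < \<infinity>" and le: "B' \<le> Ia + B"
  proof (cases "B < \<infinity>")
    case True
    with fin have "Ia + B < \<infinity>"
      by simp
    then have "B' < \<infinity>"
      by (rule le_less_trans[OF le])
    moreover have "B' + F' \<le> B' + F"
    proof -
      have "B' + F' \<le> F' + (Ia + B)"
        using add_right_mono[OF le, of F'] by (simp only: add.commute)
      then show ?thesis
        unfolding balance[symmetric] by (simp only: add.commute)
    qed
    ultimately have "F' \<le> F"
      by (rule ennreal_add_le_cancel_left)
    then show ?thesis
      by (simp add: integral_nonneg_def F_def F'_def)
  next
    case False
    then have "B = \<infinity>" by (simp only: infinity_ennreal_def top.not_eq_extremum[symmetric] not_not)
    then have "F = \<infinity>"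
      using B_le by (simp add: top_unique)
    then show ?thesis
      by (simp add: integral_nonneg_def F_def)
  qed
qed

section \<open>Reduction to radial test functions\<close>

context radial_solution
begin

lemma radial_weight_nonneg: "r \<in> {0<..<1} \<Longrightarrow> radial_weight r \<ge> 0"
  unfolding radial_weight_def using U'_nonneg coef_pos
  by (intro mult_nonneg_nonneg zero_le_power divide_nonneg_nonneg) auto

lemma radial_weight_continuous: "continuous_on {0<..<1} radial_weight"
  unfolding radial_weight_def by (intro continuous_intros continuous_on_U') auto

lemma Sk_form_parallel:
  assumes x: "x \<in> ball 0 1 - {0}" and v: "v = c *\<^sub>R x"
  shows "Sk_form k u x v v = radial_weight (norm x) * (norm v)\<^sup>2"
proof -
  have "v \<bullet> v - (v \<bullet> x) * (v \<bullet> x) / (norm x)\<^sup>2 = 0"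
    using x by (simp add: v dot_square_norm power2_eq_square)
  then show ?thesis
    by (simp only: Sk_form_u[OF x]) (simp add: dot_square_norm)
qed

lemma Sk_form_ge_radial:
  assumes x: "x \<in> ball 0 1 - {0}"
  shows "Sk_form k u x v v \<ge> radial_weight (norm x) * (v \<bullet> ((1 / norm x) *\<^sub>R x))\<^sup>2"
proof -
  define s where "s = v \<bullet> ((1 / norm x) *\<^sub>R x)"
  have s: "s\<^sup>2 = (v \<bullet> x) * (v \<bullet> x) / (norm x)\<^sup>2"
    by (simp add: s_def power2_eq_square)
  have "s\<^sup>2 \<le> v \<bullet> v"
    using Cauchy_Schwarz_ineq[of v "(1 / norm x) *\<^sub>R x"] x by (simp add: s_def dot_square_norm power_divide)
  moreover have "radial_weight (norm x) + tangential_excess (norm x) \<ge> 0"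
    using x by (intro tangential_weight_nonneg) auto
  ultimately have "0 \<le> (radial_weight (norm x) + tangential_excess (norm x)) * (v \<bullet> v - s\<^sup>2)"
    by (intro mult_nonneg_nonneg) auto
  then show ?thesis
    unfolding Sk_form_u[OF x] s_def[symmetric] s[symmetric] by (simp add: algebra_simps)
qed

lemma deriv_g_continuous: "continuous_on UNIV (deriv g)"
proof -
  obtain D where D: "\<And>x. (g has_vector_derivative D x) (at x)" "continuous_on UNIV D"
    using g_C1 unfolding C1_differentiable_on_def by auto
  then have "deriv g = D"
    by (auto intro!: DERIV_imp_deriv simp: has_real_derivative_iff_has_vector_derivative)
  with D show ?thesis by simp
qed

lemma deriv_g_u_continuous: "continuous_on (ball 0 1 - {0}) (\<lambda>x. deriv g (u x))"
  using u_C2 by (intro continuous_on_compose2[OF deriv_g_continuous] C1_on_continuous_on) (auto simp: C2_on_def)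

lemma radial_weight_norm_continuous:
  "continuous_on (ball 0 1 - {0} :: (real^'n) set) (\<lambda>x. radial_weight (norm x))"
  by (rule continuous_on_compose2[OF radial_weight_continuous]) (auto intro!: continuous_intros)

text \<open>Only the radial part of the form is used, and it is compared ray by ray: on the ray through \<open>\<theta>\<close> the test
function \<open>\<phi>\<close> coincides with its radial extension \<open>\<xi>(x) = \<phi>(|x| \<theta>)\<close>, which is continuously
differentiable at the origin because \<open>\<phi>\<close> vanishes there.\<close>

theorem semistable_if_radially:
  assumes radial: "\<And>\<xi>::real^'n \<Rightarrow> real. C1_compact_support (ball 0 1) \<xi> \<Longrightarrow> radially_symmetric \<xi> \<Longrightarrow>
      integral_nonneg (ball 0 1 - {0})
        (\<lambda>x. radial_weight (norm x) * (norm (grad \<xi> x))\<^sup>2 + deriv g (u x) * (\<xi> x)\<^sup>2)"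
  shows "semistable k g u"
  unfolding semistable_def
proof (intro allI impI)
  fix \<phi> :: "real^'n \<Rightarrow> real"
  assume \<phi>: "C1_compact_support (ball 0 1 - {0}) \<phi>"
  let ?A = "ball 0 1 - {0} :: (real^'n) set"
  obtain \<epsilon> where \<epsilon>: "0 < \<epsilon>" "\<And>x. norm x < \<epsilon> \<Longrightarrow> \<phi> x = 0"
    using C1_compact_support_puncturedD[OF \<phi>] by blast
  obtain \<rho> where \<rho>: "0 < \<rho>" "\<rho> < 1" "\<And>x. norm x > \<rho> \<Longrightarrow> \<phi> x = 0"
    using C1_compact_support_ballD[OF C1_compact_support_mono[OF \<phi>]] by (metis Diff_subset)
  have C1: "C1_on UNIV \<phi>"
    using \<phi> by (simp add: C1_compact_support_def)
  define f where "f z = radial_weight (norm z) * (grad \<phi> z \<bullet> ((1 / norm z) *\<^sub>R z))\<^sup>2 + deriv g (u z) * (\<phi> z)\<^sup>2" for z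
  define F where "F z = indicator ?A z *\<^sub>R f z" for z
  have "continuous_on ?A f"
    unfolding f_def
    using C1 C1_on_continuous_on[OF C1] unfolding C1_on_grad
    by (intro continuous_intros radial_weight_norm_continuous deriv_g_u_continuous)
      (auto intro: continuous_on_subset)
  then have [measurable]: "F \<in> borel_measurable borel"
    unfolding F_def by (intro borel_measurable_continuous_on_indicator) auto
  have "(\<integral>\<^sup>+z. ennreal (- F z) \<partial>lborel) \<le> (\<integral>\<^sup>+z. ennreal (F z) \<partial>lborel)"
  proof (rule nn_integral_le_of_rays)
    fix \<theta> :: "real^'n"
    assume \<theta>: "norm \<theta> = 1"
    define h where "h r = \<phi> (r *\<^sub>R \<theta>)" for r
    define h' where "h' r = grad \<phi> (r *\<^sub>R \<theta>) \<bullet> \<theta>" for r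
    define \<xi> where "\<xi> x = h (norm x)" for x :: "real^'n"
    have h: "(h has_real_derivative h' r) (at r)" for r
    proof -
      have "((\<lambda>r. r *\<^sub>R \<theta>) has_derivative (\<lambda>h. h *\<^sub>R \<theta>)) (at r)"
        by (auto intro!: derivative_eq_intros)
      moreover have "(\<phi> has_derivative (\<lambda>v. grad \<phi> (r *\<^sub>R \<theta>) \<bullet> v)) (at (r *\<^sub>R \<theta>))"
        using C1 by (intro has_derivative_grad) (simp add: C1_on_def)
      ultimately show ?thesis
        using has_derivative_compose[of "\<lambda>r. r *\<^sub>R \<theta>"]
        by (fastforce simp: has_field_derivative_def mult_commute_abs h_def[abs_def] h'_def)
    qed
    have h'_cont: "continuous_on {0<..} h'"
    proof -
      have "continuous_on {0<..} (\<lambda>r. grad \<phi> (r *\<^sub>R \<theta>))"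
        by (rule continuous_on_compose2[of UNIV "grad \<phi>"])
          (use C1 in \<open>auto simp: C1_on_grad intro!: continuous_intros\<close>)
      then show ?thesis
        unfolding h'_def by (intro continuous_on_inner continuous_on_const)
    qed
    have h0: "h r = 0" if "0 \<le> r" "r < \<epsilon>" for r
      using that \<theta> \<epsilon>(2)[of "r *\<^sub>R \<theta>"] by (simp add: h_def)
    have \<xi>_C1: "C1_on UNIV \<xi>" and \<xi>_grad: "grad \<xi> x = (h' (norm x) / norm x) *\<^sub>R x" for x
      unfolding \<xi>_def[abs_def] using C1_radial[of h h' \<epsilon> 0, OF h h'_cont \<epsilon>(1) h0] by auto
    have "C1_compact_support (ball 0 1) \<xi>"
    proof (rule C1_compact_supportI[OF \<xi>_C1, of "cball 0 \<rho>"])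
      fix x :: "real^'n" assume "x \<notin> cball 0 \<rho>"
      then show "\<xi> x = 0"
        using \<rho>(3)[of "norm x *\<^sub>R \<theta>"] \<theta> by (simp add: \<xi>_def h_def)
    qed (use \<rho> in auto)
    moreover have "radially_symmetric \<xi>"
      by (simp add: radially_symmetric_def \<xi>_def)
    ultimately have nonneg: "integral_nonneg ?A (\<lambda>x. radial_weight (norm x) * (norm (grad \<xi> x))\<^sup>2 + deriv g (u x) * (\<xi> x)\<^sup>2)"
      by (rule radial)
    have "f (norm x *\<^sub>R \<theta>) = radial_weight (norm x) * (norm (grad \<xi> x))\<^sup>2 + deriv g (u x) * (\<xi> x)\<^sup>2"
      if x: "x \<in> ?A" for x
    proof -
      have "u (norm x *\<^sub>R \<theta>) = u x"
        using x \<theta> u_eq[of x] u_eq[of "norm x *\<^sub>R \<theta>"] by simp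
      moreover have "norm (grad \<xi> x) = \<bar>h' (norm x)\<bar>"
        using x by (simp add: \<xi>_grad)
      moreover have "grad \<phi> (norm x *\<^sub>R \<theta>) \<bullet> ((1 / norm (norm x *\<^sub>R \<theta>)) *\<^sub>R (norm x *\<^sub>R \<theta>)) = h' (norm x)"
        using x \<theta> by (simp add: h'_def)
      ultimately show ?thesis
        using \<theta> by (simp add: f_def \<xi>_def h_def)
    qed
    then have "integral_nonneg ?A (\<lambda>x. f (norm x *\<^sub>R \<theta>))"
      using nonneg by (subst integral_nonneg_cong) auto
    moreover have "(\<integral>\<^sup>+x. ennreal (s * F (norm (x::real^'n) *\<^sub>R \<theta>)) \<partial>lborel)
        = (\<integral>\<^sup>+x\<in>?A. ennreal (s * f (norm x *\<^sub>R \<theta>)) \<partial>lborel)" for s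
      using \<theta> by (intro nn_integral_cong) (auto simp: F_def indicator_def)
    from this[of 1] this[of "-1"] have
      "(\<integral>\<^sup>+x. ennreal (F (norm (x::real^'n) *\<^sub>R \<theta>)) \<partial>lborel) = (\<integral>\<^sup>+x\<in>?A. ennreal (f (norm x *\<^sub>R \<theta>)) \<partial>lborel)"
      "(\<integral>\<^sup>+x. ennreal (- F (norm (x::real^'n) *\<^sub>R \<theta>)) \<partial>lborel) = (\<integral>\<^sup>+x\<in>?A. ennreal (- f (norm x *\<^sub>R \<theta>)) \<partial>lborel)"
      by simp_all
    ultimately show "(\<integral>\<^sup>+x. ennreal (- F (norm (x::real^'n) *\<^sub>R \<theta>)) \<partial>lborel) \<le> (\<integral>\<^sup>+x. ennreal (F (norm (x::real^'n) *\<^sub>R \<theta>)) \<partial>lborel)"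
      by (simp add: integral_nonneg_def)
  qed measurable
  moreover have "(\<integral>\<^sup>+z. ennreal (s * F z) \<partial>lborel) = (\<integral>\<^sup>+z\<in>?A. ennreal (s * f z) \<partial>lborel)" for s
    by (intro nn_integral_cong) (auto simp: F_def indicator_def)
  from this[of 1] this[of "-1"] have
    "(\<integral>\<^sup>+z. ennreal (F z) \<partial>lborel) = (\<integral>\<^sup>+z\<in>?A. ennreal (f z) \<partial>lborel)"
    "(\<integral>\<^sup>+z. ennreal (- F z) \<partial>lborel) = (\<integral>\<^sup>+z\<in>?A. ennreal (- f z) \<partial>lborel)"
    by simp_all
  ultimately have "integral_nonneg ?A f"
    by (simp add: integral_nonneg_def)
  then have "integral_nonneg ?A (\<lambda>x. Sk_form k u x (grad \<phi> x) (grad \<phi> x) + deriv g (u x) * (\<phi> x)\<^sup>2)"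
    unfolding f_def by (rule integral_nonneg_mono) (intro add_right_mono Sk_form_ge_radial)
  then show "integral_nonneg (ball 0 1) (\<lambda>x. Sk_form k u x (grad \<phi> x) (grad \<phi> x) + deriv g (u x) * (\<phi> x)\<^sup>2)"
    by (simp only: integral_nonneg_puncture)
qed

end

section \<open>Removing the origin by a logarithmic cutoff\<close>

text \<open>The transition takes place for \<open>ln r\<close> between \<open>- 2 m\<close> and \<open>- m\<close>, with slope at most \<open>2 / (m r)\<close>.
The case distinction is there because \<open>ln 0 = 0\<close> would give the value 1 at the origin.\<close>

definition log_cutoff :: "nat \<Rightarrow> real \<Rightarrow> real" where
  "log_cutoff m r = (if r \<le> 0 then 0 else c1_step (2 + ln r / real m))"

definition log_cutoff' :: "nat \<Rightarrow> real \<Rightarrow> real" where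
  "log_cutoff' m r = tent (2 + ln r / real m) / (real m * r)"

lemma log_cutoff_deriv:
  assumes "r > 0" "m > 0"
  shows "(log_cutoff m has_real_derivative log_cutoff' m r) (at r)"
proof -
  have "((\<lambda>r. 2 + ln r / real m) has_real_derivative 1 / (real m * r)) (at r)"
    using assms by (auto intro!: derivative_eq_intros)
  from DERIV_chain2[where f = c1_step, OF c1_step_has_real_derivative this]
  have "((\<lambda>r. c1_step (2 + ln r / real m)) has_real_derivative log_cutoff' m r) (at r)"
    by (simp add: log_cutoff'_def)
  then show ?thesis
    by (rule has_field_derivative_transform_within_open[of _ _ _ "{0<..}"])
      (use assms in \<open>auto simp: log_cutoff_def\<close>)
qed

lemma log_cutoff'_continuous: "continuous_on {0<..} (log_cutoff' m)"
proof (cases "m = 0")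
  case False
  then show ?thesis
    unfolding log_cutoff'_def[abs_def]
    by (intro continuous_on_divide continuous_on_compose2[OF continuous_on_tent[of UNIV]] continuous_intros) auto
qed (simp add: log_cutoff'_def[abs_def])

lemma log_cutoff_bounds: "0 \<le> log_cutoff m r" "log_cutoff m r \<le> 1"
  using c1_step_bounds by (auto simp: log_cutoff_def)

lemma log_cutoff_eq_0:
  assumes "m > 0" "r \<le> exp (- 2 * real m)"
  shows "log_cutoff m r = 0"
proof (cases "r \<le> 0")
  case False
  then have "ln r \<le> - 2 * real m"
    using assms by (metis ln_exp ln_le_cancel_iff exp_gt_zero not_le)
  then have "2 + ln r / real m \<le> 0"
    using assms(1) by (simp add: field_simps)
  then show ?thesis
    by (simp add: log_cutoff_def c1_step_eq_0)
qed (simp add: log_cutoff_def)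

lemma log_cutoff_eq_1:
  assumes "m > 0" "exp (- real m) \<le> r"
  shows "log_cutoff m r = 1"
proof -
  have r: "r > 0"
    using assms(2) exp_gt_zero less_le_trans by blast
  then have "- real m \<le> ln r"
    using assms by (metis ln_exp ln_le_cancel_iff exp_gt_zero)
  then have "2 + ln r / real m \<ge> 1"
    using assms(1) by (simp add: field_simps)
  then show ?thesis
    using r by (simp add: log_cutoff_def c1_step_eq_1)
qed

lemma log_cutoff'_square_le:
  assumes "m > 0" "r > 0"
  shows "(log_cutoff' m r)\<^sup>2 \<le> 4 / (real m * r)\<^sup>2 * indicator {exp (- 2 * real m)..exp (- real m)} r"
proof (cases "r \<in> {exp (- 2 * real m)..exp (- real m)}")
  case True
  have "(tent (2 + ln r / real m))\<^sup>2 \<le> 2\<^sup>2"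
    by (rule power_mono) (auto intro: tent_bounds)
  then show ?thesis
    using True by (auto simp: log_cutoff'_def power_divide intro!: divide_right_mono)
next
  case False
  then have "ln r \<le> - 2 * real m \<or> - real m \<le> ln r"
    using assms by (metis atLeastAtMost_iff exp_ln ln_exp ln_le_cancel_iff exp_gt_zero linear)
  then have "2 + ln r / real m \<le> 0 \<or> 2 + ln r / real m \<ge> 1"
    using assms(1) by (auto simp: field_simps)
  then have "log_cutoff' m r = 0"
    by (simp add: log_cutoff'_def tent_eq_0)
  then show ?thesis using False by simp
qed

text \<open>The parameters \<open>(Suc j)\<^sup>2\<close> are those for which the errors of the final limit vanish; the cutoff
is eventually 1 at each fixed radius.\<close>

lemma log_cutoff_tendsto:
  assumes "r > 0"
  shows "\<forall>\<^sub>F j in sequentially. log_cutoff ((Suc j)\<^sup>2) r = 1"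
proof -
  obtain N :: nat where N: "real N \<ge> - ln r"
    using real_arch_simple by blast
  show ?thesis
    using eventually_ge_at_top[of N]
  proof eventually_elim
    fix j assume "N \<le> j"
    moreover have "j \<le> (Suc j)\<^sup>2"
      by (simp add: power2_eq_square)
    ultimately have "- ln r \<le> real ((Suc j)\<^sup>2)"
      using N by (smt (verit) le_trans of_nat_le_iff)
    then have "exp (- real ((Suc j)\<^sup>2)) \<le> r"
      using assms by (metis exp_le_cancel_iff exp_ln minus_le_iff)
    then show "log_cutoff ((Suc j)\<^sup>2) r = 1"
      by (intro log_cutoff_eq_1) auto
  qed
qed

lemma norm_add_power2_le:
  fixes v w :: "'a::real_normed_vector"
  assumes "\<delta> > 0"
  shows "(norm (v + w))\<^sup>2 \<le> (1 + \<delta>) * (norm v)\<^sup>2 + (1 + 1 / \<delta>) * (norm w)\<^sup>2"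
proof -
  define p where "p = norm v"
  define q where "q = norm w"
  have "(norm (v + w))\<^sup>2 \<le> (p + q)\<^sup>2"
    unfolding p_def q_def by (intro power_mono norm_triangle_ineq) auto
  moreover have "0 \<le> (\<delta> * p - q)\<^sup>2 / \<delta>"
    using assms by simp
  moreover have "(\<delta> * p - q)\<^sup>2 / \<delta> = (1 + \<delta>) * p\<^sup>2 + (1 + 1 / \<delta>) * q\<^sup>2 - (p + q)\<^sup>2"
    using assms by (simp add: power2_eq_square field_simps)
  ultimately show ?thesis
    unfolding p_def q_def by linarith
qed

lemma ennreal_lincomb:
  assumes "p \<ge> 0" "a \<ge> 0" "q \<ge> 0" "b \<ge> 0"
  shows "ennreal (p * a + q * b) = ennreal p * ennreal a + ennreal q * ennreal b"
  using assms by (simp add: ennreal_mult)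

context radial_solution
begin

lemma punctured_open: "open (ball 0 1 - {0} :: (real^'n) set)"
  by (intro open_Diff) auto

text \<open>With \<open>r\<^sup>n\<^sup>-\<^sup>1 A(r) \<le> C r\<close> the energy is at most a constant times the integral of
\<open>r / (m r)\<^sup>2 = 1 / (m\<^sup>2 r)\<close> over an interval of logarithmic length \<open>m\<close>.\<close>

lemma cutoff_energy:
  obtains E where "E \<ge> 0" "\<And>m. m > 0 \<Longrightarrow>
    (\<integral>\<^sup>+x\<in>(ball 0 1 - {0} :: (real^'n) set). ennreal (radial_weight (norm x) * (log_cutoff' m (norm x))\<^sup>2) \<partial>lborel)
      \<le> ennreal (E / real m)"
proof -
  obtain C where C: "C > 0" "\<And>r. r \<in> {0<..1/2} \<Longrightarrow> r ^ (CARD('n) - 1) * radial_weight r \<le> C * r"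
    using radial_weight_bound[of "1/2"] by auto
  define K where "K = sphere_mass TYPE(real^'n)"
  have K: "K > 0" unfolding K_def by (rule sphere_mass)
  have "(\<integral>\<^sup>+x\<in>(ball 0 1 - {0} :: (real^'n) set). ennreal (radial_weight (norm x) * (log_cutoff' m (norm x))\<^sup>2) \<partial>lborel)
      \<le> ennreal (K * (4 * C) / real m)" if m: "m > 0" for m
  proof -
    define f where "f r = radial_weight r * (log_cutoff' m r)\<^sup>2" for r
    define lo where "lo = exp (- 2 * real m)"
    define hi where "hi = exp (- real m)"
    have lohi: "0 < lo" "lo \<le> hi" "hi \<le> 1/2"
    proof -
      have "exp (- real m) \<le> exp (- 1)" using m by simp
      moreover have "(2::real) \<le> exp 1" using exp_ge_add_one_self[of 1] by simp
      then have "exp (- 1) \<le> (1/2::real)" by (simp add: exp_minus field_simps)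
      ultimately show "hi \<le> 1/2" unfolding hi_def by linarith
    qed (use m in \<open>auto simp: lo_def hi_def\<close>)
    have f_cont: "continuous_on {0<..<1} f"
      unfolding f_def
      by (intro continuous_intros radial_weight_continuous continuous_on_subset[OF log_cutoff'_continuous]) auto
    have "(\<integral>\<^sup>+x\<in>(ball 0 1 - {0} :: (real^'n) set). ennreal (f (norm x)) \<partial>lborel)
        = (\<integral>\<^sup>+x\<in>(ball 0 1 :: (real^'n) set). ennreal (f (norm x)) \<partial>lborel)"
      by (rule nn_integral_puncture)
    also have "\<dots> = ennreal K * (\<integral>\<^sup>+r\<in>{0<..<1}. ennreal (r ^ (CARD('n) - 1) * f r) \<partial>lborel)"
      unfolding K_def using nn_integral_ball_radial[OF f_cont, where F = "\<lambda>x::real^'n. f (norm x)"] by simp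
    also have "\<dots> \<le> ennreal K * (\<integral>\<^sup>+r. ennreal (4 * C / (real m)\<^sup>2 * (1 / r)) * indicator {lo..hi} r \<partial>lborel)"
    proof (intro mult_left_mono nn_integral_mono)
      fix r :: real
      show "ennreal (r ^ (CARD('n) - 1) * f r) * indicator {0<..<1} r
          \<le> ennreal (4 * C / (real m)\<^sup>2 * (1 / r)) * indicator {lo..hi} r"
      proof (cases "r \<in> {0<..<1}")
        case True
        then have r: "r > 0" by simp
        show ?thesis
        proof (cases "r \<in> {lo..hi}")
          case in_annulus: True
          have "r ^ (CARD('n) - 1) * f r = (r ^ (CARD('n) - 1) * radial_weight r) * (log_cutoff' m r)\<^sup>2"
            by (simp add: f_def)
          also have "\<dots> \<le> (C * r) * (4 / (real m * r)\<^sup>2)"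
          proof (rule mult_mono)
            show "r ^ (CARD('n) - 1) * radial_weight r \<le> C * r"
              using in_annulus lohi r by (intro C(2)) auto
            show "(log_cutoff' m r)\<^sup>2 \<le> 4 / (real m * r)\<^sup>2"
              using log_cutoff'_square_le[OF m r] in_annulus by (simp add: lo_def hi_def)
          qed (use C r in auto)
          also have "\<dots> = 4 * C / (real m)\<^sup>2 * (1 / r)"
            using r m by (simp add: field_simps power2_eq_square)
          finally show ?thesis
            using True in_annulus by (auto intro!: ennreal_leI)
        next
          case False
          have "(log_cutoff' m r)\<^sup>2 \<le> 0"
            using log_cutoff'_square_le[OF m r] False unfolding lo_def hi_def by simp
          then have "f r = 0" by (simp add: f_def)
          then show ?thesis by simp
        qed
      qed simp
    qed auto
    also have "(\<integral>\<^sup>+r. ennreal (4 * C / (real m)\<^sup>2 * (1 / r)) * indicator {lo..hi} r \<partial>lborel)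
        = ennreal (4 * C / (real m)\<^sup>2 * ln hi - 4 * C / (real m)\<^sup>2 * ln lo)"
    proof (rule nn_integral_FTC_Icc)
      show "((\<lambda>r. 4 * C / (real m)\<^sup>2 * ln r) has_real_derivative 4 * C / (real m)\<^sup>2 * (1 / r)) (at r)"
        if "r \<in> {lo..hi}" for r
        using that lohi by (intro DERIV_cmult DERIV_ln_divide) simp
      show "0 \<le> 4 * C / (real m)\<^sup>2 * (1 / r)" if "r \<in> {lo..hi}" for r
        using that lohi C by auto
    qed (use lohi in auto)
    also have "4 * C / (real m)\<^sup>2 * ln hi - 4 * C / (real m)\<^sup>2 * ln lo = 4 * C / real m"
      using m by (simp add: lo_def hi_def power2_eq_square)
    also have "ennreal K * ennreal (4 * C / real m) = ennreal (K * (4 * C) / real m)"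
      using K C by (simp flip: ennreal_mult)
    finally show ?thesis by (simp add: f_def)
  qed
  then show ?thesis
    using that[of "K * (4 * C)"] K C by simp
qed

text \<open>The radial derivative as a continuous function \<open>d\<close> of the radius, the form in which
\<open>nn_integral_ball_radial\<close> can integrate it.\<close>

lemma radial_gradient:
  fixes \<xi> :: "real^'n \<Rightarrow> real"
  assumes C1: "C1_on UNIV \<xi>" and sym: "radially_symmetric \<xi>"
  obtains d where "continuous_on {0<..} d"
    "\<And>x. x \<noteq> 0 \<Longrightarrow> grad \<xi> x = (d (norm x) / norm x) *\<^sub>R x"
proof -
  fix i :: 'n
  define e :: "real^'n" where "e = axis i 1"
  have e: "norm e = 1" by (simp add: e_def)
  define F where "F r = \<xi> (r *\<^sub>R e)" for r
  have \<xi>F: "\<xi> x = F (norm x)" for x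
    using sym e unfolding radially_symmetric_def F_def by (metis abs_norm_cancel mult.right_neutral norm_scaleR)
  have diff: "\<xi> differentiable (at x)" for x
    using C1 by (simp add: C1_on_def)
  have grad: "grad \<xi> x = (deriv F (norm x) / norm x) *\<^sub>R x" if "x \<noteq> 0" for x
    by (rule radial_profile_derivative(2)[of UNIV]) (use that \<xi>F diff in auto)
  have "continuous_on {0<..} (\<lambda>r. grad \<xi> (r *\<^sub>R e))"
    by (rule continuous_on_compose2[of UNIV "grad \<xi>"])
      (use C1 in \<open>auto simp: C1_on_grad intro!: continuous_intros\<close>)
  then have "continuous_on {0<..} (\<lambda>r. grad \<xi> (r *\<^sub>R e) \<bullet> e)"
    by (intro continuous_on_inner continuous_on_const)
  then have "continuous_on {0<..} (deriv F)"
  proof (rule continuous_on_eq)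
    fix r :: real assume "r \<in> {0<..}"
    then have r: "r > 0" by simp
    then have "r *\<^sub>R e \<noteq> 0" and n: "norm (r *\<^sub>R e) = r"
      using e by auto
    from grad[OF this(1)] have "grad \<xi> (r *\<^sub>R e) = (deriv F r / r) *\<^sub>R r *\<^sub>R e"
      unfolding n .
    also have "\<dots> = deriv F r *\<^sub>R e"
      using r by simp
    finally show "grad \<xi> (r *\<^sub>R e) \<bullet> e = deriv F r"
      using e by (simp add: dot_square_norm)
  qed
  with grad show ?thesis using that by blast
qed

text \<open>Semistability is applied to \<open>\<xi> \<eta>\<close> with a logarithmic cutoff \<open>\<eta>\<close>. Splitting the gradient by
\<open>|p + q|\<^sup>2 \<le> (1 + \<delta>) |p|\<^sup>2 + (1 + 1 / \<delta>) |q|\<^sup>2\<close> leaves an error \<open>O(1 / (\<delta> m))\<close>; the cutoff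
parameter \<open>N\<^sup>2\<close> together with \<open>\<delta> = 1 / N\<close> lets the error and \<open>\<delta>\<close> vanish at the same time.\<close>

theorem radially_if_semistable:
  fixes \<xi> :: "real^'n \<Rightarrow> real"
  assumes stable: "semistable k g u" and \<xi>: "C1_compact_support (ball 0 1) \<xi>" and sym: "radially_symmetric \<xi>"
  shows "integral_nonneg (ball 0 1 - {0})
        (\<lambda>x. radial_weight (norm x) * (norm (grad \<xi> x))\<^sup>2 + deriv g (u x) * (\<xi> x)\<^sup>2)"
proof -
  let ?A = "ball 0 1 - {0} :: (real^'n) set"
  have C1: "C1_on UNIV \<xi>"
    using \<xi> by (simp add: C1_compact_support_def)
  have \<xi>_cont: "continuous_on S \<xi>" for S
    using C1_on_continuous_on[OF C1] by (rule continuous_on_subset) auto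
  have grad_cont: "continuous_on S (grad \<xi>)" for S
    using C1 unfolding C1_on_grad by (auto intro: continuous_on_subset)
  obtain d where d: "continuous_on {0<..} d" "\<And>x. x \<noteq> 0 \<Longrightarrow> grad \<xi> x = (d (norm x) / norm x) *\<^sub>R x"
    using radial_gradient[OF C1 sym] by blast
  obtain \<rho> where \<rho>: "0 < \<rho>" "\<rho> < 1" "\<And>x. norm x > \<rho> \<Longrightarrow> \<xi> x = 0" "\<And>x. norm x > \<rho> \<Longrightarrow> grad \<xi> x = 0"
    using C1_compact_support_ballD[OF \<xi>] by metis
  obtain M where M: "\<And>x. x \<in> cball 0 1 \<Longrightarrow> \<bar>\<xi> x\<bar> \<le> M" "\<And>x. x \<in> cball 0 1 \<Longrightarrow> norm (grad \<xi> x) \<le> M"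
  proof -
    have "bounded (\<xi> ` cball 0 1)" "bounded (grad \<xi> ` cball 0 1)"
      by (auto intro!: compact_imp_bounded compact_continuous_image \<xi>_cont grad_cont)
    then obtain M1 M2 where "\<forall>x\<in>cball 0 1. \<bar>\<xi> x\<bar> \<le> M1" "\<forall>x\<in>cball 0 1. norm (grad \<xi> x) \<le> M2"
      unfolding bounded_iff by auto
    then show ?thesis
      using that[of "max M1 M2"] by fastforce
  qed
  define a where "a x = radial_weight (norm x) * (norm (grad \<xi> x))\<^sup>2" for x
  define b where "b x = deriv g (u x) * (\<xi> x)\<^sup>2" for x
  have a_cont: "continuous_on ?A a"
    unfolding a_def by (intro continuous_intros radial_weight_norm_continuous grad_cont)
  have b_cont: "continuous_on ?A b"
    unfolding b_def by (intro continuous_intros deriv_g_u_continuous \<xi>_cont)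
  have weight0: "radial_weight (norm x) \<ge> 0" if "x \<in> ?A" for x
    using that by (intro radial_weight_nonneg) auto
  have a0: "a x \<ge> 0" if "x \<in> ?A" for x
    unfolding a_def using weight0[OF that] by simp
  obtain C where C: "C > 0" "\<And>r. r \<in> {0<..\<rho>} \<Longrightarrow> r ^ (CARD('n) - 1) * radial_weight r \<le> C * r"
    using radial_weight_bound[OF \<rho>(1,2)] by blast
  have a_fin: "(\<integral>\<^sup>+x\<in>?A. ennreal (a x) \<partial>lborel) < \<infinity>"
  proof -
    define f where "f r = radial_weight r * (d r)\<^sup>2" for r
    have f_cont: "continuous_on {0<..<1} f"
      unfolding f_def by (intro continuous_intros radial_weight_continuous continuous_on_subset[OF d(1)]) auto
    have norm_grad: "norm (grad \<xi> x) = \<bar>d (norm x)\<bar>" if "x \<noteq> 0" for x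
      using that by (simp add: d(2))
    have "(\<integral>\<^sup>+x\<in>?A. ennreal (a x) \<partial>lborel) = (\<integral>\<^sup>+x\<in>ball 0 1. ennreal (a x) \<partial>lborel)"
      by (rule nn_integral_puncture)
    also have "\<dots> = ennreal (sphere_mass TYPE(real^'n)) * (\<integral>\<^sup>+r\<in>{0<..<1}. ennreal (r ^ (CARD('n) - 1) * f r) \<partial>lborel)"
      using nn_integral_ball_radial[OF f_cont, where F = a] by (simp add: a_def f_def norm_grad)
    also have "\<dots> \<le> ennreal (sphere_mass TYPE(real^'n)) * (\<integral>\<^sup>+r. ennreal (C * M\<^sup>2) * indicator {0..1::real} r \<partial>lborel)"
    proof (intro mult_left_mono nn_integral_mono)
      fix r :: real
      show "ennreal (r ^ (CARD('n) - 1) * f r) * indicator {0<..<1} r \<le> ennreal (C * M\<^sup>2) * indicator {0..1} r"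
      proof (cases "r \<in> {0<..<1}")
        case True
        obtain x :: "real^'n" where x: "norm x = r"
          using vector_choose_size[of r] True by auto
        have x': "x \<noteq> 0" "x \<in> cball 0 1" using x True by auto
        have "r ^ (CARD('n) - 1) * f r \<le> C * M\<^sup>2"
        proof (cases "r \<le> \<rho>")
          case le: True
          have "r ^ (CARD('n) - 1) * f r = (r ^ (CARD('n) - 1) * radial_weight r) * (d r)\<^sup>2"
            by (simp add: f_def)
          also have "\<dots> \<le> C * M\<^sup>2"
          proof (rule mult_mono)
            have "r ^ (CARD('n) - 1) * radial_weight r \<le> C * r"
              using True le by (intro C(2)) auto
            also have "\<dots> \<le> C * 1"
              using C True by (intro mult_left_mono) auto
            finally show "r ^ (CARD('n) - 1) * radial_weight r \<le> C" by simp
            show "(d r)\<^sup>2 \<le> M\<^sup>2"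
              using M(2)[OF x'(2)] norm_grad[OF x'(1)] x by (metis abs_ge_zero power2_abs power_mono)
          qed (use C in auto)
          finally show ?thesis .
        next
          case False
          then have "d r = 0"
            using \<rho>(4)[of x] norm_grad[OF x'(1)] x by auto
          then show ?thesis
            using C by (simp add: f_def)
        qed
        then show ?thesis
          using True by (auto intro!: ennreal_leI)
      qed simp
    qed auto
    also have "\<dots> < \<infinity>"
      by (simp add: nn_integral_cmult ennreal_mult_less_top)
    finally show ?thesis .
  qed
  then obtain ia where ia: "ia \<ge> 0" "(\<integral>\<^sup>+x\<in>?A. ennreal (a x) \<partial>lborel) = ennreal ia"
    by (cases "\<integral>\<^sup>+x\<in>?A. ennreal (a x) \<partial>lborel") auto
  obtain E where E: "E \<ge> 0" "\<And>m. m > 0 \<Longrightarrow>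
    (\<integral>\<^sup>+x\<in>?A. ennreal (radial_weight (norm x) * (log_cutoff' m (norm x))\<^sup>2) \<partial>lborel) \<le> ennreal (E / real m)"
    using cutoff_energy by blast
  let ?B = "\<integral>\<^sup>+x\<in>?A. ennreal (b x) \<partial>lborel"
  have cut: "(\<integral>\<^sup>+x\<in>?A. ennreal (- (b x * (log_cutoff m (norm x))\<^sup>2)) \<partial>lborel)
      \<le> ennreal ((1 + \<delta>) * ia + (1 + 1 / \<delta>) * M\<^sup>2 * (E / real m)) + ?B" if m: "m > 0" and \<delta>: "\<delta> > 0" for m \<delta>
  proof -
    define \<eta> where "\<eta> x = log_cutoff m (norm x)" for x :: "real^'n"
    define \<phi> where "\<phi> x = \<xi> x * \<eta> x" for x
    have \<eta>_C1: "C1_on UNIV \<eta>" and grad_\<eta>: "grad \<eta> x = (log_cutoff' m (norm x) / norm x) *\<^sub>R x" for x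
      unfolding \<eta>_def[abs_def]
      using C1_radial[of "log_cutoff m" "log_cutoff' m" "exp (- 2 * real m)" 0, OF log_cutoff_deriv log_cutoff'_continuous]
        log_cutoff_eq_0[OF m] m by auto
    have \<phi>_C1: "C1_on UNIV \<phi>" and grad_\<phi>: "grad \<phi> x = \<xi> x *\<^sub>R grad \<eta> x + \<eta> x *\<^sub>R grad \<xi> x" for x
      unfolding \<phi>_def[abs_def] using C1_on_mult[OF C1 \<eta>_C1] by auto
    have "C1_compact_support ?A \<phi>"
    proof (rule C1_compact_supportI[OF \<phi>_C1, of "cball 0 \<rho> - ball 0 (exp (- 2 * real m))"])
      fix x :: "real^'n" assume "x \<notin> cball 0 \<rho> - ball 0 (exp (- 2 * real m))"
      then show "\<phi> x = 0"
        using \<rho>(3)[of x] log_cutoff_eq_0[OF m, of "norm x"] by (auto simp: \<phi>_def \<eta>_def)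
    qed (use \<rho> in \<open>auto intro!: compact_diff\<close>)
    then have "integral_nonneg (ball 0 1) (\<lambda>x. Sk_form k u x (grad \<phi> x) (grad \<phi> x) + deriv g (u x) * (\<phi> x)\<^sup>2)"
      using stable by (simp add: semistable_def)
    then have "integral_nonneg ?A (\<lambda>x. Sk_form k u x (grad \<phi> x) (grad \<phi> x) + deriv g (u x) * (\<phi> x)\<^sup>2)"
      by (simp only: integral_nonneg_puncture)
    define am where "am x = radial_weight (norm x) * (norm (grad \<phi> x))\<^sup>2" for x
    define bm where "bm x = b x * (\<eta> x)\<^sup>2" for x
    have "Sk_form k u x (grad \<phi> x) (grad \<phi> x) + deriv g (u x) * (\<phi> x)\<^sup>2 = am x + bm x" if x: "x \<in> ?A" for x
    proof -
      have "grad \<phi> x = (\<xi> x * (log_cutoff' m (norm x) / norm x) + \<eta> x * (d (norm x) / norm x)) *\<^sub>R x"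
        using x by (simp add: grad_\<phi> grad_\<eta> d(2) scaleR_add_left)
      from Sk_form_parallel[OF x this] show ?thesis
        by (simp add: am_def bm_def b_def \<phi>_def power_mult_distrib)
    qed
    with \<open>integral_nonneg ?A _\<close> have nonneg: "integral_nonneg ?A (\<lambda>x. am x + bm x)"
      by (subst (asm) integral_nonneg_cong) auto
    have \<eta>_cont: "continuous_on S \<eta>" for S
      using C1_on_continuous_on[OF \<eta>_C1] by (rule continuous_on_subset) auto
    have grad_\<phi>_cont: "continuous_on S (grad \<phi>)" for S
      using \<phi>_C1 unfolding C1_on_grad by (auto intro: continuous_on_subset)
    have am_cont: "continuous_on ?A am"
      unfolding am_def by (intro continuous_intros radial_weight_norm_continuous grad_\<phi>_cont)
    have bm_cont: "continuous_on ?A bm"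
      unfolding bm_def by (intro continuous_intros b_cont \<eta>_cont)
    have am0: "am x \<ge> 0" if "x \<in> ?A" for x
      unfolding am_def using weight0[OF that] by simp
    define em where "em x = radial_weight (norm x) * (log_cutoff' m (norm x))\<^sup>2" for x :: "real^'n"
    have em_cont: "continuous_on ?A em"
      unfolding em_def
      by (intro continuous_intros radial_weight_norm_continuous continuous_on_compose2[OF log_cutoff'_continuous]) auto
    have "(\<integral>\<^sup>+x\<in>?A. ennreal (- bm x) \<partial>lborel)
        \<le> (\<integral>\<^sup>+x\<in>?A. ennreal (am x) \<partial>lborel) + (\<integral>\<^sup>+x\<in>?A. ennreal (bm x) \<partial>lborel)"
      by (rule integral_nonneg_addD[OF punctured_open am_cont bm_cont am0 nonneg])
    also have "\<dots> \<le> ennreal ((1 + \<delta>) * ia + (1 + 1 / \<delta>) * M\<^sup>2 * (E / real m)) + ?B"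
    proof (rule add_mono)
      have "(\<integral>\<^sup>+x\<in>?A. ennreal (am x) \<partial>lborel)
          \<le> (\<integral>\<^sup>+x. ennreal (1 + \<delta>) * (ennreal (a x) * indicator ?A x)
              + ennreal ((1 + 1 / \<delta>) * M\<^sup>2) * (ennreal (em x) * indicator ?A x) \<partial>lborel)"
      proof (rule nn_integral_mono)
        fix x :: "real^'n"
        show "ennreal (am x) * indicator ?A x \<le> ennreal (1 + \<delta>) * (ennreal (a x) * indicator ?A x)
              + ennreal ((1 + 1 / \<delta>) * M\<^sup>2) * (ennreal (em x) * indicator ?A x)"
        proof (cases "x \<in> ?A")
          case True
          have n1: "norm (\<eta> x *\<^sub>R grad \<xi> x) \<le> norm (grad \<xi> x)"
            using log_cutoff_bounds[of m "norm x"] by (simp add: \<eta>_def mult_left_le_one_le)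
          have n2: "norm (\<xi> x *\<^sub>R grad \<eta> x) \<le> M * \<bar>log_cutoff' m (norm x)\<bar>"
          proof -
            have "norm (grad \<eta> x) = \<bar>log_cutoff' m (norm x)\<bar>"
              using True by (simp add: grad_\<eta>)
            moreover have "\<bar>\<xi> x\<bar> \<le> M"
              using True by (intro M(1)) auto
            ultimately show ?thesis
              by (simp only: norm_scaleR) (rule mult_right_mono, auto)
          qed
          have "(norm (grad \<phi> x))\<^sup>2 \<le> (1 + \<delta>) * (norm (\<eta> x *\<^sub>R grad \<xi> x))\<^sup>2 + (1 + 1 / \<delta>) * (norm (\<xi> x *\<^sub>R grad \<eta> x))\<^sup>2"
            unfolding grad_\<phi> using norm_add_power2_le[OF \<delta>, of "\<eta> x *\<^sub>R grad \<xi> x" "\<xi> x *\<^sub>R grad \<eta> x"]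
            by (simp only: add.commute)
          also have "\<dots> \<le> (1 + \<delta>) * (norm (grad \<xi> x))\<^sup>2 + (1 + 1 / \<delta>) * (M * \<bar>log_cutoff' m (norm x)\<bar>)\<^sup>2"
            using \<delta> n1 n2 by (intro add_mono mult_left_mono power_mono) auto
          finally have "radial_weight (norm x) * (norm (grad \<phi> x))\<^sup>2
              \<le> radial_weight (norm x) * ((1 + \<delta>) * (norm (grad \<xi> x))\<^sup>2 + (1 + 1 / \<delta>) * (M * \<bar>log_cutoff' m (norm x)\<bar>)\<^sup>2)"
            using weight0[OF True] by (rule mult_left_mono)
          also have "\<dots> = (1 + \<delta>) * a x + ((1 + 1 / \<delta>) * M\<^sup>2) * em x"
            by (simp only: a_def em_def power_mult_distrib power2_abs) (simp only: distrib_left mult_ac)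
          finally have "am x \<le> (1 + \<delta>) * a x + ((1 + 1 / \<delta>) * M\<^sup>2) * em x"
            by (simp only: am_def)
          then have "ennreal (am x) \<le> ennreal ((1 + \<delta>) * a x + ((1 + 1 / \<delta>) * M\<^sup>2) * em x)"
            by (rule ennreal_leI)
          also have "\<dots> = ennreal (1 + \<delta>) * ennreal (a x) + ennreal ((1 + 1 / \<delta>) * M\<^sup>2) * ennreal (em x)"
          proof -
            have "em x \<ge> 0" unfolding em_def using weight0[OF True] by simp
            moreover have "(1 + 1 / \<delta>) * M\<^sup>2 \<ge> 0" using \<delta> by simp
            ultimately show ?thesis
              using \<delta> a0[OF True] by (intro ennreal_lincomb) auto
          qed
          finally show ?thesis
            using True by simp
        qed simp
      qed
      also have "\<dots> = ennreal (1 + \<delta>) * (\<integral>\<^sup>+x\<in>?A. ennreal (a x) \<partial>lborel)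
          + ennreal ((1 + 1 / \<delta>) * M\<^sup>2) * (\<integral>\<^sup>+x\<in>?A. ennreal (em x) \<partial>lborel)"
        using nn_integrand_measurable[OF punctured_open a_cont] nn_integrand_measurable[OF punctured_open em_cont]
        by (simp add: nn_integral_add nn_integral_cmult)
      also have "\<dots> \<le> ennreal (1 + \<delta>) * ennreal ia + ennreal ((1 + 1 / \<delta>) * M\<^sup>2) * ennreal (E / real m)"
        unfolding ia(2) using E(2)[OF m] by (intro add_mono mult_left_mono) (auto simp: em_def)
      also have "\<dots> = ennreal ((1 + \<delta>) * ia + (1 + 1 / \<delta>) * M\<^sup>2 * (E / real m))"
      proof -
        have "(1 + 1 / \<delta>) * M\<^sup>2 \<ge> 0" "E / real m \<ge> 0" using \<delta> E(1) by auto
        then show ?thesis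
          using \<delta> ia(1) by (intro ennreal_lincomb[symmetric]) auto
      qed
      finally show "(\<integral>\<^sup>+x\<in>?A. ennreal (am x) \<partial>lborel)
          \<le> ennreal ((1 + \<delta>) * ia + (1 + 1 / \<delta>) * M\<^sup>2 * (E / real m))" .
      show "(\<integral>\<^sup>+x\<in>?A. ennreal (bm x) \<partial>lborel) \<le> ?B"
      proof (rule nn_integral_mono)
        fix x :: "real^'n"
        have "(\<eta> x)\<^sup>2 \<le> 1"
          using log_cutoff_bounds[of m "norm x"] by (simp add: \<eta>_def power_le_one)
        then have "b x * (\<eta> x)\<^sup>2 \<le> b x \<or> b x * (\<eta> x)\<^sup>2 \<le> 0"
          by (cases "b x \<ge> 0") (auto simp: mult_left_le mult_nonpos_nonneg)
        then have "ennreal (bm x) \<le> ennreal (b x)"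
          unfolding bm_def by (auto intro: ennreal_leI simp: ennreal_neg)
        then show "ennreal (bm x) * indicator ?A x \<le> ennreal (b x) * indicator ?A x"
          by (rule mult_right_mono) simp
      qed
    qed
    finally show ?thesis
      by (simp add: bm_def \<eta>_def)
  qed
  define I where "I j = inverse (real (Suc j))" for j
  define h where "h j x = ennreal (- (b x * (log_cutoff ((Suc j)\<^sup>2) (norm x))\<^sup>2)) * indicator ?A x" for j x
  define e where "e j = (1 + I j) * ia + (I j * I j + I j) * (M\<^sup>2 * E)" for j
  have h_le: "(\<integral>\<^sup>+x. h j x \<partial>lborel) \<le> ennreal (e j) + ?B" for j
  proof -
    have pos: "real (Suc j) > 0" by simp
    have "(1 + 1 / I j) * M\<^sup>2 * (E / real ((Suc j)\<^sup>2)) = (I j * I j + I j) * (M\<^sup>2 * E)"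
    proof -
      have "(1 + 1 / inverse n) * M\<^sup>2 * (E / n\<^sup>2) = (inverse n * inverse n + inverse n) * (M\<^sup>2 * E)" if "n > 0" for n :: real
        using that by (simp add: field_simps power2_eq_square)
      from this[OF pos] show ?thesis by (simp only: I_def of_nat_power)
    qed
    moreover have "I j > 0" unfolding I_def using pos by (rule positive_imp_inverse_positive)
    ultimately show ?thesis
      using cut[of "(Suc j)\<^sup>2" "I j"] by (simp add: h_def e_def)
  qed
  have h_meas: "h j \<in> borel_measurable lborel" for j
  proof -
    have "continuous_on ?A (\<lambda>x. log_cutoff ((Suc j)\<^sup>2) (norm x))"
    proof (rule continuous_on_compose2[of "{0<..}" "log_cutoff ((Suc j)\<^sup>2)"])
      show "continuous_on {0<..} (log_cutoff ((Suc j)\<^sup>2))"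
        by (intro continuous_at_imp_continuous_on ballI DERIV_isCont[OF log_cutoff_deriv]) auto
    qed (auto intro!: continuous_intros)
    then show ?thesis
      unfolding h_def[abs_def] by (intro nn_integrand_measurable punctured_open continuous_intros b_cont)
  qed
  have "(\<integral>\<^sup>+x\<in>?A. ennreal (- b x) \<partial>lborel) = (\<integral>\<^sup>+x. liminf (\<lambda>j. h j x) \<partial>lborel)"
  proof (rule nn_integral_cong)
    fix x :: "real^'n"
    have "\<forall>\<^sub>F j in sequentially. h j x = ennreal (- b x) * indicator ?A x"
    proof (cases "x \<in> ?A")
      case True
      then have "norm x > 0" by simp
      from log_cutoff_tendsto[OF this] show ?thesis
        by eventually_elim (simp add: h_def)
    qed (simp add: h_def)
    then have "(\<lambda>j. h j x) \<longlonglongrightarrow> ennreal (- b x) * indicator ?A x"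
      by (rule tendsto_eventually)
    then show "ennreal (- b x) * indicator ?A x = liminf (\<lambda>j. h j x)"
      by (intro lim_imp_Liminf[symmetric]) simp
  qed
  also have "\<dots> \<le> liminf (\<lambda>j. \<integral>\<^sup>+x. h j x \<partial>lborel)"
    by (rule nn_integral_liminf[OF h_meas])
  also have "\<dots> \<le> liminf (\<lambda>j. ennreal (e j) + ?B)"
    by (intro Liminf_mono always_eventually allI h_le)
  also have "\<dots> = ennreal ia + ?B"
  proof (rule lim_imp_Liminf)
    have "I \<longlonglongrightarrow> 0"
      unfolding I_def[abs_def] by (rule LIMSEQ_inverse_real_of_nat)
    then have "e \<longlonglongrightarrow> (1 + 0) * ia + (0 * 0 + 0) * (M\<^sup>2 * E)"
      unfolding e_def[abs_def] by (intro tendsto_intros)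
    then show "(\<lambda>j. ennreal (e j) + ?B) \<longlonglongrightarrow> ennreal ia + ?B"
      by (intro tendsto_add tendsto_ennrealI tendsto_const) simp
  qed simp
  finally have "(\<integral>\<^sup>+x\<in>?A. ennreal (- b x) \<partial>lborel) \<le> (\<integral>\<^sup>+x\<in>?A. ennreal (a x) \<partial>lborel) + ?B"
    by (simp only: ia(2))
  from integral_nonneg_addI[OF punctured_open a_cont b_cont a0 a_fin this]
  show ?thesis
    by (simp only: a_def b_def)
qed

end

section \<open>Semistability of radial solutions\<close>

theorem theorem1p4:
  fixes u :: "real^'n \<Rightarrow> real" and U g :: "real \<Rightarrow> real" and k :: nat
  assumes "CARD('n) \<ge> 2" and "k \<in> {1..CARD('n)}"
    and "g C1_differentiable_on UNIV" and "\<forall>t. g t > 0"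
    and "classical_solution k g u \<or> weak_solution k g u"
    and "\<forall>x\<in>ball 0 1. u x = U (norm x)" and "\<forall>r\<in>{0<..<1}. deriv U r \<ge> 0"
  shows "semistable k g u \<longleftrightarrow>
    (\<forall>\<xi>::real^'n \<Rightarrow> real. C1_compact_support (ball 0 1) \<xi> \<and> radially_symmetric \<xi> \<longrightarrow>
       integral_nonneg (ball 0 1)
         (\<lambda>x. real k * (real (CARD('n) choose k) / real CARD('n))
                * norm x powi (1 - int k) * deriv U (norm x) ^ (k - 1) * (norm (grad \<xi> x))\<^sup>2
              + deriv g (u x) * (\<xi> x)\<^sup>2))"
proof -
  interpret radial_solution u U g k
    by unfold_locales (use assms in blast)+
  have weight: "real k * (real (CARD('n) choose k) / real CARD('n))
                * norm x powi (1 - int k) * deriv U (norm x) ^ (k - 1) = radial_weight (norm x)" for x :: "real^'n"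
  proof -
    have exponent: "1 - int k = - int (k - 1)"
      using k by auto
    have "norm x powi (1 - int k) * deriv U (norm x) ^ (k - 1) = (deriv U (norm x) / norm x) ^ (k - 1)"
      unfolding exponent power_int_minus power_int_of_nat power_divide
      by (simp only: divide_inverse mult.commute)
    then show ?thesis
      by (simp add: radial_weight_def coef_def mult.assoc)
  qed
  have "integral_nonneg (ball 0 1)
         (\<lambda>x. real k * (real (CARD('n) choose k) / real CARD('n))
                * norm x powi (1 - int k) * deriv U (norm x) ^ (k - 1) * (norm (grad \<xi> x))\<^sup>2
              + deriv g (u x) * (\<xi> x)\<^sup>2)
    \<longleftrightarrow> integral_nonneg (ball 0 1 - {0})
        (\<lambda>x. radial_weight (norm x) * (norm (grad \<xi> x))\<^sup>2 + deriv g (u x) * (\<xi> x)\<^sup>2)" for \<xi> :: "real^'n \<Rightarrow> real"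
    by (simp only: weight integral_nonneg_puncture)
  note radial_form = this
  show ?thesis
    unfolding radial_form
  proof (intro iffI allI impI)
    fix \<xi> :: "real^'n \<Rightarrow> real"
    assume "semistable k g u" "C1_compact_support (ball 0 1) \<xi> \<and> radially_symmetric \<xi>"
    then show "integral_nonneg (ball 0 1 - {0})
        (\<lambda>x. radial_weight (norm x) * (norm (grad \<xi> x))\<^sup>2 + deriv g (u x) * (\<xi> x)\<^sup>2)"
      by (elim conjE) (rule radially_if_semistable)
  next
    assume *: "\<forall>\<xi>::real^'n \<Rightarrow> real. C1_compact_support (ball 0 1) \<xi> \<and> radially_symmetric \<xi> \<longrightarrow>
       integral_nonneg (ball 0 1 - {0})
        (\<lambda>x. radial_weight (norm x) * (norm (grad \<xi> x))\<^sup>2 + deriv g (u x) * (\<xi> x)\<^sup>2)"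
    show "semistable k g u"
    proof (rule semistable_if_radially)
      fix \<xi> :: "real^'n \<Rightarrow> real"
      assume "C1_compact_support (ball 0 1) \<xi>" "radially_symmetric \<xi>"
      then show "integral_nonneg (ball 0 1 - {0})
        (\<lambda>x. radial_weight (norm x) * (norm (grad \<xi> x))\<^sup>2 + deriv g (u x) * (\<xi> x)\<^sup>2)"
        using * by iprover
    qed
  qed
qed

end
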